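(* There is no hyperarithmetic procedure which calculates a maximal chain in every computable wpo, i.e. there is no hyperarithmetic function $f:\mathbb{N}\times\mathbb{N}\to\mathbb{N}$ such that for every computable wpo $P$ and every index $e$ for $P$, the function $\lambda n.f(e,n)$ is the characteristic function of a maximal chain in $P$. In fact, any function $f:\mathbb{N}\times\mathbb{N}\to\mathbb{N}$ such that, for every computable wpo $P$ with index $e$, $\lambda n.f(e,n)$ is the characteristic function of a maximal chain in $P$ must compute every hyperarithmetic set $X$ (i.e. $X\leq_T f$ for every hyperarithmetic $X\subseteq\mathbb{N}$).
   Context: A well partial order (wpo) is a well-founded partial order with no infinite antichains. A partial order $P$ (with order relation $\leq_P$) is computable if both $P\subseteq\mathbb{N}$ and ${\leq_P}\subseteq\mathbb{N}\times\mathbb{N}$ are Turing computable sets. An index for a computable partial order $P$ is a natural number $e$ coding, in a fixed standard way, Turing programs computing the characteristic functions of $P$ and of $\leq_P$. A chain in $P$ is a subset $C\subseteq P$ on which $\leq_P$ is linear; in a well-founded partial order every chain is a well-order. For well-founded $P$, the height $\operatorname{ht}(P)$ is the supremum of all ordinals which are order types of chains in $P$. A chain $C$ in $P$ is maximal if it has order type $\operatorname{ht}(P)$ (this is maximality of order type, not maximality with respect to inclusion). A set (or function, identified with its graph) is hyperarithmetic if it is Turing computable from $0^{(\alpha)}$ for some computable ordinal $\alpha$, where $0^{(\alpha)}$ is obtained by iterating the Turing jump along (a notation for) $\alpha$ starting from the empty set. $\lambda n.f(e,n)$ denotes the function $n\mapsto f(e,n)$. $\leq_T$ is Turing reducibility.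 *)

theory Defs
  imports Main "HOL-Library.Nat_Bijection"
begin

unbundle cardinal_syntax

section \<open>Oracle Turing machines\<close>

text \<open>
  A Turing program is a finite list of instructions \<open>((q, a, s), (q', s', d))\<close>: in state \<open>q\<close>,
  scanning \<open>a\<close> on the read-only oracle tape and \<open>s\<close> on the work tape, print \<open>s'\<close> on the work
  tape, move one cell (to the left if \<open>d = 0\<close>, otherwise to the right) and enter state \<open>q'\<close>.
  As in Soare's textbook, one head position is shared by the two tapes. If several instructions
  apply, the first one in the list is used; the machine halts when none applies.
  Work tape symbols are natural numbers, with \<open>0\<close> the blank; a program mentions only finitely
  many of them.
\<close>

type_synonym instruction = "(nat \<times> nat \<times> nat) \<times> (nat \<times> nat \<times> nat)"

type_synonym configuration = "nat \<times> int \<times> (int \<Rightarrow> nat)"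

definition triple_decode :: "nat \<Rightarrow> nat \<times> nat \<times> nat" where
  "triple_decode n = (let (x, m) = prod_decode n; (y, z) = prod_decode m in (x, y, z))"

definition instruction_decode :: "nat \<Rightarrow> instruction" where
  "instruction_decode n = map_prod triple_decode triple_decode (prod_decode n)"

definition program :: "nat \<Rightarrow> instruction list" where
  "program e = map instruction_decode (list_decode e)"

text \<open>
  The oracle tape carries the characteristic function of the oracle on the cells
  \<open>0, 1, 2, \<dots>\<close>; its remaining cells are blank, the blank being represented by \<open>2\<close>.
\<close>

definition oracle_tape :: "nat set \<Rightarrow> int \<Rightarrow> nat" where
  "oracle_tape A h = (if h < 0 then 2 else of_bool (nat h \<in> A))"

fun tm_step :: "nat set \<Rightarrow> nat \<Rightarrow> configuration \<Rightarrow> configuration option" where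
  "tm_step A e (q, h, T) =
     (case map_of (program e) (q, oracle_tape A h, T h) of
        None \<Rightarrow> None
      | Some (q', s', d) \<Rightarrow> Some (q', if d = 0 then h - 1 else h + 1, T(h := s')))"

text \<open>The input \<open>x\<close> is given as \<open>x + 1\<close> consecutive strokes \<open>1\<close>.\<close>

definition tm_init :: "nat \<Rightarrow> configuration" where
  "tm_init x = (0, 0, \<lambda>i. if 0 \<le> i \<and> i \<le> int x then 1 else 0)"

text \<open>
  \<open>tm_computes A e x y\<close> is the usual \<open>\<phi>\<^sub>e\<^sup>A(x) = y\<close>. The output is the number
  of strokes on the work tape when the machine halts.
\<close>

definition tm_computes :: "nat set \<Rightarrow> nat \<Rightarrow> nat \<Rightarrow> nat \<Rightarrow> bool" where
  "tm_computes A e x y \<longleftrightarrow>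
     (\<exists>q h T. (\<lambda>c c'. tm_step A e c = Some c')\<^sup>*\<^sup>* (tm_init x) (q, h, T) \<and>
        tm_step A e (q, h, T) = None \<and> y = card {i. T i = 1})"

definition tm_decides :: "nat set \<Rightarrow> nat \<Rightarrow> nat set \<Rightarrow> bool" where
  "tm_decides A e X \<longleftrightarrow> (\<forall>x. tm_computes A e x (of_bool (x \<in> X)))"

definition turing_reducible :: "nat set \<Rightarrow> nat set \<Rightarrow> bool" (infix \<open>\<le>\<^sub>T\<close> 50) where
  "X \<le>\<^sub>T A \<longleftrightarrow> (\<exists>e. tm_decides A e X)"

definition computable :: "nat set \<Rightarrow> bool" where
  "computable X \<longleftrightarrow> X \<le>\<^sub>T {}"

definition turing_jump :: "nat set \<Rightarrow> nat set" where
  "turing_jump A = {e. \<exists>y. tm_computes A e e y}"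

definition rel_code :: "(nat \<times> nat) set \<Rightarrow> nat set" where
  "rel_code r = prod_encode ` r"

definition fun_graph :: "(nat \<times> nat \<Rightarrow> nat) \<Rightarrow> nat set" where
  "fun_graph f = {prod_encode (prod_encode p, f p) | p. True}"


section \<open>Hyperarithmetic sets\<close>

text \<open>
  Kleene's system of notations for the computable ordinals, with its ordering: \<open>1\<close> denotes
  \<open>0\<close>, \<open>2 ^ a\<close> denotes the successor of the ordinal denoted by \<open>a\<close>, and \<open>3 * 5 ^ e\<close>
  denotes the limit of the ordinals denoted by \<open>\<phi>\<^sub>e(0), \<phi>\<^sub>e(1), \<dots>\<close>.
\<close>

inductive kleene_O :: "nat \<Rightarrow> bool" and kleene_less :: "nat \<Rightarrow> nat \<Rightarrow> bool" where
  O_zero: "kleene_O 1"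
| O_succ: "kleene_O a \<Longrightarrow> kleene_O (2 ^ a)"
| O_limit: "(\<And>n. tm_computes {} e n (g n)) \<Longrightarrow> (\<And>n. kleene_O (g n)) \<Longrightarrow>
    (\<And>n. kleene_less (g n) (g (Suc n))) \<Longrightarrow> kleene_O (3 * 5 ^ e)"
| less_succ: "kleene_O a \<Longrightarrow> kleene_less a (2 ^ a)"
| less_limit: "kleene_O (3 * 5 ^ e) \<Longrightarrow> tm_computes {} e n b \<Longrightarrow> kleene_less b (3 * 5 ^ e)"
| less_trans: "kleene_less a b \<Longrightarrow> kleene_less b c \<Longrightarrow> kleene_less a c"

text \<open>
  \<open>iterated_jump a H\<close> says that \<open>H\<close> is the set \<open>0\<^sup>(\<^sup>\<alpha>\<^sup>)\<close> obtained by iterating the jump along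
  the notation \<open>a\<close> of \<open>\<alpha>\<close>; at limits, the effective join is taken along the fundamental
  sequence given by the notation.
\<close>

inductive iterated_jump :: "nat \<Rightarrow> nat set \<Rightarrow> bool" where
  jump_zero: "iterated_jump 1 {}"
| jump_succ: "kleene_O a \<Longrightarrow> iterated_jump a H \<Longrightarrow> iterated_jump (2 ^ a) (turing_jump H)"
| jump_limit: "kleene_O (3 * 5 ^ e) \<Longrightarrow> (\<And>n. tm_computes {} e n (g n)) \<Longrightarrow>
    (\<And>n. iterated_jump (g n) (H n)) \<Longrightarrow>
    iterated_jump (3 * 5 ^ e) {prod_encode (x, n) | x n. x \<in> H n}"

definition hyperarithmetic :: "nat set \<Rightarrow> bool" where
  "hyperarithmetic X \<longleftrightarrow> (\<exists>a H. kleene_O a \<and> iterated_jump a H \<and> X \<le>\<^sub>T H)"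


section \<open>Well partial orders and maximal chains\<close>

text \<open>
  A partial order is given by its carrier \<open>P\<close> and its reflexive order relation \<open>r\<close>. Ordinals
  are represented by well-orders, compared by the library relations \<open>\<le>o\<close> and \<open>=o\<close>.
\<close>

definition wf_partial_order :: "'a set \<Rightarrow> 'a rel \<Rightarrow> bool" where
  "wf_partial_order P r \<longleftrightarrow> partial_order_on P r \<and> wf (r - Id)"

definition antichain :: "'a set \<Rightarrow> 'a rel \<Rightarrow> 'a set \<Rightarrow> bool" where
  "antichain P r A \<longleftrightarrow> A \<subseteq> P \<and> (\<forall>x\<in>A. \<forall>y\<in>A. x \<noteq> y \<longrightarrow> (x, y) \<notin> r)"

definition wpo :: "'a set \<Rightarrow> 'a rel \<Rightarrow> bool" where
  "wpo P r \<longleftrightarrow> wf_partial_order P r \<and> (\<forall>A. antichain P r A \<longrightarrow> finite A)"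

definition po_chain :: "'a set \<Rightarrow> 'a rel \<Rightarrow> 'a set \<Rightarrow> bool" where
  "po_chain P r C \<longleftrightarrow> C \<subseteq> P \<and> linear_order_on C (Restr r C)"

text \<open>
  \<open>has_height P r h\<close> says that the well-order \<open>h\<close> has order type \<open>ht(P)\<close>, i.e. represents the
  least upper bound of the order types of the chains. For a well-founded order on a set of natural
  numbers this is a countable ordinal, so that well-orders on natural numbers suffice.
\<close>

definition has_height :: "nat set \<Rightarrow> nat rel \<Rightarrow> nat rel \<Rightarrow> bool" where
  "has_height P r h \<longleftrightarrow>
     Well_order h \<and> (\<forall>C. po_chain P r C \<longrightarrow> Restr r C \<le>o h) \<and>
     (\<forall>h' :: nat rel. Well_order h' \<and> (\<forall>C. po_chain P r C \<longrightarrow> Restr r C \<le>o h') \<longrightarrow> h \<le>o h')"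

definition maximal_chain :: "nat set \<Rightarrow> nat rel \<Rightarrow> nat set \<Rightarrow> bool" where
  "maximal_chain P r C \<longleftrightarrow> po_chain P r C \<and> (\<exists>h. has_height P r h \<and> Restr r C =o h)"

definition computable_wpo :: "nat set \<Rightarrow> nat rel \<Rightarrow> bool" where
  "computable_wpo P r \<longleftrightarrow> wpo P r \<and> computable P \<and> computable (rel_code r)"

definition po_index :: "nat \<Rightarrow> nat set \<Rightarrow> nat rel \<Rightarrow> bool" where
  "po_index e P r \<longleftrightarrow>
     (\<exists>i j. e = prod_encode (i, j) \<and> tm_decides {} i P \<and> tm_decides {} j (rel_code r))"

definition calculates_maximal_chains :: "(nat \<times> nat \<Rightarrow> nat) \<Rightarrow> bool" where
  "calculates_maximal_chains f \<longleftrightarrow>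
     (\<forall>P r e. computable_wpo P r \<and> po_index e P r \<longrightarrow>
        (\<exists>C. maximal_chain P r C \<and> (\<forall>n. f (e, n) = of_bool (n \<in> C))))"

end

theory Submission
  imports Defs "HOL-Library.Countable"
begin

text \<open>
  Let \<open>X\<close> be a set such that both \<open>n \<in> X\<close> and \<open>n \<notin> X\<close> can be expressed by the existence of a function
  \<open>z\<close> all of whose values satisfy a fixed computable condition that looks at finitely many
  values of \<open>z\<close> at a time (\<open>\<Delta>\<^sup>1\<^sub>1\<close> definability). The finite sequences that do not yet
  violate the condition form computable trees \<open>T n 1\<close> and \<open>T n 0\<close>, exactly one of which has an
  infinite path, the first one if and only if \<open>n \<in> X\<close>. From these trees a computable well partial order is
  built, uniformly in \<open>n\<close>, whose maximal chains reveal which of the two trees is ill-founded.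

  Write \<open>S * T\<close> for the tree of pairs of nodes of equal length. The tree \<open>W\<close> whose root has the trees
  \<open>T m 0 * T m 1\<close>, for all \<open>m\<close>, as its immediate subtrees has no path, and therefore neither have
  \<open>T n 0 * W\<close> and \<open>T n 1 * W\<close>. If \<open>z\<close> is a path of \<open>T n 1\<close>, then \<open>T n 0\<close> embeds into
  \<open>T n 0 * T n 1\<close> along \<open>z\<close>, thus into an immediate subtree of \<open>W\<close>, and once more along \<open>z\<close>
  into an immediate subtree of \<open>T n 1 * W\<close>. Hence \<open>T n 0 * W\<close>, which projects to \<open>T n 0\<close>, maps to a
  proper subtree of \<open>T n 1 * W\<close>. If \<open>T n 0\<close> has a path, the roles are exchanged. So \<open>W\<close> acts as a bound for the ranks, and no ordinals need to be computed.
  To turn maps of trees into order embeddings, infinitely many copies are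
  made of every label: then the labels of a level can be mapped strictly increasingly, and the
  Kleene-Brouwer order of the one tree embeds below the root of the other one
  (\<open>tree_bounded_map\<close>). The disjoint union of the two Kleene-Brouwer orders is a
  well partial order without antichains of three elements, and its maximal chains lie in the larger
  component. As that component is the one with index \<open>1\<close> if and only if \<open>n \<in> X\<close>, a
  function which calculates maximal chains computes \<open>X\<close> (\<open>local_condition_reducible\<close>).

  Hyperarithmetic sets have such definitions. The function \<open>z\<close> describes the whole hierarchy of
  iterated jumps below a given notation, together with the complete runs of all
  machines with these oracles; every rule that it has to obey then concerns a bounded number of entries. By
  induction on the notation, the rules leave only one possibility for the jumps
  (\<open>column_set_notation\<close>).
  Finally, if \<open>fun_graph f\<close> were hyperarithmetic, the set of all \<open>p\<close> for which program \<open>p\<close> with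
  oracle \<open>fun_graph f\<close> outputs \<open>0\<close> on input \<open>p\<close> would have such a definition as well. It would thus be
  computable from \<open>fun_graph f\<close>, which is refuted by diagonalisation.

  The computability of the orders, of their indices and of the final reduction is established in a class
  of recursive functions, \<open>recursive_in\<close>, whose members are translated to register programs and these to Turing
  machines; \<open>parametrised_programs\<close> is the resulting form of the s-m-n theorem.
\<close>

section \<open>Recursive functions relative to an oracle\<close>

abbreviation pair :: "nat \<Rightarrow> nat \<Rightarrow> nat" where
  "pair a b \<equiv> prod_encode (a, b)"

definition pfst :: "nat \<Rightarrow> nat" where
  "pfst n = fst (prod_decode n)"

definition psnd :: "nat \<Rightarrow> nat" where
  "psnd n = snd (prod_decode n)"

lemma pfst_pair [simp]: "pfst (pair a b) = a"
  by (simp add: pfst_def)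

lemma psnd_pair [simp]: "psnd (pair a b) = b"
  by (simp add: psnd_def)

lemma pair_pfst_psnd [simp]: "pair (pfst n) (psnd n) = n"
  by (simp add: pfst_def psnd_def)

text \<open>
  Only total functions are needed, as everything to be computed is a characteristic function or
  produces an index. Functions of several arguments act on codes of pairs; iteration
  replaces primitive recursion, and the search operator is restricted to searches that succeed.
\<close>
inductive recursive_in :: "nat set \<Rightarrow> (nat \<Rightarrow> nat) \<Rightarrow> bool" for A where
  rec_id: "recursive_in A (\<lambda>x. x)"
| rec_zero: "recursive_in A (\<lambda>x. 0)"
| rec_Suc: "recursive_in A Suc"
| rec_pfst: "recursive_in A pfst"
| rec_psnd: "recursive_in A psnd"
| rec_oracle: "recursive_in A (\<lambda>x. of_bool (x \<in> A))"
| rec_pair: "recursive_in A f \<Longrightarrow> recursive_in A g \<Longrightarrow> recursive_in A (\<lambda>x. pair (f x) (g x))"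
| rec_comp: "recursive_in A f \<Longrightarrow> recursive_in A g \<Longrightarrow> recursive_in A (\<lambda>x. f (g x))"
| rec_iter: "recursive_in A f \<Longrightarrow> recursive_in A (\<lambda>x. (f ^^ pfst x) (psnd x))"
| rec_least: "recursive_in A f \<Longrightarrow> (\<And>x. \<exists>y. f (pair x y) = 0) \<Longrightarrow>
    recursive_in A (\<lambda>x. LEAST y. f (pair x y) = 0)"

abbreviation decidable_in :: "nat set \<Rightarrow> (nat \<Rightarrow> bool) \<Rightarrow> bool" where
  "decidable_in A P \<equiv> recursive_in A (\<lambda>x. of_bool (P x))"

named_theorems rec_intro

lemma rec_const: "recursive_in A (\<lambda>x. c)"
  by (induction c) (auto intro: rec_zero rec_comp[OF rec_Suc])

lemma rec_pfst': "recursive_in A f \<Longrightarrow> recursive_in A (\<lambda>x. pfst (f x))"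
  by (rule rec_comp[OF rec_pfst])

lemma rec_psnd': "recursive_in A f \<Longrightarrow> recursive_in A (\<lambda>x. psnd (f x))"
  by (rule rec_comp[OF rec_psnd])

lemma rec_Suc': "recursive_in A f \<Longrightarrow> recursive_in A (\<lambda>x. Suc (f x))"
  by (rule rec_comp[OF rec_Suc])

lemmas [rec_intro] = rec_id rec_const rec_pair rec_pfst' rec_psnd' rec_Suc'

text \<open>
  The state of the iteration is paired with the parameter \<open>x\<close>, which has to survive all of
  its rounds.
\<close>

lemma rec_funpow [rec_intro]:
  assumes F: "recursive_in A (\<lambda>p. F (pfst p) (psnd p))"
    and n: "recursive_in A n" and y: "recursive_in A y"
  shows "recursive_in A (\<lambda>x. (F x ^^ n x) (y x))"
proof -
  let ?G = "\<lambda>p. pair (pfst p) (F (pfst p) (psnd p))"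
  have G: "recursive_in A ?G"
    by (intro rec_intro F)
  have it: "(?G ^^ k) (pair x s) = pair x ((F x ^^ k) s)" for k x s
    by (induction k) auto
  have "recursive_in A (\<lambda>x. psnd ((\<lambda>q. (?G ^^ pfst q) (psnd q)) (pair (n x) (pair x (y x)))))"
    by (intro rec_psnd' rec_comp[OF rec_iter[OF G]] rec_intro n y)
  then show ?thesis
    by (simp add: it)
qed

lemma rec_rec_nat [rec_intro]:
  assumes F: "recursive_in A (\<lambda>p. F (pfst p) (pfst (psnd p)) (psnd (psnd p)))"
    and b: "recursive_in A b" and n: "recursive_in A n"
  shows "recursive_in A (\<lambda>x. rec_nat (b x) (F x) (n x))"
proof -
  let ?G = "\<lambda>x s. pair (Suc (pfst s)) (F x (pfst s) (psnd s))"
  have it: "(?G x ^^ k) (pair 0 s) = pair k (rec_nat s (F x) k)" for k x s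
    by (induction k) auto
  have "recursive_in A (\<lambda>p. F (pfst p) (pfst (psnd p)) (psnd (psnd p)))"
    by (rule F)
  then have "recursive_in A (\<lambda>x. psnd ((?G x ^^ n x) (pair 0 (b x))))"
    by (intro rec_intro b n)
  then show ?thesis
    by (simp add: it)
qed

lemma rec_case_nat [rec_intro]:
  assumes "recursive_in A (\<lambda>p. F (pfst p) (psnd p))"
    and "recursive_in A b" and "recursive_in A n"
  shows "recursive_in A (\<lambda>x. case n x of 0 \<Rightarrow> b x | Suc i \<Rightarrow> F x i)"
proof -
  have F: "recursive_in A (\<lambda>p. F (pfst p) (pfst (psnd p)))"
    using rec_comp[OF assms(1), of "\<lambda>p. pair (pfst p) (pfst (psnd p))"]
    by (simp add: rec_intro)
  have eq: "(case m of 0 \<Rightarrow> c | Suc i \<Rightarrow> F x i) = rec_nat c (\<lambda>i s. F x i) m" for m c x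
    by (cases m) auto
  show ?thesis
    unfolding eq by (rule rec_rec_nat) (use F assms in auto)
qed

lemma rec_add [rec_intro]:
  assumes "recursive_in A f" "recursive_in A g"
  shows "recursive_in A (\<lambda>x. f x + g x)"
proof -
  have "(Suc ^^ k) m = k + m" for k m
    by (induction k) auto
  then show ?thesis
    using rec_funpow[OF rec_Suc'[OF rec_psnd] assms] by simp
qed

lemma rec_diff [rec_intro]:
  assumes "recursive_in A f" "recursive_in A g"
  shows "recursive_in A (\<lambda>x. f x - g x)"
proof -
  have "recursive_in A (\<lambda>p. case psnd p of 0 \<Rightarrow> 0 | Suc i \<Rightarrow> i)"
    by (intro rec_intro)
  moreover have "(case m of 0 \<Rightarrow> 0 | Suc i \<Rightarrow> i) = m - 1" for m
    by (cases m) auto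
  ultimately have "recursive_in A (\<lambda>p. psnd p - 1)"
    by simp
  moreover have "((\<lambda>s. s - 1) ^^ k) m = m - k" for k m :: nat
    by (induction k) auto
  ultimately show ?thesis
    using rec_funpow[of A "\<lambda>_ s. s - 1", OF _ assms(2,1)] by simp
qed

lemma rec_mult [rec_intro]:
  assumes "recursive_in A f" "recursive_in A g"
  shows "recursive_in A (\<lambda>x. f x * g x)"
proof -
  have "recursive_in A (\<lambda>x. rec_nat 0 (\<lambda>i s. s + f x) (g x))"
    by (intro rec_intro assms rec_comp[OF assms(1)])
  moreover have "rec_nat 0 (\<lambda>i s. s + c) k = c * k" for c k :: nat
    by (induction k) auto
  ultimately show ?thesis
    by simp
qed

lemma rec_power [rec_intro]:
  assumes "recursive_in A f" "recursive_in A g"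
  shows "recursive_in A (\<lambda>x. f x ^ g x)"
proof -
  have "recursive_in A (\<lambda>x. rec_nat 1 (\<lambda>i s. s * f x) (g x))"
    by (intro rec_intro assms rec_comp[OF assms(1)])
  moreover have "rec_nat 1 (\<lambda>i s. s * c) k = c ^ k" for c k :: nat
    by (induction k) auto
  ultimately show ?thesis
    by simp
qed

lemma dec_le [rec_intro]:
  assumes "recursive_in A f" "recursive_in A g"
  shows "decidable_in A (\<lambda>x. f x \<le> g x)"
proof -
  have "of_bool (a \<le> b) = 1 - (a - b)" for a b :: nat
    by auto
  then show ?thesis
    using assms by (auto intro!: rec_intro)
qed

lemma dec_not [rec_intro]:
  assumes "decidable_in A P"
  shows "decidable_in A (\<lambda>x. \<not> P x)"
proof -
  have "of_bool (\<not> p) = 1 - (of_bool p :: nat)" for p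
    by auto
  then show ?thesis
    using assms by (auto intro!: rec_intro)
qed

lemma dec_conj [rec_intro]:
  assumes "decidable_in A P" "decidable_in A Q"
  shows "decidable_in A (\<lambda>x. P x \<and> Q x)"
  using assms by (auto simp: of_bool_conj intro!: rec_intro)

lemma dec_disj [rec_intro]:
  assumes "decidable_in A P" "decidable_in A Q"
  shows "decidable_in A (\<lambda>x. P x \<or> Q x)"
proof -
  have "decidable_in A (\<lambda>x. \<not> (\<not> P x \<and> \<not> Q x))"
    using assms by (intro rec_intro)
  then show ?thesis
    by simp
qed

lemma dec_imp [rec_intro]:
  assumes "decidable_in A P" "decidable_in A Q"
  shows "decidable_in A (\<lambda>x. P x \<longrightarrow> Q x)"
  unfolding imp_conv_disj using assms by (intro rec_intro)

lemma dec_less [rec_intro]: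
  assumes "recursive_in A f" "recursive_in A g"
  shows "decidable_in A (\<lambda>x. f x < g x)"
  unfolding not_le[symmetric] using assms by (intro rec_intro)

lemma dec_eq [rec_intro]:
  assumes "recursive_in A f" "recursive_in A g"
  shows "decidable_in A (\<lambda>x. f x = g x)"
  unfolding order_eq_iff using assms by (intro rec_intro)

lemma rec_if [rec_intro]:
  assumes "decidable_in A P" "recursive_in A f" "recursive_in A g"
  shows "recursive_in A (\<lambda>x. if P x then f x else g x)"
proof -
  have "(if p then a else b) = of_bool p * a + of_bool (\<not> p) * b" for p and a b :: nat
    by auto
  then show ?thesis
    using assms by (auto intro!: rec_intro)
qed

lemma dec_ball_less [rec_intro]:
  assumes P: "decidable_in A (\<lambda>p. P (pfst p) (psnd p))" and b: "recursive_in A b"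
  shows "decidable_in A (\<lambda>x. \<forall>i<b x. P x i)"
proof -
  have "recursive_in A (\<lambda>x. rec_nat 1 (\<lambda>i s. s * of_bool (P x i)) (b x))"
  proof (intro rec_intro b)
    have "recursive_in A (\<lambda>p. pair (pfst p) (pfst (psnd p)))"
      by (intro rec_intro)
    from rec_comp[OF P this] show "decidable_in A (\<lambda>p. P (pfst p) (pfst (psnd p)))"
      by simp
  qed
  moreover have "rec_nat 1 (\<lambda>i s. s * of_bool (P x i)) k = (of_bool (\<forall>i<k. P x i) :: nat)" for k x
    by (induction k) (auto simp: less_Suc_eq)
  ultimately show ?thesis
    by simp
qed

lemma dec_bex_less [rec_intro]:
  assumes P: "decidable_in A (\<lambda>p. P (pfst p) (psnd p))" and b: "recursive_in A b"
  shows "decidable_in A (\<lambda>x. \<exists>i<b x. P x i)"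
proof -
  have "decidable_in A (\<lambda>x. \<not> (\<forall>i<b x. \<not> P x i))"
    by (intro rec_intro assms)
  then show ?thesis
    by simp
qed

lemma rec_Least:
  assumes P: "decidable_in A (\<lambda>p. P (pfst p) (psnd p))" and ex: "\<And>x. \<exists>y. P x y"
  shows "recursive_in A (\<lambda>x. LEAST y. P x y)"
proof -
  have "recursive_in A (\<lambda>p. of_bool (\<not> P (pfst p) (psnd p)))"
    by (intro rec_intro P)
  from rec_least[OF this] ex show ?thesis
    by simp
qed

lemma rec_div2 [rec_intro]:
  assumes "recursive_in A f"
  shows "recursive_in A (\<lambda>x. f x div 2)"
proof -
  have "recursive_in A (\<lambda>x. LEAST y. x < 2 * y + 2)"
  proof (rule rec_Least)
    show "\<exists>y. x < 2 * y + 2" for x :: nat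
      by (rule exI[of _ x]) simp
  qed (intro rec_intro)
  moreover have "(LEAST y. x < 2 * y + 2) = x div 2" for x :: nat
    by (rule Least_equality) auto
  ultimately show ?thesis
    using rec_comp[OF _ assms, of "\<lambda>x. x div 2"] by simp
qed

lemma dec_even [rec_intro]:
  assumes "recursive_in A f"
  shows "decidable_in A (\<lambda>x. even (f x))"
proof -
  have even: "even n \<longleftrightarrow> n = 2 * (n div 2)" for n :: nat
    by presburger
  show ?thesis
    unfolding even by (intro rec_intro assms)
qed

text \<open>
  The selector \<open>lnth\<close> on codes of lists agrees with \<open>nth\<close> inside of the list, but it
  has a computable value also beyond its end.
\<close>

definition ltl :: "nat \<Rightarrow> nat" where
  "ltl l = psnd (l - 1)"

definition lnth :: "nat \<Rightarrow> nat \<Rightarrow> nat" where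
  "lnth l i = pfst ((ltl ^^ i) l - 1)"

definition llength :: "nat \<Rightarrow> nat" where
  "llength l = length (list_decode l)"

lemma rec_ltl_pow [rec_intro]:
  assumes "recursive_in A f" "recursive_in A g"
  shows "recursive_in A (\<lambda>x. (ltl ^^ f x) (g x))"
  unfolding ltl_def by (intro rec_intro assms)

lemma rec_lnth [rec_intro]:
  assumes "recursive_in A f" "recursive_in A g"
  shows "recursive_in A (\<lambda>x. lnth (f x) (g x))"
  unfolding lnth_def by (intro rec_intro assms)

lemma prod_encode_0: "pair 0 0 = 0"
  by (simp add: prod_encode_def)

lemma prod_decode_0: "prod_decode 0 = (0, 0)"
  by (metis prod_encode_0 prod_encode_inverse)

lemma ltl_list_encode: "ltl (list_encode xs) = list_encode (tl xs)"
  by (cases xs) (auto simp: ltl_def psnd_def prod_decode_0)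

lemma ltl_pow_list_encode: "(ltl ^^ i) (list_encode xs) = list_encode (drop i xs)"
  by (induction i) (auto simp: ltl_list_encode tl_drop drop_Suc)

lemma lnth_list_encode: "i < length xs \<Longrightarrow> lnth (list_encode xs) i = xs ! i"
  by (simp add: lnth_def ltl_pow_list_encode Cons_nth_drop_Suc[symmetric])

lemma rec_llength [rec_intro]:
  assumes "recursive_in A f"
  shows "recursive_in A (\<lambda>x. llength (f x))"
proof -
  have nil: "list_encode xs = 0 \<longleftrightarrow> xs = []" for xs
    by (cases xs) auto
  have z: "(ltl ^^ i) l = 0 \<longleftrightarrow> length (list_decode l) \<le> i" for i l
    using ltl_pow_list_encode[of i "list_decode l"] by (simp add: nil)
  have "recursive_in A (\<lambda>l. LEAST i. (ltl ^^ i) l = 0)"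
  proof (rule rec_Least)
    show "\<exists>i. (ltl ^^ i) l = 0" for l
      unfolding z by blast
  qed (intro rec_intro)
  moreover have "(LEAST i. (ltl ^^ i) l = 0) = llength l" for l
    unfolding z llength_def by (rule Least_equality) auto
  ultimately show ?thesis
    using rec_comp[OF _ assms, of llength] by simp
qed

section \<open>Register programs\<close>

datatype com =
  Inc nat
| Dec nat
| Branch nat "com list" "com list"
| Loop nat "com list"
| Query nat "com list" "com list"

text \<open>
  The remaining program is an explicit argument, as it becomes the control state of a
  Turing machine. There is no rule for decrementing a register with value \<open>0\<close>: the machine keeps
  the value as a mark on its tape, which cannot be moved to the left of cell \<open>0\<close>.
\<close>
inductive exec :: "nat set \<Rightarrow> com list \<Rightarrow> (nat \<Rightarrow> nat) \<Rightarrow> (nat \<Rightarrow> nat) \<Rightarrow> bool" for A where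
  exec_Nil: "exec A [] v v"
| exec_Inc: "exec A cs (v(r := Suc (v r))) w \<Longrightarrow> exec A (Inc r # cs) v w"
| exec_Dec: "v r = Suc n \<Longrightarrow> exec A cs (v(r := n)) w \<Longrightarrow> exec A (Dec r # cs) v w"
| exec_Branch: "exec A ((if v r = 0 then d else c) @ cs) v w \<Longrightarrow> exec A (Branch r c d # cs) v w"
| exec_Loop_end: "v r = 0 \<Longrightarrow> exec A cs v w \<Longrightarrow> exec A (Loop r c # cs) v w"
| exec_Loop: "v r \<noteq> 0 \<Longrightarrow> exec A (c @ Loop r c # cs) v w \<Longrightarrow> exec A (Loop r c # cs) v w"
| exec_Query: "exec A ((if v r \<in> A then c else d) @ cs) v w \<Longrightarrow> exec A (Query r c d # cs) v w"

lemma exec_append: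
  assumes "exec A c v u" "exec A d u w"
  shows "exec A (c @ d) v w"
  using assms by induction (auto intro: exec.intros)

lemma exec_append': "exec A c v u \<Longrightarrow> exec A d u w \<Longrightarrow> w = w' \<Longrightarrow> exec A (c @ d) v w'"
  using exec_append by blast

lemma exec_end: "v = w \<Longrightarrow> exec A [] v w"
  by (auto intro: exec_Nil)

lemma exec_Loop_round:
  "v r \<noteq> 0 \<Longrightarrow> exec A c v u \<Longrightarrow> exec A [Loop r c] u w \<Longrightarrow> exec A [Loop r c] v w"
  by (rule exec_Loop) (auto intro: exec_append)

lemma exec_Loop_zero: "v r = 0 \<Longrightarrow> v = w \<Longrightarrow> exec A [Loop r c] v w"
  by (auto intro: exec_Loop_end exec_Nil)

definition clear :: "nat \<Rightarrow> com list" where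
  "clear r = [Loop r [Dec r]]"

definition move :: "nat \<Rightarrow> nat \<Rightarrow> com list" where
  "move r s = [Loop r [Dec r, Inc s]]"

definition move2 :: "nat \<Rightarrow> nat \<Rightarrow> nat \<Rightarrow> com list" where
  "move2 r s t = [Loop r [Dec r, Inc s, Inc t]]"

lemma exec_clear: "exec A (clear r) v (v(r := 0))"
proof (induction "v r" arbitrary: v)
  case 0
  then show ?case
    by (auto simp: clear_def intro!: exec_Loop_zero)
next
  case (Suc n)
  have "exec A (clear r) (v(r := n)) (v(r := 0))"
    using Suc(1)[of "v(r := n)"] by simp
  moreover have "exec A [Dec r] v (v(r := n))"
    using Suc(2)[symmetric] by (rule exec_Dec) (rule exec_Nil)
  ultimately show ?case
    using Suc(2) exec_Loop_round unfolding clear_def by fastforce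
qed

lemma exec_move: "r \<noteq> s \<Longrightarrow> exec A (move r s) v (v(r := 0, s := v s + v r))"
proof (induction "v r" arbitrary: v)
  case 0
  then show ?case
    by (auto simp: move_def intro!: exec_Loop_zero)
next
  case (Suc n)
  have "exec A (move r s) (v(r := n, s := Suc (v s))) (v(r := 0, s := v s + v r))"
    using Suc(1)[of "v(r := n, s := Suc (v s))"] Suc(2)[symmetric] Suc(3) by (simp add: fun_upd_twist)
  moreover have "exec A [Dec r, Inc s] v (v(r := n, s := Suc (v s)))"
    by (rule exec_Dec[where v = v and r = r, OF Suc(2)[symmetric]], rule exec_Inc, rule exec_end) (use Suc(3) in simp)
  ultimately show ?case
    using Suc(2) exec_Loop_round[of v r] unfolding move_def by fastforce
qed

lemma exec_move2: "distinct [r, s, t] \<Longrightarrow>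
    exec A (move2 r s t) v (v(r := 0, s := v s + v r, t := v t + v r))"
proof (induction "v r" arbitrary: v)
  case 0
  then show ?case
    by (auto simp: move2_def intro!: exec_Loop_zero)
next
  case (Suc n)
  have "(v(r := n, s := Suc (v s), t := Suc (v t)))(r := 0, s := Suc (v s) + n, t := Suc (v t) + n)
      = v(r := 0, s := v s + v r, t := v t + v r)"
    using Suc(2,3) by (auto simp: fun_eq_iff)
  then have "exec A (move2 r s t) (v(r := n, s := Suc (v s), t := Suc (v t)))
      (v(r := 0, s := v s + v r, t := v t + v r))"
    using Suc(1)[of "v(r := n, s := Suc (v s), t := Suc (v t))"] Suc(2,3) by simp
  moreover have "exec A [Dec r, Inc s, Inc t] v (v(r := n, s := Suc (v s), t := Suc (v t)))"
    by (rule exec_Dec[where v = v and r = r, OF Suc(2)[symmetric]], rule exec_Inc, rule exec_Inc, rule exec_end)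
      (use Suc(3) in simp)
  ultimately show ?case
    using Suc(2) exec_Loop_round[of v r] unfolding move2_def by fastforce
qed

definition dup :: "nat \<Rightarrow> com list" where
  "dup b = move2 b (b + 1) (b + 2) @ move (b + 2) b"

lemma exec_dup: "\<forall>i>b. v i = 0 \<Longrightarrow> exec A (dup b) v (v(b + 1 := v b))"
  unfolding dup_def
  by (rule exec_append'[OF exec_move2 exec_move]) (auto simp: fun_eq_iff)

definition swap :: "nat \<Rightarrow> com list" where
  "swap b = move b (b + 2) @ move (b + 1) b @ move (b + 2) (b + 1)"

lemma exec_swap: "\<forall>i>b+1. v i = 0 \<Longrightarrow> exec A (swap b) v (v(b := v (b + 1), b + 1 := v b))"
  unfolding swap_def
  by (rule exec_append'[OF exec_move exec_append[OF exec_move exec_move]]) (auto simp: fun_eq_iff)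

text \<open>
  The code of a pair \<open>(m, n)\<close> is \<open>triangle (m + n) + m\<close>. The loop adds
  \<open>s, s - 1, \<dots>, 1\<close> to register \<open>b + 2\<close>, where \<open>s\<close> is the contents of register \<open>b + 1\<close>;
  register \<open>b + 3\<close> preserves the current summand.
\<close>
definition sum_triangle :: "nat \<Rightarrow> com list" where
  "sum_triangle b = [Loop (b + 1) (move2 (b + 1) (b + 2) (b + 3) @ move (b + 3) (b + 1) @ [Dec (b + 1)])]"

lemma exec_sum_triangle:
  "v (b + 3) = 0 \<Longrightarrow>
    exec A (sum_triangle b) v (v(b + 1 := 0, b + 2 := v (b + 2) + triangle (v (b + 1))))"
proof (induction "v (b + 1)" arbitrary: v)
  case 0
  then show ?case
    by (auto simp: sum_triangle_def intro!: exec_Loop_zero)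
next
  case (Suc n)
  let ?u = "v(b + 1 := n, b + 2 := v (b + 2) + Suc n)"
  have "exec A (move2 (b + 1) (b + 2) (b + 3) @ move (b + 3) (b + 1) @ [Dec (b + 1)]) v ?u"
    by (rule exec_append'[OF exec_move2 exec_append[OF exec_move exec_Dec[where n = n, OF _ exec_Nil]]])
      (use Suc(2)[symmetric] Suc(3) in \<open>auto simp: fun_eq_iff\<close>)
  moreover have "exec A (sum_triangle b) ?u (?u(b + 1 := 0, b + 2 := ?u (b + 2) + triangle (?u (b + 1))))"
    using Suc by (intro Suc) auto
  then have "exec A (sum_triangle b) ?u (v(b + 1 := 0, b + 2 := v (b + 2) + triangle (v (b + 1))))"
    by (rule back_subst[of "exec _ _ _"]) (use Suc(2)[symmetric] in \<open>simp add: fun_eq_iff\<close>)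
  ultimately show ?case
    using Suc(2) exec_Loop_round[of v "b + 1"] unfolding sum_triangle_def by fastforce
qed

definition join :: "nat \<Rightarrow> com list" where
  "join b = move2 b (b + 1) (b + 2) @ sum_triangle b @ move (b + 2) b"

lemma exec_join:
  assumes "\<forall>i>b+1. v i = 0"
  shows "exec A (join b) v (v(b := pair (v b) (v (b + 1)), b + 1 := 0))"
  unfolding join_def
  by (rule exec_append'[OF exec_move2 exec_append[OF exec_sum_triangle exec_move]])
    (use assms in \<open>auto simp: fun_eq_iff prod_encode_def ac_simps\<close>)

text \<open>The successor of a pair in the order of the codes, on the registers \<open>b + 1\<close> and \<open>b + 2\<close>.\<close>

definition next_pair :: "nat \<Rightarrow> com list" where
  "next_pair b = [Branch (b + 2) [Dec (b + 2), Inc (b + 1)] (move (b + 1) (b + 2) @ [Inc (b + 2)])]"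

lemma exec_next_pair:
  assumes "pair (v (b + 1)) (v (b + 2)) = n"
  shows "exec A (next_pair b) v (v(b + 1 := pfst (Suc n), b + 2 := psnd (Suc n)))"
proof (cases "v (b + 2)")
  case 0
  then have "Suc n = pair 0 (Suc (v (b + 1)))"
    using assms by (simp add: prod_encode_def)
  moreover have "exec A (move (b + 1) (b + 2) @ [Inc (b + 2)]) v
      (v(b + 1 := 0, b + 2 := Suc (v (b + 1))))"
    using 0 by (intro exec_append'[OF exec_move exec_Inc[OF exec_Nil]]) auto
  ultimately show ?thesis
    unfolding next_pair_def by (intro exec_Branch) (use 0 in simp)
next
  case (Suc k)
  then have "Suc n = pair (Suc (v (b + 1))) k"
    using assms by (simp add: prod_encode_def)
  then show ?thesis
    unfolding next_pair_def
    by (intro exec_Branch) (use Suc in \<open>auto simp: fun_eq_iff intro!: exec_Dec exec_Inc exec_end\<close>)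
qed

text \<open>
  Decoding counts through all pairs in the order of their codes.
\<close>
definition split :: "nat \<Rightarrow> com list" where
  "split b = [Loop b (Dec b # next_pair b)] @ move (b + 1) b @ move (b + 2) (b + 1)"

lemma exec_split_loop:
  "pair (v (b + 1)) (v (b + 2)) = n \<Longrightarrow>
    exec A [Loop b (Dec b # next_pair b)] v (v(b := 0, b + 1 := pfst (n + v b), b + 2 := psnd (n + v b)))"
proof (induction "v b" arbitrary: v n)
  case 0
  then show ?case
    by (auto intro!: exec_Loop_zero)
next
  case (Suc m)
  let ?u = "v(b := m, b + 1 := pfst (Suc n), b + 2 := psnd (Suc n))"
  have "exec A (next_pair b) (v(b := m)) ((v(b := m))(b + 1 := pfst (Suc n), b + 2 := psnd (Suc n)))"
    using Suc by (intro exec_next_pair) auto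
  then have "exec A (Dec b # next_pair b) v ?u"
    using Suc(2) by (intro exec_Dec) auto
  moreover have "exec A [Loop b (Dec b # next_pair b)] ?u
      (?u(b := 0, b + 1 := pfst (Suc n + ?u b), b + 2 := psnd (Suc n + ?u b)))"
    using Suc by (intro Suc) auto
  then have "exec A [Loop b (Dec b # next_pair b)] ?u
      (v(b := 0, b + 1 := pfst (n + v b), b + 2 := psnd (n + v b)))"
    by (rule back_subst[of "exec _ _ _"]) (use Suc(2)[symmetric] in \<open>simp add: fun_eq_iff\<close>)
  ultimately show ?case
    by (rule exec_Loop_round[rotated]) (use Suc(2) in simp)
qed

lemma exec_split:
  assumes "\<forall>i>b. v i = 0"
  shows "exec A (split b) v (v(b := pfst (v b), b + 1 := psnd (v b)))"
  unfolding split_def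
  by (rule exec_append'[OF exec_split_loop[where n = 0] exec_append[OF exec_move exec_move]])
    (use assms in \<open>auto simp: fun_eq_iff prod_encode_0\<close>)

text \<open>
  Programs are composed with a stack discipline: a program for \<open>f\<close> at base \<open>b\<close> replaces the
  contents of register \<open>b\<close> by its image, finds the registers above \<open>b\<close> empty, leaves
  them empty, and does not touch the registers below \<open>b\<close>.
\<close>

definition computes_at :: "nat set \<Rightarrow> nat \<Rightarrow> com list \<Rightarrow> (nat \<Rightarrow> nat) \<Rightarrow> bool" where
  "computes_at A b c f \<longleftrightarrow> (\<forall>v. (\<forall>i>b. v i = 0) \<longrightarrow> exec A c v (v(b := f (v b))))"

lemma computes_atD: "computes_at A b c f \<Longrightarrow> \<forall>i>b. v i = 0 \<Longrightarrow> exec A c v (v(b := f (v b)))"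
  by (auto simp: computes_at_def)

lemma computes_at_comp:
  assumes "computes_at A b c f" "computes_at A b d g"
  shows "computes_at A b (d @ c) (\<lambda>x. f (g x))"
  unfolding computes_at_def
  by (intro allI impI, rule exec_append'[OF computes_atD[OF assms(2)] computes_atD[OF assms(1)]]) auto

text \<open>
  The second component is computed first, on a copy of the argument. It then changes places with
  the argument because the program for the first component needs empty registers above its base.
\<close>
lemma computes_at_pair:
  assumes "computes_at A (b + 1) c f" "computes_at A (b + 1) d g"
  shows "computes_at A b (dup b @ d @ swap b @ c @ swap b @ join b)
    (\<lambda>x. pair (f x) (g x))"
  unfolding computes_at_def
  by (intro allI impI,
      rule exec_append'[OF exec_dup exec_append[OF computes_atD[OF assms(2)] exec_append[OF exec_swap
            exec_append[OF computes_atD[OF assms(1)] exec_append[OF exec_swap exec_join]]]]])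
    auto

lemma computes_at_pfst: "computes_at A b (split b @ clear (b + 1)) pfst"
  unfolding computes_at_def
  by (intro allI impI, rule exec_append'[OF exec_split exec_clear]) auto

lemma computes_at_psnd: "computes_at A b (split b @ clear b @ move (b + 1) b) psnd"
  unfolding computes_at_def
  by (intro allI impI, rule exec_append'[OF exec_split exec_append[OF exec_clear exec_move]])
    (auto simp: fun_eq_iff)

lemma computes_at_oracle:
  "computes_at A b [Query b (clear b @ [Inc b]) (clear b)] (\<lambda>x. of_bool (x \<in> A))"
  unfolding computes_at_def
proof (intro allI impI)
  fix v :: "nat \<Rightarrow> nat"
  have "exec A (clear b @ [Inc b]) v (v(b := 1))"
    by (rule exec_append'[OF exec_clear exec_Inc[OF exec_Nil]]) auto
  moreover have "exec A (clear b) v (v(b := 0))"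
    by (rule exec_clear)
  ultimately show "exec A [Query b (clear b @ [Inc b]) (clear b)] v (v(b := of_bool (v b \<in> A)))"
    by (intro exec_Query) auto
qed

lemma exec_iter_loop:
  assumes "computes_at A (b + 1) c f" "\<forall>i>b+1. v i = 0"
  shows "exec A [Loop b (Dec b # c)] v (v(b := 0, b + 1 := (f ^^ v b) (v (b + 1))))"
  using assms(2)
proof (induction "v b" arbitrary: v)
  case 0
  then show ?case
    by (auto intro!: exec_Loop_zero)
next
  case (Suc m)
  let ?u = "v(b := m, b + 1 := f (v (b + 1)))"
  have "exec A c (v(b := m)) ((v(b := m))(b + 1 := f ((v(b := m)) (b + 1))))"
    using Suc by (intro computes_atD[OF assms(1)]) auto
  then have "exec A (Dec b # c) v ?u"
    using Suc(2) by (intro exec_Dec) auto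
  moreover have "exec A [Loop b (Dec b # c)] ?u (?u(b := 0, b + 1 := (f ^^ ?u b) (?u (b + 1))))"
    using Suc by (intro Suc) auto
  then have "exec A [Loop b (Dec b # c)] ?u (v(b := 0, b + 1 := (f ^^ v b) (v (b + 1))))"
    by (rule back_subst[of "exec _ _ _"])
      (use Suc(2)[symmetric] in \<open>simp add: fun_eq_iff funpow_swap1\<close>)
  ultimately show ?case
    by (rule exec_Loop_round[rotated]) (use Suc(2) in simp)
qed

lemma computes_at_iter:
  assumes "computes_at A (b + 1) c f"
  shows "computes_at A b (split b @ [Loop b (Dec b # c)] @ move (b + 1) b)
    (\<lambda>x. (f ^^ pfst x) (psnd x))"
  unfolding computes_at_def
  by (intro allI impI,
      rule exec_append'[OF exec_split exec_append[OF exec_iter_loop[OF assms] exec_move]])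
    (auto simp: fun_eq_iff)

text \<open>
  A search keeps the pair of the parameter and the current candidate in register \<open>b\<close> and
  the value of the test in register \<open>b + 1\<close>.
\<close>

lemma exec_search_loop:
  assumes f: "computes_at A (b + 1) c f" and g: "computes_at A b d g"
    and "f ((g ^^ n) (v b)) = 0" "\<forall>i<n. f ((g ^^ i) (v b)) \<noteq> 0"
    and "v (b + 1) = f (v b)" "\<forall>i>b+1. v i = 0"
  shows "exec A [Loop (b + 1) (clear (b + 1) @ d @ dup b @ c)] v (v(b := (g ^^ n) (v b), b + 1 := 0))"
  using assms(3-)
proof (induction n arbitrary: v)
  case 0
  then show ?case
    by (auto intro!: exec_Loop_zero)
next
  case (Suc n)
  let ?c = "clear (b + 1) @ d @ dup b @ c"
  let ?u = "v(b := g (v b), b + 1 := f (g (v b)))"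
  have nz: "v (b + 1) \<noteq> 0"
    using Suc.prems by auto
  have "exec A ?c v ?u"
    by (rule exec_append'[OF exec_clear exec_append[OF computes_atD[OF g]
          exec_append[OF exec_dup computes_atD[OF f]]]]) (use Suc in auto)
  moreover have "exec A [Loop (b + 1) ?c] ?u (?u(b := (g ^^ n) (?u b), b + 1 := 0))"
  proof (rule Suc.IH)
    show "\<forall>i<n. f ((g ^^ i) (?u b)) \<noteq> 0"
    proof (intro allI impI)
      fix i assume "i < n"
      then have "f ((g ^^ Suc i) (v b)) \<noteq> 0"
        using Suc.prems(2) Suc_less_eq by blast
      then show "f ((g ^^ i) (?u b)) \<noteq> 0"
        by (simp add: funpow_swap1)
    qed
  qed (use Suc in \<open>auto simp: funpow_swap1\<close>)
  then have "exec A [Loop (b + 1) ?c] ?u (v(b := (g ^^ Suc n) (v b), b + 1 := 0))"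
    by (rule back_subst[of "exec _ _ _"]) (simp add: fun_eq_iff funpow_swap1)
  ultimately show ?case
    by (rule exec_Loop_round[where v = v and r = "b + 1", OF nz])
qed

lemma computes_at_search:
  assumes f: "computes_at A (b + 1) c f" and g: "computes_at A b d g" and s: "computes_at A b e s"
    and h: "\<And>x. f ((g ^^ h x) (s x)) = 0" "\<And>x i. i < h x \<Longrightarrow> f ((g ^^ i) (s x)) \<noteq> 0"
  shows "computes_at A b (e @ dup b @ c @ [Loop (b + 1) (clear (b + 1) @ d @ dup b @ c)])
    (\<lambda>x. (g ^^ h x) (s x))"
  unfolding computes_at_def
proof (intro allI impI)
  fix v :: "nat \<Rightarrow> nat"
  assume v: "\<forall>i>b. v i = 0"
  show "exec A (e @ dup b @ c @ [Loop (b + 1) (clear (b + 1) @ d @ dup b @ c)]) v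
      (v(b := (g ^^ h (v b)) (s (v b))))"
    by (rule exec_append'[OF computes_atD[OF s] exec_append[OF exec_dup exec_append[OF computes_atD[OF f]
            exec_search_loop[OF f g, of "h (v b)"]]]])
      (use v h in \<open>auto simp: fun_eq_iff\<close>)
qed

theorem recursive_in_program:
  assumes "recursive_in A f"
  shows "\<exists>c. computes_at A b c f"
  using assms
proof (induction arbitrary: b)
  case rec_id
  show ?case
    by (rule exI[of _ "[]"]) (auto simp: computes_at_def intro: exec_end)
next
  case rec_zero
  show ?case
    by (rule exI[of _ "clear b"]) (auto simp: computes_at_def intro: exec_clear)
next
  case rec_Suc
  show ?case
    by (rule exI[of _ "[Inc b]"]) (auto simp: computes_at_def intro!: exec_Inc exec_end)
next
  case (rec_least f)
  obtain c where c: "computes_at A (b + 1) c f"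
    using rec_least.IH by blast
  define g where "g = (\<lambda>p. pair (pfst p) (Suc (psnd p)))"
  obtain s where s: "computes_at A (b + 1) s Suc"
    by (metis computes_at_def exec_Inc exec_Nil)
  have id: "computes_at A (b + 1) [] (\<lambda>x. x)" and zero: "computes_at A (b + 1) (clear (b + 1)) (\<lambda>x. 0)"
    by (auto simp: computes_at_def intro: exec_end exec_clear)
  obtain d where d: "computes_at A b d g"
    using computes_at_pair[OF computes_at_pfst computes_at_comp[OF s computes_at_psnd]]
    unfolding g_def by blast
  obtain e where e: "computes_at A b e (\<lambda>x. pair x 0)"
    using computes_at_pair[OF id zero] by blast
  have g: "(g ^^ i) p = pair (pfst p) (psnd p + i)" for i p
    by (induction i) (auto simp: g_def)
  define h where "h x = (LEAST i. f (pair x i) = 0)" for x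
  have "computes_at A b (e @ dup b @ c @ [Loop (b + 1) (clear (b + 1) @ d @ dup b @ c)])
      (\<lambda>x. (g ^^ h x) (pair x 0))"
  proof (rule computes_at_search[OF c d e])
    show "f ((g ^^ h x) (pair x 0)) = 0" for x
      unfolding g h_def using rec_least.hyps(2)[of x] by (auto intro: LeastI_ex)
    show "f ((g ^^ i) (pair x 0)) \<noteq> 0" if "i < h x" for x i
      using that not_less_Least unfolding g h_def by auto
  qed
  from computes_at_comp[OF computes_at_psnd this] show ?case
    by (auto simp: g h_def)
next
  case rec_pfst
  show ?case
    using computes_at_pfst by blast
next
  case rec_psnd
  show ?case
    using computes_at_psnd by blast
next
  case rec_oracle
  show ?case
    using computes_at_oracle by blast
next
  case (rec_pair f g)
  obtain c d where "computes_at A (b + 1) c f" "computes_at A (b + 1) d g"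
    using rec_pair.IH by blast
  from computes_at_pair[OF this] show ?case
    by blast
next
  case (rec_comp f g)
  obtain c d where "computes_at A b c f" "computes_at A b d g"
    using rec_comp.IH by blast
  from computes_at_comp[OF this] show ?case
    by blast
next
  case (rec_iter f)
  obtain c where "computes_at A (b + 1) c f"
    using rec_iter.IH by blast
  from computes_at_iter[OF this] show ?case
    by blast
qed

section \<open>Compiling register programs to Turing machines\<close>

instance com :: countable
  by countable_datatype

text \<open>
  The residuals of a program are the programs that may remain to be executed while it runs. They
  serve as control states of the Turing machine, which spares a numbering of
  program positions; there are finitely many of them, and execution steps do not lead out of them.
\<close>
fun residuals :: "com list \<Rightarrow> com list set" where
  "residuals [] = {[]}"
| "residuals (Inc r # e) = insert (Inc r # e) (residuals e)"
| "residuals (Dec r # e) = insert (Dec r # e) (residuals e)"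
| "residuals (Branch r c d # e) =
     insert (Branch r c d # e) ((\<lambda>x. x @ e) ` (residuals c \<union> residuals d) \<union> residuals e)"
| "residuals (Loop r c # e) =
     insert (Loop r c # e) ((\<lambda>x. x @ Loop r c # e) ` residuals c \<union> residuals e)"
| "residuals (Query r c d # e) =
     insert (Query r c d # e) ((\<lambda>x. x @ e) ` (residuals c \<union> residuals d) \<union> residuals e)"

fun continuations :: "com list \<Rightarrow> com list set" where
  "continuations [] = {}"
| "continuations (Inc r # e) = {e}"
| "continuations (Dec r # e) = {e}"
| "continuations (Branch r c d # e) = {c @ e, d @ e}"
| "continuations (Loop r c # e) = {c @ Loop r c # e, e}"
| "continuations (Query r c d # e) = {c @ e, d @ e}"

lemma finite_residuals: "finite (residuals c)"
  by (induction c rule: residuals.induct) auto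

lemma self_in_residuals: "c \<in> residuals c"
  by (induction c rule: residuals.induct) auto

lemma continuations_append:
  "c \<noteq> [] \<Longrightarrow> continuations (c @ e) = (\<lambda>x. x @ e) ` continuations c"
  by (cases c rule: continuations.cases) auto

lemma continuations_append_residuals:
  assumes "\<And>d. d \<in> residuals c \<Longrightarrow> continuations d \<subseteq> residuals c" "d \<in> residuals c"
    and "continuations e \<subseteq> X" "(\<lambda>x. x @ e) ` residuals c \<subseteq> X"
  shows "continuations (d @ e) \<subseteq> X"
proof (cases "d = []")
  case True
  then show ?thesis
    using assms(3) by simp
next
  case False
  have "(\<lambda>x. x @ e) ` continuations d \<subseteq> X"
    using assms(1)[OF assms(2)] assms(4) by blast
  then show ?thesis
    by (simp add: continuations_append[OF False])
qed

lemma residuals_closed: "d \<in> residuals c \<Longrightarrow> continuations d \<subseteq> residuals c"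
proof (induction c arbitrary: d rule: residuals.induct)
  case (4 r c1 c2 e)
  let ?R = "residuals (Branch r c1 c2 # e)"
  have e: "continuations e \<subseteq> ?R"
    using 4(3)[OF self_in_residuals] by auto
  consider "d = Branch r c1 c2 # e" | x where "d = x @ e" "x \<in> residuals c1"
    | x where "d = x @ e" "x \<in> residuals c2" | "d \<in> residuals e"
    using "4.prems" by auto
  then show ?case
  proof cases
    case 1
    then show ?thesis
      using self_in_residuals[of c1] self_in_residuals[of c2] by auto
  next
    case (2 x)
    show ?thesis
      unfolding 2(1) by (rule continuations_append_residuals[OF 4(1) 2(2) e]) auto
  next
    case (3 x)
    show ?thesis
      unfolding 3(1) by (rule continuations_append_residuals[OF 4(2) 3(2) e]) auto
  next
    case 4
    then show ?thesis
      using "4.IH"(3) by auto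
  qed
next
  case (5 r c e)
  let ?R = "residuals (Loop r c # e)"
  have e: "continuations (Loop r c # e) \<subseteq> ?R"
    using self_in_residuals[of c] self_in_residuals[of e] by auto
  consider "d = Loop r c # e" | x where "d = x @ Loop r c # e" "x \<in> residuals c" | "d \<in> residuals e"
    using "5.prems" by auto
  then show ?case
  proof cases
    case 1
    then show ?thesis
      using e by simp
  next
    case (2 x)
    show ?thesis
      unfolding 2(1) by (rule continuations_append_residuals[OF 5(1) 2(2) e]) auto
  next
    case 3
    then show ?thesis
      using "5.IH"(2) by auto
  qed
next
  case (6 r c1 c2 e)
  let ?R = "residuals (Query r c1 c2 # e)"
  have e: "continuations e \<subseteq> ?R"
    using 6(3)[OF self_in_residuals] by auto
  consider "d = Query r c1 c2 # e" | x where "d = x @ e" "x \<in> residuals c1"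
    | x where "d = x @ e" "x \<in> residuals c2" | "d \<in> residuals e"
    using "6.prems" by auto
  then show ?case
  proof cases
    case 1
    then show ?thesis
      using self_in_residuals[of c1] self_in_residuals[of c2] by auto
  next
    case (2 x)
    show ?thesis
      unfolding 2(1) by (rule continuations_append_residuals[OF 6(1) 2(2) e]) auto
  next
    case (3 x)
    show ?thesis
      unfolding 3(1) by (rule continuations_append_residuals[OF 6(2) 3(2) e]) auto
  next
    case 4
    then show ?thesis
      using "6.IH"(3) by auto
  qed
next
  case (2 r e)
  then show ?case
    using self_in_residuals[of e] by auto
next
  case (3 r e)
  then show ?case
    using self_in_residuals[of e] by auto
qed auto

fun registers :: "com list \<Rightarrow> nat set" where
  "registers [] = {}"
| "registers (Inc r # e) = insert r (registers e)"
| "registers (Dec r # e) = insert r (registers e)"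
| "registers (Branch r c d # e) = insert r (registers c \<union> registers d \<union> registers e)"
| "registers (Loop r c # e) = insert r (registers c \<union> registers e)"
| "registers (Query r c d # e) = insert r (registers c \<union> registers d \<union> registers e)"

lemma finite_registers: "finite (registers c)"
  by (induction c rule: registers.induct) auto

lemma registers_append [simp]: "registers (c @ e) = registers c \<union> registers e"
  by (induction c rule: registers.induct) auto

lemma registers_residuals: "d \<in> residuals c \<Longrightarrow> registers d \<subseteq> registers c"
  by (induction c arbitrary: d rule: residuals.induct) fastforce+

text \<open>
  The work tape represents the registers by marks: a cell carries a finite set, encoded by
  \<open>set_encode\<close>, which contains \<open>Suc r\<close> if the cell is number \<open>v r\<close>, where \<open>v r\<close> is
  the value of register \<open>r\<close>. The element \<open>0\<close> stands for the strokes of the input, so that the symbols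
  \<open>0\<close> and \<open>1\<close> of the initial tape are the sets \<open>{}\<close> and \<open>{0}\<close>. As both
  tapes share the head, the oracle is asked about \<open>v r\<close> by going to the mark of \<open>r\<close>, and cell
  \<open>-1\<close> is recognised by the blank of the oracle tape.

  Every command starts in cell \<open>0\<close>, where it can see which registers are empty. \<open>Rewind d\<close> goes there
  and continues with \<open>d\<close>; \<open>Run d\<close> executes the first command of \<open>d\<close>; \<open>Mark r d\<close> puts the mark of
  \<open>r\<close> into the cell scanned. The phases \<open>Start\<close>, \<open>Init\<close>, \<open>Seek\<close> and \<open>Place\<close> create the
  initial marks: the input is moved to register \<open>0\<close> by searching for the end of the strokes,
  register \<open>1\<close> is already marked, and the other registers are empty. In the end,
  \<open>Run []\<close> writes as many strokes as register \<open>0\<close> says, and \<open>Erase\<close> removes the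
  remaining input.
\<close>
datatype phase = Start | Init | Seek | Place | Erase
  | Rewind "com list" | Run "com list" | Mark nat "com list"

instance phase :: countable
  by countable_datatype

fun delta :: "nat \<Rightarrow> com list \<Rightarrow> phase \<Rightarrow> nat \<Rightarrow> nat set \<Rightarrow> (phase \<times> nat set \<times> nat) option" where
  "delta k c Start a S = Some (if a = 2 then (Init, S, 1) else (Start, S, 0))"
| "delta k c Init a S = Some (Seek, S \<union> {3..k}, 1)"
| "delta k c Seek a S = Some (if 0 \<in> S then (Seek, S, 1) else (Place, S, 0))"
| "delta k c Place a S = Some (Rewind c, insert 1 S, 0)"
| "delta k c (Rewind d) a S = Some (if a = 2 then (Run d, S, 1) else (Rewind d, S, 0))"
| "delta k c (Mark r d) a S = Some (Rewind d, insert (Suc r) S, 0)"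
| "delta k c (Run (Inc r # e)) a S =
     Some (if Suc r \<in> S then (Mark r e, S - {Suc r}, 1) else (Run (Inc r # e), S, 1))"
| "delta k c (Run (Dec r # e)) a S =
     Some (if Suc r \<in> S then (Mark r e, S - {Suc r}, 0) else (Run (Dec r # e), S, 1))"
| "delta k c (Run (Branch r d1 d2 # e)) a S =
     Some (Rewind ((if Suc r \<in> S then d2 else d1) @ e), S, 0)"
| "delta k c (Run (Loop r d # e)) a S =
     Some (Rewind (if Suc r \<in> S then e else d @ Loop r d # e), S, 0)"
| "delta k c (Run (Query r d1 d2 # e)) a S =
     Some (if Suc r \<in> S then (Rewind ((if a = 1 then d1 else d2) @ e), S, 0)
           else (Run (Query r d1 d2 # e), S, 1))"
| "delta k c (Run []) a S = Some (if 1 \<in> S then (Erase, {}, 1) else (Run [], {0}, 1))"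
| "delta k c Erase a S = (if 0 \<in> S then Some (Erase, {}, 1) else None)"

definition phases :: "nat \<Rightarrow> com list \<Rightarrow> phase set" where
  "phases k c = {Start, Init, Seek, Place, Erase} \<union> Rewind ` residuals c \<union> Run ` residuals c
     \<union> (\<lambda>(r, d). Mark r d) ` ({..<k} \<times> residuals c)"

lemma finite_phases: "finite (phases k c)"
  by (auto simp: phases_def finite_residuals)

text \<open>
  Odd numbers are used for these states; the even ones are left to the part of the
  program that depends on a parameter. In particular, the initial state \<open>0\<close> belongs to that part.
\<close>
definition num :: "phase \<Rightarrow> nat" where
  "num p = 2 * to_nat p + 1"

lemma num_eq [simp]: "num p = num q \<longleftrightarrow> p = q"
  by (auto simp: num_def)

lemma finite_map_is_map_of:
  assumes "finite (dom m)"
  obtains L where "map_of L = m"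
proof -
  obtain xs where "set xs = dom m"
    using finite_list[OF assms] by (rule exE)
  then show ?thesis
    by (rule that[OF map_of_map_keys])
qed

definition encode_action :: "phase \<times> nat set \<times> nat \<Rightarrow> nat \<times> nat \<times> nat" where
  "encode_action = (\<lambda>(p, S, d). (num p, set_encode S, d))"

lemma delta_table:
  obtains L where
    "\<And>p a S. p \<in> phases k c \<Longrightarrow> a < 3 \<Longrightarrow> S \<subseteq> {..k} \<Longrightarrow>
       map_of L (num p, a, set_encode S) = map_option encode_action (delta k c p a S)"
proof -
  define m where "m = (\<lambda>(q, a, s).
    if q \<in> num ` phases k c \<and> a < (3::nat) \<and> set_decode s \<subseteq> {..k}
    then map_option encode_action (delta k c (inv num q) a (set_decode s)) else None)"
  have inv: "inv num (num p) = p" for p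
    by (rule inv_f_f) (auto simp: inj_def)
  have "dom m \<subseteq> num ` phases k c \<times> {..<3} \<times> set_encode ` Pow {..k}"
  proof
    fix x
    assume "x \<in> dom m"
    then obtain q a s where x: "x = (q, a, s)"
      and "q \<in> num ` phases k c" "a < 3" "set_decode s \<subseteq> {..k}"
      by (cases x) (auto simp: m_def dom_def split: if_splits)
    moreover from this have "s \<in> set_encode ` Pow {..k}"
      by (auto intro!: image_eqI[of _ _ "set_decode s"])
    ultimately show "x \<in> num ` phases k c \<times> {..<3} \<times> set_encode ` Pow {..k}"
      by auto
  qed
  then have "finite (dom m)"
    by (rule finite_subset) (auto simp: finite_phases)
  then obtain L where L: "map_of L = m"
    by (rule finite_map_is_map_of)
  show ?thesis
  proof
    show "map_of L (num p, a, set_encode S) = map_option encode_action (delta k c p a S)"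
      if "p \<in> phases k c" "a < 3" "S \<subseteq> {..k}" for p a S
      using that finite_subset[OF that(3)] by (simp add: L m_def inv)
  qed
qed

text \<open>
  The program \<open>e\<close> may contain further instructions, as long as it behaves like \<open>delta\<close> in the
  states of the phases.
\<close>
locale compiled =
  fixes A :: "nat set" and e :: nat and k :: nat and c :: "com list"
  assumes table: "\<And>p a S. p \<in> phases k c \<Longrightarrow> a < 3 \<Longrightarrow> S \<subseteq> {..k} \<Longrightarrow>
      map_of (program e) (num p, a, set_encode S) = map_option encode_action (delta k c p a S)"
    and two_le: "2 \<le> k" and below: "registers c \<subseteq> {..<k}"
begin

definition reach :: "configuration \<Rightarrow> configuration \<Rightarrow> bool" where
  "reach = (\<lambda>c c'. tm_step A e c = Some c')\<^sup>*\<^sup>*"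

lemma reach_refl [simp]: "reach a a"
  by (simp add: reach_def)

lemma reach_trans [trans]: "reach y z \<Longrightarrow> reach z z' \<Longrightarrow> reach y z'"
  unfolding reach_def by (rule rtranclp_trans)

lemma reach_tm_step: "tm_step A e a = Some b \<Longrightarrow> reach a b"
  by (auto simp: reach_def simp del: tm_step.simps)

definition conf :: "phase \<Rightarrow> int \<Rightarrow> (int \<Rightarrow> nat set) \<Rightarrow> configuration" where
  "conf p h C = (num p, h, \<lambda>i. set_encode (C i))"

definition tape :: "nat \<Rightarrow> (nat \<Rightarrow> nat) \<Rightarrow> int \<Rightarrow> nat set" where
  "tape x v h = (if 0 \<le> h \<and> h \<le> int x then {0} else {}) \<union> {Suc r | r. r < k \<and> int (v r) = h}"

lemma tape_bounded: "tape x v i \<subseteq> {..k}"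
  by (auto simp: tape_def)

lemma zero_in_tape [simp]: "0 \<in> tape x v i \<longleftrightarrow> 0 \<le> i \<and> i \<le> int x"
  by (auto simp: tape_def)

lemma Suc_in_tape [simp]: "Suc r \<in> tape x v i \<longleftrightarrow> r < k \<and> int (v r) = i"
  by (auto simp: tape_def)

lemma tm_step_conf:
  assumes "p \<in> phases k c" "C h \<subseteq> {..k}"
  shows "tm_step A e (conf p h C) =
    map_option (\<lambda>(p', S, d). conf p' (if d = 0 then h - 1 else h + 1) (C(h := S)))
      (delta k c p (oracle_tape A h) (C h))"
proof -
  have "oracle_tape A h < 3"
    by (auto simp: oracle_tape_def)
  note t = table[OF assms(1) this assms(2)]
  show ?thesis
  proof (cases "delta k c p (oracle_tape A h) (C h)")
    case None
    then show ?thesis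
      using t by (simp add: conf_def)
  next
    case (Some y)
    obtain p' S d where y: "y = (p', S, d)"
      by (cases y)
    have "(\<lambda>i. set_encode (C i))(h := set_encode S) = (\<lambda>i. set_encode ((C(h := S)) i))"
      by (rule ext) simp
    then show ?thesis
      using t Some by (simp add: conf_def y encode_action_def)
  qed
qed

lemma reach_step:
  assumes "p \<in> phases k c" "C h \<subseteq> {..k}" "delta k c p (oracle_tape A h) (C h) = Some (p', S, d)"
    and "h' = (if d = 0 then h - 1 else h + 1)" "C' = C(h := S)"
  shows "reach (conf p h C) (conf p' h' C')"
  using tm_step_conf[where C = C and p = p and h = h] assms by (intro reach_tm_step) simp

lemma oracle_tape_eq_2 [simp]: "oracle_tape A h = 2 \<longleftrightarrow> h < 0"
  by (auto simp: oracle_tape_def of_bool_def)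

lemma oracle_tape_eq_1: "oracle_tape A (int n) = Suc 0 \<longleftrightarrow> n \<in> A"
  by (auto simp: oracle_tape_def of_bool_def)

lemma scan_left:
  assumes p: "p \<in> phases k c" "\<And>i. C i \<subseteq> {..k}"
    and left: "\<And>a S. delta k c p a S = Some (if a = 2 then (p', S, 1) else (p, S, 0))"
    and h: "- 1 \<le> h"
  shows "reach (conf p h C) (conf p' 0 C)"
  using h
proof (induction "nat (h + 1)" arbitrary: h)
  case 0
  then have "h = - 1"
    by simp
  then show ?case
    by (intro reach_step[OF p]) (auto simp: left)
next
  case (Suc n)
  then have "reach (conf p h C) (conf p (h - 1) C)"
    by (intro reach_step[OF p]) (auto simp: left)
  also have "reach (conf p (h - 1) C) (conf p' 0 C)"
    using Suc by (intro Suc) auto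
  finally show ?case .
qed

lemma scan_right:
  assumes p: "p \<in> phases k c" "\<And>i. C i \<subseteq> {..k}"
    and right: "\<And>i. l \<le> i \<Longrightarrow> i < h \<Longrightarrow> delta k c p (oracle_tape A i) (C i) = Some (p, C i, 1)"
    and h: "l \<le> h"
  shows "reach (conf p l C) (conf p h C)"
  using right h
proof (induction "nat (h - l)" arbitrary: l)
  case 0
  then show ?case
    by simp
next
  case (Suc n)
  then have "reach (conf p l C) (conf p (l + 1) C)"
    by (intro reach_step[OF p]) auto
  also have "reach (conf p (l + 1) C) (conf p h C)"
    using Suc by (intro Suc) auto
  finally show ?case .
qed

lemma move_marker:
  assumes "r < k" and U: "U = (tape x v)(int (v r) := tape x v (int (v r)) - {Suc r})"
  shows "tape x (v(r := n)) = U(int n := insert (Suc r) (U (int n)))" "U i \<subseteq> {..k}"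
proof -
  have "s \<in> tape x (v(r := n)) i \<longleftrightarrow> s \<in> (U(int n := insert (Suc r) (U (int n)))) i" for i s
    using assms by (cases s) (auto simp: U)
  then show "tape x (v(r := n)) = U(int n := insert (Suc r) (U (int n)))"
    by blast
  show "U i \<subseteq> {..k}"
    using tape_bounded[of x v] by (auto simp: U)
qed

lemma rewind:
  assumes "d \<in> residuals c" "- 1 \<le> h" "C = tape x v"
  shows "reach (conf (Rewind d) h C) (conf (Run d) 0 (tape x v))"
  using assms by (auto intro!: scan_left tape_bounded simp: phases_def)

lemma find_marker:
  assumes p: "Run (f # d) \<in> phases k c" "r < k"
    and "\<And>a S. Suc r \<notin> S \<Longrightarrow> delta k c (Run (f # d)) a S = Some (Run (f # d), S, 1)"
  shows "reach (conf (Run (f # d)) 0 (tape x v)) (conf (Run (f # d)) (int (v r)) (tape x v))"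
  using assms by (intro scan_right tape_bounded) auto

text \<open>
  Every command takes the head from cell \<open>0\<close> to the mark of its register, where the marks change or the
  oracle is read, and back.
\<close>
lemma run_exec:
  assumes "exec A d v w" "d \<in> residuals c"
  shows "reach (conf (Run d) 0 (tape x v)) (conf (Run []) 0 (tape x w))"
  using assms
proof induction
  case (exec_Nil v)
  show ?case
    by simp
next
  case (exec_Inc d v r w)
  have d: "d \<in> residuals c" and r: "r < k"
    using residuals_closed[OF exec_Inc.prems] registers_residuals[OF exec_Inc.prems] below by auto
  let ?h = "int (v r)" and ?p = "Run (Inc r # d)"
  have p: "?p \<in> phases k c" "Mark r d \<in> phases k c"
    using exec_Inc.prems d r by (auto simp: phases_def)
  have "reach (conf ?p 0 (tape x v)) (conf ?p ?h (tape x v))"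
    using p r by (intro find_marker) auto
  also have "reach (conf ?p ?h (tape x v))
      (conf (Mark r d) (?h + 1) ((tape x v)(?h := tape x v ?h - {Suc r})))"
    using p r by (intro reach_step tape_bounded) auto
  also have "reach (conf (Mark r d) (?h + 1) ((tape x v)(?h := tape x v ?h - {Suc r})))
      (conf (Rewind d) ?h (tape x (v(r := Suc (v r)))))"
  proof (rule reach_step[OF p(2)])
    show "((tape x v)(?h := tape x v ?h - {Suc r})) (?h + 1) \<subseteq> {..k}"
      using move_marker(2)[OF r refl, of x v] by blast
    show "tape x (v(r := Suc (v r))) = ((tape x v)(?h := tape x v ?h - {Suc r}))
        (?h + 1 := insert (Suc r) (((tape x v)(?h := tape x v ?h - {Suc r})) (?h + 1)))"
      using move_marker(1)[OF r refl, of x v "Suc (v r)"] by (simp add: add.commute)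
  qed (rule delta.simps, simp)
  also have "reach (conf (Rewind d) ?h (tape x (v(r := Suc (v r)))))
      (conf (Run d) 0 (tape x (v(r := Suc (v r)))))"
    using d by (intro rewind) auto
  also note exec_Inc.IH[OF d]
  finally show ?case .
next
  case (exec_Dec v r n d w)
  have d: "d \<in> residuals c" and r: "r < k"
    using residuals_closed[OF exec_Dec.prems] registers_residuals[OF exec_Dec.prems] below by auto
  let ?h = "int (v r)" and ?p = "Run (Dec r # d)"
  have p: "?p \<in> phases k c" "Mark r d \<in> phases k c"
    using exec_Dec.prems d r by (auto simp: phases_def)
  have "reach (conf ?p 0 (tape x v)) (conf ?p ?h (tape x v))"
    using p r by (intro find_marker) auto
  also have "reach (conf ?p ?h (tape x v))
      (conf (Mark r d) (?h - 1) ((tape x v)(?h := tape x v ?h - {Suc r})))"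
    using p r by (intro reach_step tape_bounded) auto
  also have "reach (conf (Mark r d) (?h - 1) ((tape x v)(?h := tape x v ?h - {Suc r})))
      (conf (Rewind d) (?h - 2) (tape x (v(r := n))))"
  proof (rule reach_step[OF p(2)])
    show "((tape x v)(?h := tape x v ?h - {Suc r})) (?h - 1) \<subseteq> {..k}"
      using move_marker(2)[OF r refl, of x v] by blast
    show "tape x (v(r := n)) = ((tape x v)(?h := tape x v ?h - {Suc r}))
        (?h - 1 := insert (Suc r) (((tape x v)(?h := tape x v ?h - {Suc r})) (?h - 1)))"
      using move_marker(1)[OF r refl, of x v n] \<open>v r = Suc n\<close> by simp
  qed (rule delta.simps, simp)
  also have "reach (conf (Rewind d) (?h - 2) (tape x (v(r := n)))) (conf (Run d) 0 (tape x (v(r := n))))"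
    using d \<open>v r = Suc n\<close> by (intro rewind) auto
  also note exec_Dec.IH[OF d]
  finally show ?case .
next
  case (exec_Branch v r d2 d1 d w)
  let ?d = "(if v r = 0 then d2 else d1) @ d" and ?p = "Run (Branch r d1 d2 # d)"
  have d: "?d \<in> residuals c" and r: "r < k"
    using residuals_closed[OF exec_Branch.prems] registers_residuals[OF exec_Branch.prems] below by auto
  have p: "?p \<in> phases k c"
    using exec_Branch.prems by (auto simp: phases_def)
  have "reach (conf ?p 0 (tape x v)) (conf (Rewind ?d) (- 1) (tape x v))"
    using p r by (intro reach_step tape_bounded) auto
  also have "reach (conf (Rewind ?d) (- 1) (tape x v)) (conf (Run ?d) 0 (tape x v))"
    using d by (intro rewind) auto
  also note exec_Branch.IH[OF d]
  finally show ?case .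
next
  case (exec_Loop_end v r d w b)
  let ?p = "Run (Loop r b # d)"
  have d: "d \<in> residuals c" and r: "r < k"
    using residuals_closed[OF exec_Loop_end.prems] registers_residuals[OF exec_Loop_end.prems] below by auto
  have p: "?p \<in> phases k c"
    using exec_Loop_end.prems by (auto simp: phases_def)
  have "reach (conf ?p 0 (tape x v)) (conf (Rewind d) (- 1) (tape x v))"
    using p r \<open>v r = 0\<close> by (intro reach_step tape_bounded) auto
  also have "reach (conf (Rewind d) (- 1) (tape x v)) (conf (Run d) 0 (tape x v))"
    using d by (intro rewind) auto
  also note exec_Loop_end.IH[OF d]
  finally show ?case .
next
  case (exec_Loop v r b d w)
  let ?p = "Run (Loop r b # d)" and ?d = "b @ Loop r b # d"
  have d: "?d \<in> residuals c" and r: "r < k"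
    using residuals_closed[OF exec_Loop.prems] registers_residuals[OF exec_Loop.prems] below by auto
  have p: "?p \<in> phases k c"
    using exec_Loop.prems by (auto simp: phases_def)
  have "reach (conf ?p 0 (tape x v)) (conf (Rewind ?d) (- 1) (tape x v))"
    using p r \<open>v r \<noteq> 0\<close> by (intro reach_step tape_bounded) auto
  also have "reach (conf (Rewind ?d) (- 1) (tape x v)) (conf (Run ?d) 0 (tape x v))"
    using d by (intro rewind) auto
  also note exec_Loop.IH[OF d]
  finally show ?case .
next
  case (exec_Query v r d1 d2 d w)
  let ?d = "(if v r \<in> A then d1 else d2) @ d" and ?p = "Run (Query r d1 d2 # d)"
  let ?h = "int (v r)"
  have d: "?d \<in> residuals c" and r: "r < k"
    using residuals_closed[OF exec_Query.prems] registers_residuals[OF exec_Query.prems] below by auto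
  have p: "?p \<in> phases k c"
    using exec_Query.prems by (auto simp: phases_def)
  have "reach (conf ?p 0 (tape x v)) (conf ?p ?h (tape x v))"
    using p r by (intro find_marker) auto
  also have "reach (conf ?p ?h (tape x v)) (conf (Rewind ?d) (?h - 1) (tape x v))"
    using p r by (intro reach_step tape_bounded) (auto simp: oracle_tape_eq_1)
  also have "reach (conf (Rewind ?d) (?h - 1) (tape x v)) (conf (Run ?d) 0 (tape x v))"
    using d by (intro rewind) auto
  also note exec_Query.IH[OF d]
  finally show ?case .
qed

lemma write_strokes:
  assumes "j \<le> w 0"
  shows "reach (conf (Run []) 0 (tape x w))
    (conf (Run []) (int j) (\<lambda>i. if 0 \<le> i \<and> i < int j then {0} else tape x w i))"
  using assms
proof (induction j)
  case 0
  have "(\<lambda>i. if 0 \<le> i \<and> i < int 0 then {0} else tape x w i) = tape x w"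
    by (intro ext) auto
  then show ?case
    by simp
next
  case (Suc j)
  let ?C = "\<lambda>j i. if 0 \<le> i \<and> i < int j then {0} else tape x w i"
  have p: "Run [] \<in> phases k c"
  proof -
    have "[] \<in> residuals d" for d
      by (induction d rule: residuals.induct) auto
    then show ?thesis
      by (auto simp: phases_def)
  qed
  have "reach (conf (Run []) 0 (tape x w)) (conf (Run []) (int j) (?C j))"
    using Suc by simp
  also have "?C (Suc j) = (?C j)(int j := {0})"
    by (intro ext) auto
  then have "reach (conf (Run []) (int j) (?C j)) (conf (Run []) (int (Suc j)) (?C (Suc j)))"
    using Suc.prems tape_bounded by (intro reach_step[OF p, where S = "{0}" and d = 1]) auto
  finally show ?case .
qed

text \<open>
  Since the strokes of the input are contiguous, erasing can stop at the first cell without one. Other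
  cells may keep marks, whose symbols are different from the stroke \<open>1\<close>.
\<close>
lemma erase_strokes:
  assumes "\<And>i. C i \<subseteq> {..k}" "\<And>i. h \<le> i \<Longrightarrow> 0 \<in> C i \<longleftrightarrow> i \<le> int x"
  shows "\<exists>h' C'. reach (conf Erase h C) (conf Erase h' C') \<and>
    tm_step A e (conf Erase h' C') = None \<and> (\<forall>i<h. C' i = C i) \<and> (\<forall>i\<ge>h. 0 \<notin> C' i) \<and>
    (\<forall>i. C' i \<subseteq> {..k})"
  using assms
proof (induction "nat (int x + 1 - h)" arbitrary: h C)
  case 0
  then have "tm_step A e (conf Erase h C) = None"
    by (subst tm_step_conf) (auto simp: phases_def)
  then show ?case
    using 0 by (intro exI[of _ h] exI[of _ C]) auto
next
  case (Suc n)
  let ?C = "C(h := {})"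
  have "reach (conf Erase h C) (conf Erase (h + 1) ?C)"
    using Suc.prems Suc.hyps(2) by (intro reach_step) (auto simp: phases_def)
  moreover obtain h' C' where C': "reach (conf Erase (h + 1) ?C) (conf Erase h' C')"
      "tm_step A e (conf Erase h' C') = None" "\<forall>i<h+1. C' i = ?C i" "\<forall>i\<ge>h+1. 0 \<notin> C' i"
      "\<forall>i. C' i \<subseteq> {..k}"
  proof -
    have "n = nat (int x + 1 - (h + 1))"
      using Suc.hyps(2) by simp
    moreover have "?C i \<subseteq> {..k}" for i
      using Suc.prems(1) by simp
    moreover have "0 \<in> ?C i \<longleftrightarrow> i \<le> int x" if "h + 1 \<le> i" for i
      using Suc.prems(2)[of i] that by simp
    ultimately have "\<exists>h' C'. reach (conf Erase (h + 1) ?C) (conf Erase h' C') \<and>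
        tm_step A e (conf Erase h' C') = None \<and> (\<forall>i<h+1. C' i = ?C i) \<and>
        (\<forall>i\<ge>h+1. 0 \<notin> C' i) \<and> (\<forall>i. C' i \<subseteq> {..k})"
      by (rule Suc.hyps(1))
    then show ?thesis
      using that by blast
  qed
  moreover have "0 \<notin> C' i" if "h \<le> i" for i
    using C'(3,4) that by (cases "i = h") auto
  ultimately show ?case
    by (intro exI[of _ h'] exI[of _ C']) (auto intro: reach_trans)
qed

lemma halts_with_output:
  obtains q h T where "reach (conf (Run []) 0 (tape x w)) (q, h, T)"
    "tm_step A e (q, h, T) = None" "card {i. T i = 1} = w 0"
proof -
  let ?n = "int (w 0)"
  let ?C = "\<lambda>i. if 0 \<le> i \<and> i < ?n then {0} else tape x w i"
  have p: "Run [] \<in> phases k c" "2 \<le> k"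
  proof -
    have "[] \<in> residuals d" for d
      by (induction d rule: residuals.induct) auto
    then show "Run [] \<in> phases k c"
      by (auto simp: phases_def)
    show "2 \<le> k"
      by (rule two_le)
  qed
  have bounded: "?C i \<subseteq> {..k}" for i
    using tape_bounded by auto
  have "reach (conf (Run []) 0 (tape x w)) (conf (Run []) ?n ?C)"
    using write_strokes[of "w 0"] by simp
  also have "reach (conf (Run []) ?n ?C) (conf Erase (?n + 1) (?C(?n := {})))"
    using bounded[of ?n] by (intro reach_step[OF p(1), where S = "{}" and d = 1]) (use p(2) in auto)
  finally have 1: "reach (conf (Run []) 0 (tape x w)) (conf Erase (?n + 1) (?C(?n := {})))" .
  obtain h' C' where C': "reach (conf Erase (?n + 1) (?C(?n := {}))) (conf Erase h' C')"
      "tm_step A e (conf Erase h' C') = None"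
      "\<forall>i<?n+1. C' i = (?C(?n := {})) i" "\<forall>i\<ge>?n+1. 0 \<notin> C' i" "\<forall>i. C' i \<subseteq> {..k}"
  proof -
    have "(?C(?n := {})) i \<subseteq> {..k}" for i
      using bounded[of i] by simp
    moreover have "0 \<in> (?C(?n := {})) i \<longleftrightarrow> i \<le> int x" if "?n + 1 \<le> i" for i
      using that by simp
    ultimately have "\<exists>h' C'. reach (conf Erase (?n + 1) (?C(?n := {}))) (conf Erase h' C') \<and>
        tm_step A e (conf Erase h' C') = None \<and> (\<forall>i<?n+1. C' i = (?C(?n := {})) i) \<and>
        (\<forall>i\<ge>?n+1. 0 \<notin> C' i) \<and> (\<forall>i. C' i \<subseteq> {..k})"
      by (rule erase_strokes)
    then show ?thesis
      using that by blast
  qed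
  have "set_encode (C' i) = 1 \<longleftrightarrow> 0 \<le> i \<and> i < ?n" for i
  proof -
    have "finite (C' i)"
      using C'(5) finite_subset by blast
    moreover have "set_encode {0} = 1"
      by simp
    ultimately have "set_encode (C' i) = 1 \<longleftrightarrow> C' i = {0}"
      by (metis finite.emptyI finite.insertI set_encode_eq)
    also have "\<dots> \<longleftrightarrow> 0 \<le> i \<and> i < ?n"
    proof (cases "i < ?n + 1")
      case True
      then show ?thesis
        using C'(3) by (auto simp: tape_def)
    next
      case False
      then have "0 \<notin> C' i"
        using C'(4) by simp
      then show ?thesis
        using False by auto
    qed
    finally show ?thesis .
  qed
  then have "{i. set_encode (C' i) = 1} = {0..<?n}"
    unfolding set_eq_iff mem_Collect_eq atLeastLessThan_iff by (rule allI)
  then have "card {i. set_encode (C' i) = 1} = card {0..<?n}"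
    by (rule arg_cong)
  then have "card {i. set_encode (C' i) = 1} = w 0"
    unfolding card_atLeastLessThan_int by simp
  moreover have "reach (conf (Run []) 0 (tape x w)) (conf Erase h' C')"
    using 1 C'(1) by (rule reach_trans)
  ultimately show ?thesis
    using C'(2) unfolding conf_def by (rule that[unfolded conf_def, rotated 2])
qed

text \<open>
  The machine is entered with \<open>n\<close> already stored as the mark \<open>2\<close> of register \<open>1\<close> in cell \<open>n\<close>.
\<close>
lemma start:
  assumes "C = (\<lambda>i. (if 0 \<le> i \<and> i \<le> int x then {0} else {}) \<union> (if i = int n then {2} else {}))"
  shows "reach (conf Start (int n - 1) C) (conf (Run c) 0 (tape x ((\<lambda>_. 0)(0 := x, 1 := n))))"
proof -
  let ?v = "(\<lambda>_. 0)(0 := x, 1 := n)"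
  have p: "{Start, Init, Seek, Place} \<subseteq> phases k c" and k: "2 \<le> k"
    using two_le by (auto simp: phases_def)
  have C: "C i \<subseteq> {..k}" for i
    using k by (auto simp: assms)
  let ?C = "C(0 := C 0 \<union> {3..k})"
  have C': "?C i \<subseteq> {..k}" for i
    using k by (auto simp: assms)
  have "reach (conf Start (int n - 1) C) (conf Init 0 C)"
    using p C by (intro scan_left) auto
  also have "reach (conf Init 0 C) (conf Seek 1 ?C)"
    using p C by (intro reach_step) auto
  also have "reach (conf Seek 1 ?C) (conf Seek (int x + 1) ?C)"
    using p C' by (intro scan_right) (auto simp: assms)
  also have "reach (conf Seek (int x + 1) ?C) (conf Place (int x) ?C)"
    using p C' by (intro reach_step[where S = "?C (int x + 1)" and d = 0])
      (use k in \<open>simp_all add: assms\<close>, simp_all add: fun_eq_iff)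
  also have "reach (conf Place (int x) ?C) (conf (Rewind c) (int x - 1) (tape x ?v))"
  proof (intro reach_step)
    have "tape x ?v i = (?C(int x := insert 1 (?C (int x)))) i" for i
    proof (intro set_eqI)
      fix s
      show "s \<in> tape x ?v i \<longleftrightarrow> s \<in> (?C(int x := insert 1 (?C (int x)))) i"
        using k by (cases s) (auto simp: assms numeral_2_eq_2 numeral_3_eq_3 split: if_splits)
    qed
    then show "tape x ?v = ?C(int x := insert 1 (?C (int x)))"
      by (rule ext)
    show "?C (int x) \<subseteq> {..k}"
      by (rule C')
  qed (use p in auto)
  also have "reach (conf (Rewind c) (int x - 1) (tape x ?v)) (conf (Run c) 0 (tape x ?v))"
    by (intro rewind self_in_residuals) auto
  finally show ?thesis .
qed

end

definition instruction_encode :: "instruction \<Rightarrow> nat" where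
  "instruction_encode = (\<lambda>((q, a, s), (q', s', d)).
     pair (pair q (pair a s)) (pair q' (pair s' d)))"

lemma instruction_decode_encode [simp]: "instruction_decode (instruction_encode i) = i"
  by (auto simp: instruction_encode_def instruction_decode_def triple_decode_def split: prod.splits)

lemma program_list_encode [simp]: "program (list_encode (map instruction_encode L)) = L"
  by (simp add: program_def o_def)

text \<open>
  The parameter \<open>n\<close> is built into the program by a row of states \<open>0, 2, \<dots>, 2 * n\<close>, which walk to cell
  \<open>n\<close> and set the mark of register \<open>1\<close> there: this is the element \<open>2\<close>, which adds \<open>4\<close> to the code
  of the set. On this way only the symbols \<open>0\<close> and \<open>1\<close> occur on both tapes.
\<close>
definition walk_instruction :: "nat \<Rightarrow> nat \<Rightarrow> nat \<Rightarrow> instruction" where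
  "walk_instruction i a s = ((2 * i, a, s), (2 * i + 2, s, 1))"

definition place_instruction :: "nat \<Rightarrow> nat \<Rightarrow> nat \<Rightarrow> instruction" where
  "place_instruction i a s = ((2 * i, a, s), (num Start, s + 4, 0))"

primrec walk :: "instruction list \<Rightarrow> nat \<Rightarrow> instruction list" where
  "walk L 0 = L"
| "walk L (Suc i) = walk_instruction i 0 0 # walk_instruction i 0 1 #
     walk_instruction i 1 0 # walk_instruction i 1 1 # walk L i"

definition hardwire :: "instruction list \<Rightarrow> nat \<Rightarrow> instruction list" where
  "hardwire L n = place_instruction n 0 0 # place_instruction n 0 1 #
     place_instruction n 1 0 # place_instruction n 1 1 # walk L n"

lemma map_of_walk:
  "i < n \<Longrightarrow> a \<le> 1 \<Longrightarrow> s \<le> 1 \<Longrightarrow> map_of (walk L n) (2 * i, a, s) = Some (2 * i + 2, s, 1)"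
  by (induction n) (auto simp: walk_instruction_def less_Suc_eq le_Suc_eq)

lemma map_of_walk_odd: "odd q \<Longrightarrow> map_of (walk L n) (q, a, s) = map_of L (q, a, s)"
  by (induction n) (auto simp: walk_instruction_def)

lemma map_of_hardwire:
  "i < n \<Longrightarrow> a \<le> 1 \<Longrightarrow> s \<le> 1 \<Longrightarrow> map_of (hardwire L n) (2 * i, a, s) = Some (2 * i + 2, s, 1)"
  "a \<le> 1 \<Longrightarrow> s \<le> 1 \<Longrightarrow> map_of (hardwire L n) (2 * n, a, s) = Some (num Start, s + 4, 0)"
  "odd q \<Longrightarrow> map_of (hardwire L n) (q, a, s) = map_of L (q, a, s)"
  by (auto simp: hardwire_def place_instruction_def map_of_walk map_of_walk_odd le_Suc_eq)

lemma recursive_hardwire: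
  "recursive_in B (\<lambda>n. list_encode (map instruction_encode (hardwire L n)))"
proof -
  have walk: "list_encode (map instruction_encode (walk L n)) =
      rec_nat (list_encode (map instruction_encode L))
        (\<lambda>i s. Suc (pair (instruction_encode (walk_instruction i 0 0))
          (Suc (pair (instruction_encode (walk_instruction i 0 1))
          (Suc (pair (instruction_encode (walk_instruction i 1 0))
          (Suc (pair (instruction_encode (walk_instruction i 1 1)) s)))))))) n" for n
    by (induction n) auto
  show ?thesis
    by (simp add: hardwire_def walk)
      (simp add: walk_instruction_def place_instruction_def instruction_encode_def, intro rec_intro)
qed

text \<open>
  The s-m-n theorem. The index is recursive in \<open>n\<close> because the fixed part of the program is a
  constant and the row of states that contains \<open>n\<close> is prepended by iteration.
\<close>
theorem parametrised_programs:
  assumes "recursive_in A f"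
  obtains idx where "\<And>B. recursive_in B idx" "\<And>n x. tm_computes A (idx n) x (f (pair n x))"
proof -
  obtain d where d: "computes_at A 0 d f"
    using recursive_in_program[OF assms] by blast
  define c where "c = swap 0 @ join 0 @ d"
  define k where "k = Max (insert 1 (registers c)) + 1"
  have k: "2 \<le> k" "registers c \<subseteq> {..<k}"
    by (auto simp: k_def finite_registers less_Suc_eq_le)
  obtain L where L: "\<And>p a S. p \<in> phases k c \<Longrightarrow> a < 3 \<Longrightarrow> S \<subseteq> {..k} \<Longrightarrow>
       map_of L (num p, a, set_encode S) = map_option encode_action (delta k c p a S)"
    by (rule delta_table[of k c]) (rule that)
  define idx where "idx n = list_encode (map instruction_encode (hardwire L n))" for n
  have "tm_computes A (idx n) x (f (pair n x))" for n x
  proof -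
    have prog: "program (idx n) = hardwire L n"
      by (simp add: idx_def)
    interpret compiled A "idx n" k c
    proof
      show "map_of (program (idx n)) (num p, a, set_encode S) = map_option encode_action (delta k c p a S)"
        if "p \<in> phases k c" "a < 3" "S \<subseteq> {..k}" for p a S
        using L[OF that] map_of_hardwire(3)[of "num p"] by (simp add: prog num_def)
    qed (fact k)+
    define T where "T = (\<lambda>i. if 0 \<le> i \<and> i \<le> int x then 1 else 0 :: nat)"
    have T: "T i \<le> 1" for i
      by (auto simp: T_def)
    have orc: "oracle_tape A (int i) \<le> 1" for i
      by (auto simp: oracle_tape_def)
    have walk: "reach (0, 0, T) (2 * i, int i, T)" if "i \<le> n" for i
      using that
    proof (induction i)
      case (Suc i)
      have "tm_step A (idx n) (2 * i, int i, T) = Some (2 * Suc i, int (Suc i), T)"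
        using Suc.prems map_of_hardwire(1)[OF _ orc T, where L = L and n = n, of i i "int i"] by (simp add: prog)
      from reach_trans[OF _ reach_tm_step[OF this]] Suc show ?case
        by simp
    qed simp
    let ?C = "\<lambda>i. (if 0 \<le> i \<and> i \<le> int x then {0} else {}) \<union> (if i = int n then {2} else {})"
    let ?v = "(\<lambda>_. 0)(0 := x, 1 := n)"
    have final: "tm_step A (idx n) (2 * n, int n, T) = Some (num Start, int n - 1, T(int n := T (int n) + 4))"
      using map_of_hardwire(2)[OF orc T, where L = L and n = n, of n "int n"] by (simp add: prog)
    have "T(int n := T (int n) + 4) = (\<lambda>i. set_encode (?C i))"
      by (auto simp: T_def fun_eq_iff)
    with reach_trans[OF walk[of n] reach_tm_step[OF final]]
    have "reach (0, 0, T) (conf Start (int n - 1) ?C)"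
      by (simp add: conf_def)
    also have "reach (conf Start (int n - 1) ?C) (conf (Run c) 0 (tape x ?v))"
      by (rule start) simp
    also have "exec A c ?v ((\<lambda>_. 0)(0 := f (pair n x)))"
      unfolding c_def
      by (rule exec_append'[OF exec_swap exec_append[OF exec_join computes_atD[OF d]]])
        (auto simp: fun_eq_iff)
    then have "reach (conf (Run c) 0 (tape x ?v)) (conf (Run []) 0 (tape x ((\<lambda>_. 0)(0 := f (pair n x)))))"
      by (rule run_exec) (rule self_in_residuals)
    finally have 1: "reach (0, 0, T) (conf (Run []) 0 (tape x ((\<lambda>_. 0)(0 := f (pair n x)))))" .
    obtain q h T' where 2: "reach (conf (Run []) 0 (tape x ((\<lambda>_. 0)(0 := f (pair n x))))) (q, h, T')"
      "tm_step A (idx n) (q, h, T') = None" "card {i. T' i = 1} = f (pair n x)"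
      by (rule halts_with_output[of x "(\<lambda>_. 0)(0 := f (pair n x))"]) simp
    have "tm_init x = (0, 0, T)"
      by (simp add: tm_init_def T_def)
    with reach_trans[OF 1 2(1)] 2(2,3) show ?thesis
      unfolding tm_computes_def reach_def by metis
  qed
  with that recursive_hardwire show ?thesis
    unfolding idx_def by blast
qed

section \<open>The Kleene-Brouwer order\<close>

fun kb :: "nat list \<Rightarrow> nat list \<Rightarrow> bool" where
  "kb [] ys = False"
| "kb (x # xs) [] = True"
| "kb (x # xs) (y # ys) = (x < y \<or> x = y \<and> kb xs ys)"

lemma kb_irrefl [simp]: "\<not> kb xs xs"
  by (induction xs) auto

lemma kb_trans: "kb xs ys \<Longrightarrow> kb ys zs \<Longrightarrow> kb xs zs"
proof (induction xs ys arbitrary: zs rule: kb.induct)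
  case (3 x xs y ys)
  then show ?case
    by (cases zs) auto
qed auto

lemma kb_total: "xs \<noteq> ys \<Longrightarrow> kb xs ys \<or> kb ys xs"
proof (induction xs ys rule: kb.induct)
  case (1 ys)
  then show ?case
    by (cases ys) auto
qed auto

lemma kb_append [simp]: "kb (p @ xs) (p @ ys) = kb xs ys"
  by (induction p) auto

lemma kb_iff_nth:
  "kb xs ys \<longleftrightarrow> (\<exists>i<length xs. i \<le> length ys \<and> (\<forall>j<i. xs ! j = ys ! j) \<and>
     (i = length ys \<or> xs ! i < ys ! i))"
proof (induction xs ys rule: kb.induct)
  case (3 x xs y ys)
  then show ?case
    by (auto simp: Ex_less_Suc2 All_less_Suc2)
qed auto

definition prefix_closed :: "nat list set \<Rightarrow> bool" where
  "prefix_closed V \<longleftrightarrow> (\<forall>xs n. xs \<in> V \<longrightarrow> take n xs \<in> V)"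

definition pathless :: "nat list set \<Rightarrow> bool" where
  "pathless V \<longleftrightarrow> (\<nexists>t. \<forall>n. map t [0..<n] \<in> V)"

lemma wf_children:
  assumes V: "prefix_closed V" "pathless V"
  shows "wf {(xs @ [x], xs) | xs x. xs @ [x] \<in> V}"
  unfolding wf_iff_no_infinite_down_chain
proof
  assume "\<exists>f. \<forall>i. (f (Suc i), f i) \<in> {(xs @ [x], xs) | xs x. xs @ [x] \<in> V}"
  then obtain f where f0: "\<forall>i. (f (Suc i), f i) \<in> {(xs @ [x], xs) | xs x. xs @ [x] \<in> V}" ..
  have f: "\<exists>x. f (Suc i) = f i @ [x]" and fV: "f (Suc i) \<in> V" for i
    using spec[OF f0, of i] by auto
  have len: "i \<le> length (f i)" for i
  proof (induction i)
    case (Suc i)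
    then show ?case
      using f[of i] by auto
  qed simp
  have app: "\<exists>zs. f (i + k) = f i @ zs" for i k
  proof (induction k)
    case (Suc k)
    then show ?case
      using f[of "i + k"] by auto
  qed simp
  define t where "t n = f (Suc n) ! n" for n
  have t: "t n = f k ! n" if "n < k" for n k
  proof -
    obtain zs where "f (Suc n + (k - Suc n)) = f (Suc n) @ zs"
      using app by blast
    with that len[of "Suc n"] show ?thesis
      by (simp add: t_def nth_append)
  qed
  have "map t [0..<n] = take n (f (Suc n))" for n
    using len[of "Suc n"] by (intro nth_equalityI) (auto intro: t)
  then have "map t [0..<n] \<in> V" for n
    using V(1) fV[of n] by (simp add: prefix_closed_def)
  with V(2) show False
    by (auto simp: pathless_def)
qed

text \<open>
  A nonempty set of nodes that extend \<open>p\<close> either is \<open>{p}\<close> or meets the subtree of a child of \<open>p\<close>;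
  the minimum in the leftmost such subtree is the minimum of the set.
\<close>

lemma kb_minimum:
  assumes V: "prefix_closed V" "pathless V"
    and S: "S \<subseteq> V" "S \<noteq> {}"
  obtains m where "m \<in> S" "\<And>y. y \<in> S \<Longrightarrow> \<not> kb y m"
proof -
  have "\<exists>m\<in>S. \<forall>y\<in>S. \<not> kb y m" if "S \<subseteq> V" "S \<noteq> {}" "\<forall>xs\<in>S. \<exists>zs. xs = p @ zs" for p S
    using wf_children[OF V] that
  proof (induction p arbitrary: S rule: wf_induct_rule)
    case (less p)
    show ?case
    proof (cases "\<exists>x zs. p @ x # zs \<in> S")
      case False
      then have "S = {p}"
        using less.prems(2,3) by (metis append_Nil2 insertI1 neq_Nil_conv subsetI subset_singleton_iff)
      then show ?thesis
        by simp
    next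
      case True
      define x where "x = (LEAST x. \<exists>zs. p @ x # zs \<in> S)"
      have x: "\<exists>zs. p @ x # zs \<in> S"
        unfolding x_def using True by (rule LeastI_ex)
      have least: "x \<le> y" if "p @ y # zs \<in> S" for y zs
        unfolding x_def using that by (intro Least_le) blast
      let ?S = "{xs \<in> S. \<exists>zs. xs = (p @ [x]) @ zs}"
      obtain zs where zs: "p @ x # zs \<in> S"
        using x by blast
      then have "take (length p + 1) (p @ x # zs) \<in> V"
        using less.prems(1) V(1) unfolding prefix_closed_def by blast
      then have "p @ [x] \<in> V"
        by simp
      then have "\<exists>m\<in>?S. \<forall>y\<in>?S. \<not> kb y m"
        using less.prems zs by (intro less.IH[of "p @ [x]"]) auto
      then obtain m where m: "m \<in> S" "\<And>y. y \<in> ?S \<Longrightarrow> \<not> kb y m" and "\<exists>zs. m = (p @ [x]) @ zs"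
        by blast
      then obtain ms where ms: "m = p @ x # ms"
        by auto
      have "\<not> kb y m" if y: "y \<in> S" for y
      proof -
        obtain ys where ys: "y = p @ ys"
          using less.prems(3) y by blast
        show ?thesis
        proof (cases ys)
          case Nil
          then show ?thesis
            using kb_append[of p "[]" "x # ms"] by (simp add: ys ms)
        next
          case (Cons y' ys')
          then have "x \<le> y'"
            using least y ys by blast
          moreover have "\<not> kb y m" if "y' = x"
            using m(2)[of y] y that by (auto simp: ys Cons)
          ultimately show ?thesis
            by (auto simp: ys ms Cons)
        qed
      qed
      with m(1) show ?thesis
        by blast
    qed
  qed
  from this[OF S, of "[]"] that show ?thesis
    by auto
qed

primrec level_map :: "(nat \<Rightarrow> nat \<Rightarrow> nat) \<Rightarrow> nat list \<Rightarrow> nat list" where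
  "level_map j [] = []"
| "level_map j (x # xs) = j 0 x # level_map (\<lambda>i. j (Suc i)) xs"

lemma length_level_map [simp]: "length (level_map j xs) = length xs"
  by (induction xs arbitrary: j) auto

lemma nth_level_map: "i < length xs \<Longrightarrow> level_map j xs ! i = j i (xs ! i)"
  by (induction xs arbitrary: i j) (auto simp: nth_Cons split: nat.splits)

lemma kb_level_map:
  "kb xs ys \<Longrightarrow> (\<And>i. strict_mono (j i)) \<Longrightarrow> kb (level_map j xs) (level_map j ys)"
  by (induction xs ys arbitrary: j rule: kb.induct) (auto simp: strict_mono_less)


section \<open>Disjoint unions of two well-ordered trees\<close>

text \<open>
  An order-preserving map from a well-order to itself cannot send an element below itself. If \<open>s\<close> embedded
  into \<open>r\<close> by \<open>f\<close>, the map \<open>f \<circ> g\<close> from \<open>r\<close> to itself would send \<open>f y\<close> below itself.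
\<close>

lemma ordLess_by_bounded_map:
  assumes r: "Well_order r" and s: "Well_order s"
    and g: "\<And>x. x \<in> Field r \<Longrightarrow> g x \<in> Field s"
    and mono: "\<And>x y. (x, y) \<in> r \<Longrightarrow> x \<noteq> y \<Longrightarrow> (g x, g y) \<in> s \<and> g x \<noteq> g y"
    and y: "y \<in> Field s" "\<And>x. x \<in> Field r \<Longrightarrow> (g x, y) \<in> s \<and> g x \<noteq> y"
  shows "r <o s"
proof (rule ccontr)
  assume "\<not> r <o s"
  then have "s \<le>o r"
    using r s not_ordLess_iff_ordLeq by blast
  then obtain f where f: "embed s r f"
    by (auto simp: ordLeq_def)
  have strict: "(f u, f v) \<in> r \<and> f u \<noteq> f v" if "(u, v) \<in> s" "u \<noteq> v" for u v
  proof -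
    have "compat s r f"
      using f s by (intro embed_compat)
    moreover have "inj_on f (Field s)"
      using f s by (intro embed_inj_on)
    moreover have "u \<in> Field s" "v \<in> Field s"
      using that(1) by (auto simp: Field_def)
    ultimately show ?thesis
      using that inj_onD[of f "Field s" u v] unfolding compat_def by blast
  qed
  have fr: "f u \<in> Field r" if "u \<in> Field s" for u
    using embed_in_Field[OF f that] .
  define h where "h x = f (g x)" for x
  have h: "(h u, h v) \<in> r \<and> h u \<noteq> h v" if "(u, v) \<in> r" "u \<noteq> v" for u v
    unfolding h_def using mono[OF that] strict by blast
  define Q where "Q = {x \<in> Field r. (h x, x) \<in> r \<and> h x \<noteq> x}"
  have "f y \<in> Q"
    unfolding Q_def h_def using fr[OF y(1)] y(2)[OF fr[OF y(1)]] strict by blast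
  moreover have "wf (r - Id)"
    using r by (auto simp: well_order_on_def)
  ultimately obtain z where z: "z \<in> Q" "\<And>w. (w, z) \<in> r - Id \<Longrightarrow> w \<notin> Q"
    by (metis wfE_min)
  then have "h z \<notin> Q"
    by (auto simp: Q_def)
  moreover have "h z \<in> Field r" "(h (h z), h z) \<in> r \<and> h (h z) \<noteq> h z"
    using z(1) h[of "h z" z] by (auto simp: Q_def Field_def)
  ultimately show False
    by (simp add: Q_def)
qed

text \<open>
  An element of the disjoint union is a pair consisting of the number of a component and the code of
  a node.
\<close>
definition node :: "nat \<Rightarrow> nat list" where
  "node m = list_decode (psnd m)"

definition sum_carrier :: "(nat \<Rightarrow> nat list set) \<Rightarrow> nat set" where
  "sum_carrier V = {m. pfst m < 2 \<and> node m \<in> V (pfst m)}"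

definition sum_order :: "(nat \<Rightarrow> nat list set) \<Rightarrow> nat rel" where
  "sum_order V = {(m, m'). m \<in> sum_carrier V \<and> m' \<in> sum_carrier V \<and> pfst m = pfst m' \<and>
     (m = m' \<or> kb (node m) (node m'))}"

lemma node_eqD: "pfst m = pfst m' \<Longrightarrow> node m = node m' \<Longrightarrow> m = m'"
  by (metis list_decode_eq node_def pair_pfst_psnd)

lemma node_pair [simp]: "node (pair b (list_encode xs)) = xs"
  by (simp add: node_def)

lemma wpo_sum:
  assumes V: "\<And>b. b < 2 \<Longrightarrow> prefix_closed (V b)" "\<And>b. b < 2 \<Longrightarrow> pathless (V b)"
  shows "wpo (sum_carrier V) (sum_order V)"
proof -
  let ?P = "sum_carrier V" and ?r = "sum_order V"
  have "refl_on ?P ?r"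
    by (auto simp: refl_on_def sum_order_def)
  moreover have "trans ?r"
    by (rule transI) (auto simp: sum_order_def intro: kb_trans)
  moreover have "antisym ?r"
    by (rule antisymI) (auto simp: sum_order_def dest: kb_trans)
  moreover have "?r \<subseteq> ?P \<times> ?P"
    by (auto simp: sum_order_def)
  ultimately have "partial_order_on ?P ?r"
    by (auto simp: partial_order_on_def preorder_on_def)
  moreover have "wf (?r - Id)"
  proof (rule wfI_min)
    fix x :: nat and Q
    assume x: "x \<in> Q"
    show "\<exists>z\<in>Q. \<forall>y. (y, z) \<in> ?r - Id \<longrightarrow> y \<notin> Q"
    proof (cases "x \<in> ?P")
      case False
      then show ?thesis
        using x by (auto simp: sum_order_def)
    next
      case True
      let ?b = "pfst x"
      let ?S = "node ` {y \<in> Q \<inter> ?P. pfst y = ?b}"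
      have b: "?b < 2"
        using True by (simp add: sum_carrier_def)
      have "?S \<subseteq> V ?b" "?S \<noteq> {}"
        using x True by (auto simp: sum_carrier_def)
      then obtain m where m: "m \<in> ?S" "\<And>y. y \<in> ?S \<Longrightarrow> \<not> kb y m"
        by (rule kb_minimum[OF V[OF b]]) (rule that)
      then obtain z where z: "z \<in> Q" "z \<in> ?P" "pfst z = ?b" "m = node z"
        by blast
      have "y \<notin> Q" if "(y, z) \<in> ?r - Id" for y
      proof
        assume "y \<in> Q"
        moreover have "y \<in> ?P" "pfst y = ?b" "kb (node y) (node z)"
          using that z(3) by (auto simp: sum_order_def)
        ultimately show False
          using m(2) z(4) by blast
      qed
      with z(1) show ?thesis
        by blast
    qed
  qed
  moreover have "finite A" if A: "antichain ?P ?r A" for A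
  proof -
    have "inj_on pfst A"
    proof (rule inj_onI, rule ccontr)
      fix x y assume xy: "x \<in> A" "y \<in> A" "pfst x = pfst y" "x \<noteq> y"
      then have "kb (node x) (node y) \<or> kb (node y) (node x)"
        using kb_total node_eqD by blast
      moreover have "x \<in> ?P" "y \<in> ?P"
        using A xy(1,2) by (auto simp: antichain_def)
      ultimately have "(x, y) \<in> ?r \<or> (y, x) \<in> ?r"
        using xy(3) by (auto simp: sum_order_def)
      moreover have "(x, y) \<notin> ?r" "(y, x) \<notin> ?r"
        using A xy by (simp_all add: antichain_def)
      ultimately show False
        by blast
    qed
    moreover have "pfst ` A \<subseteq> {..<2}"
      using A by (auto simp: antichain_def sum_carrier_def)
    ultimately show ?thesis
      using finite_imageD finite_subset by (metis finite_lessThan)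
  qed
  ultimately show ?thesis
    by (auto simp: wpo_def wf_partial_order_def)
qed

lemma chain_Field:
  "po_chain P r C \<Longrightarrow> Field (Restr r C) = C"
  by (auto simp: po_chain_def linear_order_on_def partial_order_on_def preorder_on_def refl_on_def Field_def)

lemma chain_Well_order:
  assumes "wpo P r" "po_chain P r C"
  shows "Well_order (Restr r C)"
proof -
  have "wf (r - Id)"
    using assms(1) by (auto simp: wpo_def wf_partial_order_def)
  then have "wf (Restr r C - Id)"
    by (rule wf_subset) auto
  then show ?thesis
    using assms(2) by (simp add: chain_Field[OF assms(2)] well_order_on_def) (simp add: po_chain_def)
qed

text \<open>
  If one Kleene-Brouwer order is mapped strictly below the root of the other one, then a chain in the
  first component is shorter than the whole second component, which is itself a chain. So
  the chains of maximal order type are found in the second component.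
\<close>
lemma maximal_chain_sum:
  assumes V: "\<And>b. b < 2 \<Longrightarrow> prefix_closed (V b)" "\<And>b. b < 2 \<Longrightarrow> pathless (V b)"
    and b: "{b, b'} = {0, 1 :: nat}"
    and F: "\<And>xs. xs \<in> V b \<Longrightarrow> F xs \<in> V b'" "\<And>xs. xs \<in> V b \<Longrightarrow> F xs \<noteq> []"
      "\<And>xs ys. kb xs ys \<Longrightarrow> kb (F xs) (F ys)"
    and root: "[] \<in> V b'"
    and C: "maximal_chain (sum_carrier V) (sum_order V) C"
  shows "C \<noteq> {}" "c \<in> C \<Longrightarrow> pfst c = b'"
proof -
  let ?P = "sum_carrier V" and ?r = "sum_order V"
  have wpo: "wpo ?P ?r"
    using V by (rule wpo_sum)
  have bb: "b < 2" "b' < 2" "b \<noteq> b'" and b2: "i < 2 \<longleftrightarrow> i = b \<or> i = b'" for i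
    using b by (auto simp: doubleton_eq_iff)
  obtain h where h: "has_height ?P ?r h" "Restr ?r C =o h" and chain: "po_chain ?P ?r C"
    using C by (auto simp: maximal_chain_def)
  define D where "D = {m \<in> ?P. pfst m = b'}"
  have D: "po_chain ?P ?r D"
  proof -
    have "kb (node x) (node y) \<or> kb (node y) (node x)" if "x \<in> D" "y \<in> D" "x \<noteq> y" for x y
      using that kb_total node_eqD[of x y] by (auto simp: D_def)
    then have "total_on D (Restr ?r D)"
      by (auto simp: total_on_def sum_order_def D_def)
    moreover have "refl_on D (Restr ?r D)"
      by (auto simp: refl_on_def sum_order_def D_def)
    moreover have "trans (Restr ?r D)"
      by (rule transI) (auto simp: sum_order_def intro: kb_trans)
    moreover have "antisym (Restr ?r D)"
      by (rule antisymI) (auto simp: sum_order_def dest: kb_trans)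
    ultimately show ?thesis
      by (auto simp: po_chain_def linear_order_on_def partial_order_on_def preorder_on_def D_def)
  qed
  let ?top = "pair b' (list_encode [])"
  have top: "?top \<in> D"
    using root bb by (auto simp: D_def sum_carrier_def simp del: list_encode.simps)
  have small: False if C': "C \<subseteq> {m \<in> ?P. pfst m = b}"
  proof -
    define g where "g m = pair b' (list_encode (F (node m)))" for m
    have gD: "g m \<in> D" if "m \<in> C" for m
      using that C' F(1) bb by (auto simp: g_def D_def sum_carrier_def)
    have "Restr ?r C <o Restr ?r D"
    proof (rule ordLess_by_bounded_map[OF chain_Well_order[OF wpo chain] chain_Well_order[OF wpo D]])
      show "g x \<in> Field (Restr ?r D)" if "x \<in> Field (Restr ?r C)" for x
        using that gD by (simp add: chain_Field[OF chain] chain_Field[OF D])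
      show "(g x, g y) \<in> Restr ?r D \<and> g x \<noteq> g y" if "(x, y) \<in> Restr ?r C" "x \<noteq> y" for x y
      proof -
        have "kb (F (node x)) (F (node y))"
          using that F(3) by (auto simp: sum_order_def)
        then show ?thesis
          using gD[of x] gD[of y] that by (auto simp: sum_order_def D_def g_def list_encode_eq)
      qed
      show "?top \<in> Field (Restr ?r D)"
        using top by (simp add: chain_Field[OF D])
      show "(g x, ?top) \<in> Restr ?r D \<and> g x \<noteq> ?top" if "x \<in> Field (Restr ?r C)" for x
      proof -
        have x: "x \<in> C"
          using that by (simp add: chain_Field[OF chain])
        then have "F (node x) \<noteq> []"
          using C' F(2) by (auto simp: sum_carrier_def)
        then have "kb (node (g x)) (node ?top)" "g x \<noteq> ?top"
          unfolding g_def node_pair by (cases "F (node x)"; simp add: list_encode_eq del: list_encode.simps)+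
        then show ?thesis
          using gD[OF x] top by (auto simp: sum_order_def D_def)
      qed
    qed
    also have "Restr ?r D \<le>o h"
      using h(1) D by (auto simp: has_height_def)
    finally have "Restr ?r C <o h" .
    with h(2) show False
      using not_ordLess_ordIso by blast
  qed
  show "C \<noteq> {}"
    using small by blast
  have CP: "C \<subseteq> ?P"
    using chain by (simp add: po_chain_def)
  show "pfst c = b'" if "c \<in> C"
  proof (rule ccontr)
    assume "pfst c \<noteq> b'"
    then have c: "pfst c = b"
      using that CP b2 by (auto simp: sum_carrier_def)
    have "pfst d = b" if d: "d \<in> C" for d
    proof (cases "d = c")
      case False
      have "total_on C (Restr ?r C)"
        using chain by (auto simp: po_chain_def linear_order_on_def)
      then have "(c, d) \<in> ?r \<or> (d, c) \<in> ?r"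
        using False d \<open>c \<in> C\<close> by (auto simp: total_on_def)
      then show ?thesis
        using c by (auto simp: sum_order_def)
    qed (simp add: c)
    then show False
      using small CP by blast
  qed
qed

section \<open>Local conditions and their finite approximations\<close>

text \<open>
  The value of such a functional at \<open>z\<close> and \<open>k\<close> is computed from \<open>k\<close> with a number of requests
  to \<open>z\<close> that depends on neither of them. This weak form of computability in \<open>z\<close> suffices here.
\<close>
inductive local_fun :: "((nat \<Rightarrow> nat) \<Rightarrow> nat \<Rightarrow> nat) \<Rightarrow> bool" where
  local_rec: "recursive_in {} f \<Longrightarrow> local_fun (\<lambda>z k. f k)"
| local_lookup: "local_fun F \<Longrightarrow> local_fun (\<lambda>z k. z (F z k))"
| local_comb: "recursive_in {} h \<Longrightarrow> local_fun F \<Longrightarrow> local_fun G \<Longrightarrow>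
    local_fun (\<lambda>z k. h (pair (F z k) (G z k)))"

text \<open>
  \<open>G len s k\<close> is the attempt to compute \<open>F s k\<close> from the first \<open>len\<close> values of \<open>s\<close>. It is
  \<open>0\<close> if further values are requested and \<open>Suc v\<close> if the result is \<open>v\<close>. The clauses express that
  results are final, depend on the available values only, are correct, and are eventually
  obtained, and that the attempt is computable in the data, which may depend on a parameter \<open>x\<close>.
\<close>
definition approximation :: "(nat \<Rightarrow> (nat \<Rightarrow> nat) \<Rightarrow> nat \<Rightarrow> nat) \<Rightarrow> ((nat \<Rightarrow> nat) \<Rightarrow> nat \<Rightarrow> nat) \<Rightarrow> bool"
  where "approximation G F \<longleftrightarrow>
    (\<forall>len len' s k. len \<le> len' \<longrightarrow> G len s k \<noteq> 0 \<longrightarrow> G len' s k = G len s k) \<and>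
    (\<forall>len s s' k. (\<forall>i<len. s i = s' i) \<longrightarrow> G len s k = G len s' k) \<and>
    (\<forall>len z k. G len z k \<noteq> 0 \<longrightarrow> G len z k = Suc (F z k)) \<and>
    (\<forall>z k. \<exists>len. G len z k \<noteq> 0) \<and>
    (\<forall>L S K. recursive_in {} L \<longrightarrow> recursive_in {} (\<lambda>p. S (pfst p) (psnd p)) \<longrightarrow>
       recursive_in {} K \<longrightarrow> recursive_in {} (\<lambda>x. G (L x) (S x) (K x)))"

lemma approximationD:
  assumes "approximation G F"
  shows "len \<le> len' \<Longrightarrow> G len s k \<noteq> 0 \<Longrightarrow> G len' s k = G len s k"
    and "(\<And>i. i < len \<Longrightarrow> s i = s' i) \<Longrightarrow> G len s k = G len s' k"
    and "G len z k \<noteq> 0 \<Longrightarrow> G len z k = Suc (F z k)"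
    and "\<exists>len. G len z k \<noteq> 0"
    and "recursive_in {} L \<Longrightarrow> recursive_in {} (\<lambda>p. S (pfst p) (psnd p)) \<Longrightarrow> recursive_in {} K \<Longrightarrow>
      recursive_in {} (\<lambda>x. G (L x) (S x) (K x))"
proof -
  note a = assms[unfolded approximation_def]
  show "len \<le> len' \<Longrightarrow> G len s k \<noteq> 0 \<Longrightarrow> G len' s k = G len s k"
    using a by metis
  show "(\<And>i. i < len \<Longrightarrow> s i = s' i) \<Longrightarrow> G len s k = G len s' k"
    using a[THEN conjunct2, THEN conjunct1] by auto
  show "G len z k \<noteq> 0 \<Longrightarrow> G len z k = Suc (F z k)"
    using a by metis
  show "\<exists>len. G len z k \<noteq> 0"
    using a[THEN conjunct2, THEN conjunct2, THEN conjunct2, THEN conjunct1] by blast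
  show "recursive_in {} L \<Longrightarrow> recursive_in {} (\<lambda>p. S (pfst p) (psnd p)) \<Longrightarrow> recursive_in {} K \<Longrightarrow>
      recursive_in {} (\<lambda>x. G (L x) (S x) (K x))"
    using a[THEN conjunct2, THEN conjunct2, THEN conjunct2, THEN conjunct2] by blast
qed

lemma rec_param:
  assumes "recursive_in A (\<lambda>p. S (pfst p) (psnd p))" "recursive_in A f"
  shows "recursive_in A (\<lambda>x. S x (f x))"
  using rec_comp[OF assms(1) rec_pair[OF rec_id assms(2)]] by simp

lemma approximation_rec:
  assumes "recursive_in {} f"
  shows "approximation (\<lambda>len s k. Suc (f k)) (\<lambda>z k. f k)"
  using rec_comp[OF assms] by (auto simp: approximation_def intro!: rec_intro)

lemma approximation_lookup:
  assumes G: "approximation G F"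
  shows "approximation (\<lambda>len s k. if G len s k = 0 \<or> len < G len s k then 0 else Suc (s (G len s k - 1)))
    (\<lambda>z k. z (F z k))"
  unfolding approximation_def
proof (intro conjI allI impI)
  fix len len' :: nat and s s' :: "nat \<Rightarrow> nat" and k
  show "(if G len' s k = 0 \<or> len' < G len' s k then 0 else Suc (s (G len' s k - 1)))
      = (if G len s k = 0 \<or> len < G len s k then 0 else Suc (s (G len s k - 1)))"
    if "len \<le> len'" "(if G len s k = 0 \<or> len < G len s k then 0 else Suc (s (G len s k - 1))) \<noteq> 0"
    using that approximationD(1)[OF G, OF that(1), of s k] by (auto split: if_splits)
  show "(if G len s k = 0 \<or> len < G len s k then 0 else Suc (s (G len s k - 1)))
      = (if G len s' k = 0 \<or> len < G len s' k then 0 else Suc (s' (G len s' k - 1)))"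
    if "\<forall>i<len. s i = s' i"
  proof -
    have "G len s k = G len s' k"
      using that by (intro approximationD(2)[OF G]) auto
    then show ?thesis
      using that by auto
  qed
next
  fix len z k
  show "(if G len z k = 0 \<or> len < G len z k then 0 else Suc (z (G len z k - 1))) = Suc (z (F z k))"
    if "(if G len z k = 0 \<or> len < G len z k then 0 else Suc (z (G len z k - 1))) \<noteq> 0"
    using that approximationD(3)[OF G, of len z k] by (auto split: if_splits)
next
  fix z k
  obtain len where len: "G len z k \<noteq> 0"
    using approximationD(4)[OF G] by blast
  let ?len = "max len (G len z k)"
  have "G ?len z k = G len z k"
    using len by (intro approximationD(1)[OF G]) auto
  with len show "\<exists>len. (if G len z k = 0 \<or> len < G len z k then 0 else Suc (z (G len z k - 1))) \<noteq> 0"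
    by (intro exI[of _ ?len]) auto
next
  fix L S K
  assume L: "recursive_in {} L" and S: "recursive_in {} (\<lambda>p. S (pfst p) (psnd p) :: nat)"
    and K: "recursive_in {} K"
  have "recursive_in {} (\<lambda>x. G (L x) (S x) (K x))"
    by (rule approximationD(5)[OF G, OF L S K])
  then show "recursive_in {} (\<lambda>x. if G (L x) (S x) (K x) = 0 \<or> L x < G (L x) (S x) (K x) then 0
      else Suc (S x (G (L x) (S x) (K x) - 1)))"
    by (intro rec_intro rec_param[OF S] L)
qed

lemma approximation_comb:
  assumes h: "recursive_in {} h" and G: "approximation G F" and G': "approximation G' F'"
  shows "approximation (\<lambda>len s k. if G len s k = 0 \<or> G' len s k = 0 then 0
      else Suc (h (pair (G len s k - 1) (G' len s k - 1))))
    (\<lambda>z k. h (pair (F z k) (F' z k)))"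
  unfolding approximation_def
proof (intro conjI allI impI)
  fix len len' :: nat and s s' :: "nat \<Rightarrow> nat" and k
  show "(if G len' s k = 0 \<or> G' len' s k = 0 then 0
      else Suc (h (pair (G len' s k - 1) (G' len' s k - 1)))) =
    (if G len s k = 0 \<or> G' len s k = 0 then 0
      else Suc (h (pair (G len s k - 1) (G' len s k - 1))))"
    if "len \<le> len'" "(if G len s k = 0 \<or> G' len s k = 0 then 0
      else Suc (h (pair (G len s k - 1) (G' len s k - 1)))) \<noteq> 0"
    using that approximationD(1)[OF G, OF that(1), of s k] approximationD(1)[OF G', OF that(1), of s k]
    by (auto split: if_splits)
  show "(if G len s k = 0 \<or> G' len s k = 0 then 0
      else Suc (h (pair (G len s k - 1) (G' len s k - 1)))) =
    (if G len s' k = 0 \<or> G' len s' k = 0 then 0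
      else Suc (h (pair (G len s' k - 1) (G' len s' k - 1))))"
    if "\<forall>i<len. s i = s' i"
  proof -
    have "G len s k = G len s' k" "G' len s k = G' len s' k"
      using that by (auto intro: approximationD(2)[OF G] approximationD(2)[OF G'])
    then show ?thesis
      by simp
  qed
next
  fix len z k
  show "(if G len z k = 0 \<or> G' len z k = 0 then 0
      else Suc (h (pair (G len z k - 1) (G' len z k - 1)))) = Suc (h (pair (F z k) (F' z k)))"
    if "(if G len z k = 0 \<or> G' len z k = 0 then 0
      else Suc (h (pair (G len z k - 1) (G' len z k - 1)))) \<noteq> 0"
    using that approximationD(3)[OF G, of len z k] approximationD(3)[OF G', of len z k]
    by (auto split: if_splits)
next
  fix z k
  obtain l l' where l: "G l z k \<noteq> 0" "G' l' z k \<noteq> 0"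
    using approximationD(4)[OF G] approximationD(4)[OF G'] by blast
  have "G (max l l') z k = G l z k" "G' (max l l') z k = G' l' z k"
    using l by (auto intro: approximationD(1)[OF G] approximationD(1)[OF G'])
  with l show "\<exists>len. (if G len z k = 0 \<or> G' len z k = 0 then 0
      else Suc (h (pair (G len z k - 1) (G' len z k - 1)))) \<noteq> 0"
    by (intro exI[of _ "max l l'"]) auto
next
  fix L S K
  assume L: "recursive_in {} L" and S: "recursive_in {} (\<lambda>p. S (pfst p) (psnd p) :: nat)"
    and K: "recursive_in {} K"
  have "recursive_in {} (\<lambda>x. G (L x) (S x) (K x))" "recursive_in {} (\<lambda>x. G' (L x) (S x) (K x))"
    using approximationD(5)[OF G, OF L S K] approximationD(5)[OF G', OF L S K] by auto
  then show "recursive_in {} (\<lambda>x. if G (L x) (S x) (K x) = 0 \<or> G' (L x) (S x) (K x) = 0 then 0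
      else Suc (h (pair (G (L x) (S x) (K x) - 1) (G' (L x) (S x) (K x) - 1))))"
    by (intro rec_intro rec_comp[OF h])
qed

lemma local_fun_approximation: "local_fun F \<Longrightarrow> \<exists>G. approximation G F"
proof (induction rule: local_fun.induct)
  case (local_rec f)
  then show ?case
    using approximation_rec by blast
next
  case (local_lookup F)
  then show ?case
    using approximation_lookup by blast
next
  case (local_comb h F F')
  then show ?case
    using approximation_comb by blast
qed


section \<open>From local conditions to well partial orders\<close>

lemma ex_strict_mono_copies:
  fixes lab :: "nat \<Rightarrow> nat"
  obtains j where "strict_mono j" "\<And>x. psnd (j x) = lab x"
proof -
  define j where "j = rec_nat (pair 0 (lab 0)) (\<lambda>x y. pair (Suc y) (lab (Suc x)))"
  have "j x < j (Suc x)" for x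
    using le_prod_encode_1[of "Suc (j x)" "lab (Suc x)"] by (simp add: j_def)
  then have "strict_mono j"
    by (simp add: strict_mono_Suc_iff)
  moreover have "psnd (j x) = lab x" for x
    by (cases x) (auto simp: j_def)
  ultimately show ?thesis
    by (rule that)
qed

text \<open>
  A label of the tree \<open>T n b * W\<close> with infinitely many copies is a triple of the copy number, the label
  of \<open>T n b\<close> and the label of \<open>W\<close>.
\<close>
abbreviation guess :: "nat \<Rightarrow> nat" where
  "guess x \<equiv> pfst (psnd x)"

abbreviation bound :: "nat \<Rightarrow> nat" where
  "bound x \<equiv> psnd (psnd x)"

locale approximated =
  fixes G :: "nat \<Rightarrow> (nat \<Rightarrow> nat) \<Rightarrow> nat \<Rightarrow> nat" and R :: "(nat \<Rightarrow> nat) \<Rightarrow> nat \<Rightarrow> nat" and X :: "nat set"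
  assumes G: "approximation G R"
    and X: "\<And>n. (\<exists>z. \<forall>k. R z (pair n (pair 1 k)) \<noteq> 0) \<longleftrightarrow> n \<in> X"
    and co_X: "\<And>n. (\<exists>z. \<forall>k. R z (pair n (pair 0 k)) \<noteq> 0) \<longleftrightarrow> n \<notin> X"
begin

text \<open>
  The nodes of the tree \<open>T n b\<close>: no violation of the condition with a number below \<open>len\<close> can be
  seen on the sequence of the first \<open>len\<close> values of \<open>s\<close>. The bound on the numbers makes this decidable.
\<close>
definition consistent :: "nat \<Rightarrow> nat \<Rightarrow> nat \<Rightarrow> (nat \<Rightarrow> nat) \<Rightarrow> bool" where
  "consistent n b len s \<longleftrightarrow> (\<forall>k<len. G len s (pair n (pair b k)) \<noteq> 1)"

lemma consistent_mono: "consistent n b len' s \<Longrightarrow> len \<le> len' \<Longrightarrow> consistent n b len s"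
  using approximationD(1)[OF G] unfolding consistent_def
  by (metis less_le_trans zero_neq_one)

lemma consistent_cong:
  "(\<And>i. i < len \<Longrightarrow> s i = s' i) \<Longrightarrow> consistent n b len s \<longleftrightarrow> consistent n b len s'"
  using approximationD(2)[OF G, of len s s'] unfolding consistent_def by simp

lemma consistent_solution:
  "(\<forall>len. consistent n b len z) \<longleftrightarrow> (\<forall>k. R z (pair n (pair b k)) \<noteq> 0)"
proof
  assume con: "\<forall>len. consistent n b len z"
  show "\<forall>k. R z (pair n (pair b k)) \<noteq> 0"
  proof
    fix k
    let ?k = "pair n (pair b k)"
    obtain len where len: "G len z ?k \<noteq> 0"
      using approximationD(4)[OF G] by blast
    have eq: "G (max len (Suc k)) z ?k = G len z ?k"
      using len by (intro approximationD(1)[OF G]) auto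
    have "k < max len (Suc k)"
      by simp
    then have "G (max len (Suc k)) z ?k \<noteq> 1"
      using con unfolding consistent_def by blast
    with eq have "G len z ?k \<noteq> 1"
      by simp
    with approximationD(3)[OF G, OF len] show "R z ?k \<noteq> 0"
      by simp
  qed
next
  assume R: "\<forall>k. R z (pair n (pair b k)) \<noteq> 0"
  have "G len z (pair n (pair b k)) \<noteq> 1" for len k
    using approximationD(3)[OF G, of len z "pair n (pair b k)"] spec[OF R, of k] by auto
  then show "\<forall>len. consistent n b len z"
    unfolding consistent_def by simp
qed

lemma recursive_consistent:
  assumes "recursive_in {} n" "recursive_in {} b" "recursive_in {} len"
    and s: "recursive_in {} (\<lambda>p. s (pfst p) (psnd p))"
  shows "decidable_in {} (\<lambda>x. consistent (n x) (b x) (len x) (s x))"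
proof -
  have "recursive_in {} (\<lambda>q. s (pfst (pfst q)) (psnd q))"
    using rec_comp[OF s, of "\<lambda>q. pair (pfst (pfst q)) (psnd q)"] by (simp add: rec_intro)
  then have "recursive_in {} (\<lambda>p. G (len (pfst p)) (s (pfst p)) (pair (n (pfst p)) (pair (b (pfst p)) (psnd p))))"
    by (intro approximationD(5)[OF G] rec_intro rec_comp[OF assms(1)] rec_comp[OF assms(2)]
        rec_comp[OF assms(3)])
  then show ?thesis
    unfolding consistent_def using assms(3) by (intro rec_intro)
qed

text \<open>
  The nodes of \<open>T n b * W\<close>. The first label of a node of \<open>W\<close> selects a number \<open>m\<close>, and the following ones
  are labels of \<open>T m 0 * T m 1\<close>; this is why the second part is shorter by one.
\<close>
definition good :: "nat \<Rightarrow> nat \<Rightarrow> nat \<Rightarrow> (nat \<Rightarrow> nat) \<Rightarrow> bool" where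
  "good n b len t \<longleftrightarrow> consistent n b len (\<lambda>i. guess (t i)) \<and>
     consistent (bound (t 0)) 0 (len - 1) (\<lambda>i. pfst (bound (t (Suc i)))) \<and>
     consistent (bound (t 0)) 1 (len - 1) (\<lambda>i. psnd (bound (t (Suc i))))"

definition tree :: "nat \<Rightarrow> nat \<Rightarrow> nat list set" where
  "tree n b = {xs. good n b (length xs) (lnth (list_encode xs))}"

lemma good_0: "good n b 0 t"
  by (simp add: good_def consistent_def)

lemma good_cong:
  assumes "\<And>i. i < len \<Longrightarrow> t i = t' i"
  shows "good n b len t \<longleftrightarrow> good n b len t'"
proof (cases len)
  case (Suc l)
  have bounds: "consistent m c l (\<lambda>i. g (t (Suc i))) = consistent m c l (\<lambda>i. g (t' (Suc i)))" for m c and g :: "nat \<Rightarrow> nat"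
    using assms Suc by (intro consistent_cong) auto
  have "consistent n b len (\<lambda>i. guess (t i)) = consistent n b len (\<lambda>i. guess (t' i))"
    using assms by (intro consistent_cong) auto
  moreover have "t 0 = t' 0"
    using assms Suc by auto
  ultimately show ?thesis
    using bounds[of _ _ "\<lambda>x. pfst (bound x)"] bounds[of _ _ "\<lambda>x. psnd (bound x)"]
    by (simp add: good_def Suc)
qed (simp add: good_0)

lemma good_mono: "good n b len' t \<Longrightarrow> len \<le> len' \<Longrightarrow> good n b len t"
  unfolding good_def by (meson consistent_mono diff_le_mono)

lemma mem_tree_iff:
  assumes "\<And>i. i < length xs \<Longrightarrow> xs ! i = t i"
  shows "xs \<in> tree n b \<longleftrightarrow> good n b (length xs) t"
  unfolding tree_def mem_Collect_eq using assms by (intro good_cong) (simp add: lnth_list_encode)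

lemma prefix_closed_tree: "prefix_closed (tree n b)"
  unfolding prefix_closed_def
proof (intro allI impI)
  fix xs m
  assume "xs \<in> tree n b"
  then have "good n b (length xs) (\<lambda>i. xs ! i)"
    using mem_tree_iff[of xs] by simp
  then have "good n b (length (take m xs)) (\<lambda>i. xs ! i)"
    by (rule good_mono) simp
  then show "take m xs \<in> tree n b"
    using mem_tree_iff[of "take m xs" "\<lambda>i. xs ! i"] by simp
qed

text \<open>
  A path yields paths of both \<open>T m 0\<close> and \<open>T m 1\<close>, where \<open>m\<close> is selected by its first label.
\<close>
lemma pathless_tree: "pathless (tree n b)"
  unfolding pathless_def
proof
  assume "\<exists>t. \<forall>m. map t [0..<m] \<in> tree n b"
  then obtain t where t: "\<forall>m. map t [0..<m] \<in> tree n b" ..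
  have good: "good n b m t" for m
    using mem_tree_iff[of "map t [0..<m]" t] spec[OF t, of m] by simp
  let ?m = "bound (t 0)"
  have "consistent ?m 0 len (\<lambda>i. pfst (bound (t (Suc i))))"
    "consistent ?m 1 len (\<lambda>i. psnd (bound (t (Suc i))))" for len
    using good[of "Suc len"] by (simp_all add: good_def)
  then have "\<exists>z. \<forall>k. R z (pair ?m (pair 0 k)) \<noteq> 0" "\<exists>z. \<forall>k. R z (pair ?m (pair 1 k)) \<noteq> 0"
    unfolding consistent_solution[symmetric] by blast+
  then show False
    unfolding X co_X by blast
qed

text \<open>
  The image of a node begins with the label that selects \<open>n\<close> in \<open>W\<close>. The node itself then moves
  down by one level: its guesses become one side of a node of \<open>T n 0 * T n 1\<close>, and the path \<open>z\<close>
  provides the other side as well as all the guesses of the image. Copy numbers are chosen so as to keep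
  the order of the labels.
\<close>
lemma tree_bounded_map:
  assumes z: "\<forall>k. R z (pair n (pair b' k)) \<noteq> 0" and b: "{b, b'} = {0, 1 :: nat}"
  obtains F where "\<And>xs. xs \<in> tree n b \<Longrightarrow> F xs \<in> tree n b'" "\<And>xs. F xs \<noteq> []"
    "\<And>xs ys. kb xs ys \<Longrightarrow> kb (F xs) (F ys)"
proof -
  define lab where "lab i x = pair (z (Suc i))
    (if b = 0 then pair (guess x) (z i) else pair (z i) (guess x))" for i x
  have "\<exists>j. strict_mono j \<and> (\<forall>x. psnd (j x) = lab i x)" for i
    using ex_strict_mono_copies[of "lab i"] by metis
  then obtain j where j: "\<And>i. strict_mono (j i)" "\<And>i x. psnd (j i x) = lab i x"
    by metis
  define root where "root = pair 0 (pair (z 0) n)"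
  define F where "F xs = root # level_map j xs" for xs
  have "F xs \<in> tree n b'" if xs: "xs \<in> tree n b" for xs
  proof -
    define t where "t i = (case i of 0 \<Rightarrow> root | Suc i \<Rightarrow> j i (xs ! i))" for i
    let ?len = "length xs"
    have good: "good n b ?len (\<lambda>i. xs ! i)"
      using xs mem_tree_iff[of xs "\<lambda>i. xs ! i"] by simp
    have z': "consistent n b' len z" for len
      using z unfolding consistent_solution[symmetric] by blast
    have "guess (t i) = z i" for i
      by (cases i) (auto simp: t_def root_def j lab_def)
    moreover have "bound (t 0) = n"
      by (simp add: t_def root_def)
    moreover have "bound (t (Suc i)) = (if b = 0 then pair (guess (xs ! i)) (z i) else pair (z i) (guess (xs ! i)))" for i
      by (simp add: t_def j lab_def)
    moreover have "consistent n b ?len (\<lambda>i. guess (xs ! i))"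
      using good by (simp add: good_def)
    moreover have "b = 0 \<and> b' = 1 \<or> b = 1 \<and> b' = 0"
      using b by (auto simp: doubleton_eq_iff)
    ultimately have "good n b' (Suc ?len) t"
      using z' by (auto simp: good_def)
    moreover have "F xs ! i = t i" if "i < length (F xs)" for i
      using that by (cases i) (auto simp: F_def t_def nth_level_map)
    ultimately show ?thesis
      using mem_tree_iff[of "F xs" t] by (simp add: F_def)
  qed
  moreover have "F xs \<noteq> []" for xs
    by (simp add: F_def)
  moreover have "kb (F xs) (F ys)" if "kb xs ys" for xs ys
    using kb_level_map[OF that] j(1) by (simp add: F_def)
  ultimately show ?thesis
    by (rule that)
qed

lemma decidable_carrier:
  assumes "recursive_in {} f" "recursive_in {} g"
  shows "decidable_in {} (\<lambda>x. g x \<in> sum_carrier (tree (f x)))"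
proof -
  have t: "recursive_in {} (\<lambda>p. lnth (psnd (g (pfst p))) (psnd p))"
    by (intro rec_intro rec_comp[OF assms(2)])
  have "decidable_in {} (\<lambda>x. good (f x) (pfst (g x)) (llength (psnd (g x))) (lnth (psnd (g x))))"
    unfolding good_def
    by (intro rec_intro recursive_consistent assms rec_comp[OF assms(2)])
  then have "decidable_in {} (\<lambda>x. pfst (g x) < 2 \<and>
      good (f x) (pfst (g x)) (llength (psnd (g x))) (lnth (psnd (g x))))"
    by (intro rec_intro assms)
  then show ?thesis
    by (simp add: sum_carrier_def tree_def node_def llength_def)
qed

lemma decidable_order:
  "decidable_in {} (\<lambda>p. psnd p \<in> rel_code (sum_order (tree (pfst p))))"
proof -
  have kb: "kb (node m) (node m') \<longleftrightarrow> (\<exists>i<llength (psnd m). i \<le> llength (psnd m') \<and>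
      (\<forall>j<i. lnth (psnd m) j = lnth (psnd m') j) \<and>
      (i = llength (psnd m') \<or> lnth (psnd m) i < lnth (psnd m') i))" for m m'
  proof -
    have l: "lnth (psnd m) j = node m ! j" if "j < length (node m)" for j m
      using that lnth_list_encode[of j "node m"] by (simp add: node_def)
    have len: "llength (psnd m) = length (node m)" for m
      by (simp add: node_def llength_def)
    show ?thesis
      unfolding kb_iff_nth len
    proof (intro ex_cong1 conj_cong refl disj_cong)
      fix i j
      assume i: "i < length (node m)" "i \<le> length (node m')"
      show "(\<forall>j<i. node m ! j = node m' ! j) \<longleftrightarrow> (\<forall>j<i. lnth (psnd m) j = lnth (psnd m') j)"
        using i by (simp add: l)
      show "node m ! i < node m' ! i \<longleftrightarrow> lnth (psnd m) i < lnth (psnd m') i" if "i \<noteq> length (node m')"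
        using i that by (simp add: l)
    qed
  qed
  have code: "x \<in> rel_code r \<longleftrightarrow> (pfst x, psnd x) \<in> r" for x r
    by (auto simp: rel_code_def pfst_def psnd_def image_iff) (metis prod.collapse prod_decode_inverse)
  have "decidable_in {} (\<lambda>p. pfst (psnd p) \<in> sum_carrier (tree (pfst p)) \<and>
     psnd (psnd p) \<in> sum_carrier (tree (pfst p)) \<and> pfst (pfst (psnd p)) = pfst (psnd (psnd p)) \<and>
     (pfst (psnd p) = psnd (psnd p) \<or> kb (node (pfst (psnd p))) (node (psnd (psnd p)))))"
    unfolding kb by (intro rec_intro decidable_carrier)
  then show ?thesis
    by (simp add: code sum_order_def)
qed

text \<open>
  On input \<open>n\<close>, search for any element of the chain calculated for the \<open>n\<close>-th order, and output its
  component.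
\<close>
theorem reducible_to_maximal_chains:
  assumes f: "calculates_maximal_chains f"
  shows "X \<le>\<^sub>T fun_graph f"
proof -
  let ?P = "\<lambda>n. sum_carrier (tree n)" and ?r = "\<lambda>n. sum_order (tree n)"
  obtain i1 where i1: "\<And>B. recursive_in B i1" "\<And>n x. tm_computes {} (i1 n) x (of_bool (x \<in> ?P n))"
    using parametrised_programs[OF decidable_carrier[OF rec_pfst rec_psnd]] by auto
  obtain i2 where i2: "\<And>B. recursive_in B i2"
      "\<And>n x. tm_computes {} (i2 n) x (of_bool (x \<in> rel_code (?r n)))"
    using parametrised_programs[OF decidable_order] by auto
  define e where "e n = pair (i1 n) (i2 n)" for n
  have dec: "tm_decides {} (i1 n) (?P n)" "tm_decides {} (i2 n) (rel_code (?r n))" for n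
    using i1(2) i2(2) by (auto simp: tm_decides_def)
  have wpo: "wpo (?P n) (?r n)" for n
    by (intro wpo_sum prefix_closed_tree pathless_tree)
  have max: "\<exists>C. maximal_chain (?P n) (?r n) C \<and> (\<forall>m. f (e n, m) = of_bool (m \<in> C))" for n
    using f wpo[of n] dec[of n] unfolding calculates_maximal_chains_def computable_wpo_def
      computable_def turing_reducible_def po_index_def e_def by blast
  have side: "(\<exists>m. f (e n, m) = 1) \<and> (\<forall>m. f (e n, m) = 1 \<longrightarrow> pfst m = of_bool (n \<in> X))" for n
  proof -
    obtain C where C: "maximal_chain (?P n) (?r n) C" "\<forall>m. f (e n, m) = of_bool (m \<in> C)"
      using max by blast
    \<comment> \<open>\<open>b'\<close> is the component whose tree \<open>T n b'\<close> has a path.\<close>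
    define b b' :: nat where "b = of_bool (n \<notin> X)" and "b' = of_bool (n \<in> X)"
    have bb: "{b, b'} = {0, 1}"
      by (auto simp: b_def b'_def)
    have "\<exists>z. \<forall>k. R z (pair n (pair b' k)) \<noteq> 0"
      using X[of n] co_X[of n] by (auto simp: b'_def of_bool_def)
    then obtain z where z: "\<forall>k. R z (pair n (pair b' k)) \<noteq> 0" ..
    obtain F where F: "\<And>xs. xs \<in> tree n b \<Longrightarrow> F xs \<in> tree n b'" "\<And>xs. F xs \<noteq> []"
      "\<And>xs ys. kb xs ys \<Longrightarrow> kb (F xs) (F ys)"
      using tree_bounded_map[OF z bb] by metis
    have root: "[] \<in> tree n b'"
      by (simp add: tree_def good_0)
    have "C \<noteq> {}"
      by (rule maximal_chain_sum(1)[of "tree n" b b' F])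
        (rule prefix_closed_tree pathless_tree bb F root C(1) | assumption)+
    moreover have "pfst c = b'" if "c \<in> C" for c
      by (rule maximal_chain_sum(2)[of "tree n" b b' F])
        (rule prefix_closed_tree pathless_tree bb F root C(1) that | assumption)+
    ultimately show ?thesis
      using C(2) by (auto simp: b'_def)
  qed
  define A where "A = fun_graph f"
  have A: "pair (pair x m) (Suc 0) \<in> A \<longleftrightarrow> f (x, m) = 1" for x m
    by (auto simp: A_def fun_graph_def)
  define g where "g n = pfst (LEAST m. pair (pair (e n) m) (Suc 0) \<in> A)" for n
  have e: "recursive_in A e"
    unfolding e_def by (intro rec_intro i1 i2)
  have "decidable_in A (\<lambda>p. pair (pair (e (pfst p)) (psnd p)) (Suc 0) \<in> A)"
    by (intro rec_comp[OF rec_oracle] rec_intro rec_comp[OF e])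
  then have "recursive_in A (\<lambda>n. LEAST m. pair (pair (e n) m) (Suc 0) \<in> A)"
    using side by (intro rec_Least) (auto simp: A)
  then have "recursive_in A (\<lambda>p. g (psnd p))"
    unfolding g_def using rec_comp[OF _ rec_psnd] by (intro rec_pfst') blast
  then obtain i :: "nat \<Rightarrow> nat" where i: "\<And>n x. tm_computes A (i n) x (g (psnd (pair n x)))"
    by (rule parametrised_programs) (rule that)
  have "g n = of_bool (n \<in> X)" for n
  proof -
    have "\<exists>m. pair (pair (e n) m) (Suc 0) \<in> A"
      using side by (simp add: A)
    then have "pair (pair (e n) (LEAST m. pair (pair (e n) m) (Suc 0) \<in> A)) (Suc 0) \<in> A"
      by (rule LeastI_ex)
    then show ?thesis
      using side by (simp add: A g_def)
  qed
  with i have "tm_decides A (i 0) X"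
    by (metis tm_decides_def psnd_pair)
  then show ?thesis
    by (auto simp: turing_reducible_def A_def)
qed

end

theorem local_condition_reducible:
  assumes "local_fun R"
    and "\<And>n. (\<exists>z. \<forall>k. R z (pair n (pair 1 k)) \<noteq> 0) \<longleftrightarrow> n \<in> X"
    and "\<And>n. (\<exists>z. \<forall>k. R z (pair n (pair 0 k)) \<noteq> 0) \<longleftrightarrow> n \<notin> X"
    and "calculates_maximal_chains f"
  shows "X \<le>\<^sub>T fun_graph f"
proof -
  obtain G where "approximation G R"
    using local_fun_approximation[OF assms(1)] by blast
  then interpret approximated G R X
    using assms(2,3) by unfold_locales
  show ?thesis
    using assms(4) by (rule reducible_to_maximal_chains)
qed

section \<open>Runs of Turing machines\<close>

text \<open>
  A run stays in its last configuration after halting, so that there is a configuration at all times.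
\<close>
primrec run :: "nat set \<Rightarrow> nat \<Rightarrow> nat \<Rightarrow> nat \<Rightarrow> configuration" where
  "run A e x 0 = tm_init x"
| "run A e x (Suc t) = (case tm_step A e (run A e x t) of None \<Rightarrow> run A e x t | Some c \<Rightarrow> c)"

definition halts_at :: "nat set \<Rightarrow> nat \<Rightarrow> nat \<Rightarrow> nat \<Rightarrow> bool" where
  "halts_at A e x t \<longleftrightarrow> tm_step A e (run A e x t) = None"

definition strokes :: "configuration \<Rightarrow> nat" where
  "strokes c = card {i. snd (snd c) i = 1}"

lemma tm_computes_iff_run:
  "tm_computes A e x y \<longleftrightarrow> (\<exists>t. halts_at A e x t \<and> y = strokes (run A e x t))"
proof
  let ?R = "\<lambda>c c'. tm_step A e c = Some c'"
  have reach: "?R\<^sup>*\<^sup>* (tm_init x) (run A e x t)" for t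
  proof (induction t)
    case (Suc t)
    then show ?case
      by (cases "tm_step A e (run A e x t)")
        (auto simp del: tm_step.simps intro: rtranclp.rtrancl_into_rtrancl)
  qed simp
  have ex: "\<exists>t. run A e x t = c" if "?R\<^sup>*\<^sup>* (tm_init x) c" for c
    using that
  proof induction
    case base
    show ?case
      by (rule exI[of _ 0]) simp
  next
    case (step c c')
    then obtain t where "run A e x t = c"
      by blast
    with step.hyps(2) have "run A e x (Suc t) = c'"
      by (simp del: tm_step.simps)
    then show ?case
      by blast
  qed
  show "\<exists>t. halts_at A e x t \<and> y = strokes (run A e x t)" if comp: "tm_computes A e x y"
  proof -
    from comp obtain q h T where c: "?R\<^sup>*\<^sup>* (tm_init x) (q, h, T)" "tm_step A e (q, h, T) = None"
      "y = card {i. T i = 1}"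
      unfolding tm_computes_def by (elim exE conjE)
    obtain t where "run A e x t = (q, h, T)"
      using ex[OF c(1)] by blast
    with c(2,3) show ?thesis
      by (intro exI[of _ t]) (simp add: halts_at_def strokes_def del: tm_step.simps)
  qed
  show "tm_computes A e x y" if t: "\<exists>t. halts_at A e x t \<and> y = strokes (run A e x t)"
  proof -
    obtain t where t: "halts_at A e x t" "y = strokes (run A e x t)"
      using t by blast
    obtain q h T where c: "run A e x t = (q, h, T)"
      by (cases "run A e x t")
    show ?thesis
      unfolding tm_computes_def
      using reach[of t] t by (intro exI[of _ q] exI[of _ h] exI[of _ T])
        (simp add: c halts_at_def strokes_def del: tm_step.simps)
  qed
qed

lemma halts_at_stable:
  assumes "halts_at A e x t"
  shows "run A e x (t + n) = run A e x t"
  using assms by (induction n) (auto simp: halts_at_def simp del: tm_step.simps)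

lemma halts_at_unique:
  assumes "halts_at A e x t" "halts_at A e x t'"
  shows "run A e x t = run A e x t'"
  using halts_at_stable[OF assms(1), of "t' - t"] halts_at_stable[OF assms(2), of "t - t'"]
  by (cases "t \<le> t'") auto

lemma tm_computes_at: "tm_computes A e x y \<Longrightarrow> halts_at A e x t \<Longrightarrow> y = strokes (run A e x t)"
  unfolding tm_computes_iff_run using halts_at_unique by metis

lemma tm_computes_unique: "tm_computes A e x y \<Longrightarrow> tm_computes A e x y' \<Longrightarrow> y = y'"
  using tm_computes_at unfolding tm_computes_iff_run by metis

lemma finite_tape_run: "finite {i. snd (snd (run A e x t)) i \<noteq> 0}"
proof (induction t)
  case 0
  have "{i. snd (snd (tm_init x)) i \<noteq> 0} \<subseteq> {0..int x}"
    by (auto simp: tm_init_def split: if_splits)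
  then show ?case
    by (simp add: finite_subset)
next
  case (Suc t)
  obtain q h T where c: "run A e x t = (q, h, T)"
    by (cases "run A e x t")
  show ?case
  proof (cases "tm_step A e (q, h, T)")
    case None
    then show ?thesis
      using Suc by (simp add: c del: tm_step.simps)
  next
    case (Some c')
    then have "{i. snd (snd c') i \<noteq> 0} \<subseteq> insert h {i. T i \<noteq> 0}"
      by (auto split: option.splits if_splits)
    then have "finite {i. snd (snd c') i \<noteq> 0}"
      using Suc by (simp add: c finite_subset)
    then show ?thesis
      using Some by (simp add: c del: tm_step.simps)
  qed
qed

text \<open>
  The instruction table of a program on codes. Its recursion equations relate a table to the one without the
  first instruction.
\<close>
definition lookup :: "nat \<Rightarrow> nat \<Rightarrow> nat" where
  "lookup e key = (case map_of (program e) (triple_decode key) of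
     None \<Rightarrow> 0 | Some (q, s, d) \<Rightarrow> Suc (pair q (pair s d)))"

lemma triple_decode_pair [simp]: "triple_decode (pair q (pair s d)) = (q, s, d)"
  by (simp add: triple_decode_def)

lemma triple_decode_eq: "triple_decode n = (pfst n, pfst (psnd n), psnd (psnd n))"
  by (simp add: triple_decode_def pfst_def psnd_def split: prod.splits)

lemma triple_decode_inj: "triple_decode m = triple_decode n \<Longrightarrow> m = n"
  by (metis triple_decode_eq pair_pfst_psnd prod.inject)

lemma lookup_0: "lookup 0 key = 0"
  by (simp add: lookup_def program_def)

lemma lookup_Suc:
  "lookup (Suc m) key = (if pfst (pfst m) = key then Suc (psnd (pfst m)) else lookup (psnd m) key)"
proof -
  have "program (Suc m) = (triple_decode (pfst (pfst m)), triple_decode (psnd (pfst m))) # program (psnd m)"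
    by (simp add: program_def instruction_decode_def pfst_def psnd_def map_prod_def split: prod.splits)
  then show ?thesis
    using triple_decode_inj[of "pfst (pfst m)" key]
    by (auto simp: lookup_def triple_decode_eq[of "psnd (pfst m)"])
qed

lemma tm_step_lookup:
  "tm_step A e (q, h, T) = (let l = lookup e (pair q (pair (oracle_tape A h) (T h))) in
     if l = 0 then None
     else Some (pfst (l - 1), if psnd (psnd (l - 1)) = 0 then h - 1 else h + 1,
       T(h := pfst (psnd (l - 1)))))"
  by (auto simp: lookup_def Let_def split: option.splits prod.splits)


section \<open>A local description of runs\<close>

named_theorems local_intro

abbreviation local_pred :: "((nat \<Rightarrow> nat) \<Rightarrow> nat \<Rightarrow> bool) \<Rightarrow> bool" where
  "local_pred P \<equiv> local_fun (\<lambda>z k. of_bool (P z k))"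

lemma local_rec2:
  assumes "recursive_in {} (\<lambda>p. h (pfst p) (psnd p))" "local_fun F" "local_fun G"
  shows "local_fun (\<lambda>z k. h (F z k) (G z k))"
  using local_comb[OF assms] by simp

lemma local_rec1:
  assumes "recursive_in {} h" "local_fun F"
  shows "local_fun (\<lambda>z k. h (F z k))"
  using local_rec2[of "\<lambda>x y. h x" F F] rec_comp[OF assms(1) rec_pfst] assms(2) by simp

lemma local_const: "local_fun (\<lambda>z k. c)"
  by (rule local_rec) (rule rec_const)

lemma local_var: "local_fun (\<lambda>z k. k)"
  by (rule local_rec) (rule rec_id)

lemma local_ops:
  assumes "local_fun F"
  shows "local_fun (\<lambda>z k. pfst (F z k))" "local_fun (\<lambda>z k. psnd (F z k))"
    "local_fun (\<lambda>z k. Suc (F z k))" "local_fun (\<lambda>z k. F z k div 2)" "local_pred (\<lambda>z k. even (F z k))"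
  using local_rec1[of pfst F] local_rec1[of psnd F] local_rec1[of Suc F] local_rec1[of "\<lambda>x. x div 2" F]
    local_rec1[of "\<lambda>x. of_bool (even x)" F] assms by (simp_all add: rec_intro)

lemma local_ops2:
  assumes "local_fun F" "local_fun G"
  shows "local_fun (\<lambda>z k. pair (F z k) (G z k))" "local_fun (\<lambda>z k. F z k + G z k)"
    "local_fun (\<lambda>z k. F z k - G z k)" "local_fun (\<lambda>z k. F z k * G z k)"
    "local_fun (\<lambda>z k. F z k ^ G z k)" "local_pred (\<lambda>z k. F z k = G z k)"
    "local_pred (\<lambda>z k. F z k \<le> G z k)"
  by (rule local_rec2[OF _ assms], intro rec_intro)+

lemma local_connectives:
  assumes "local_pred P" "local_pred Q"
  shows "local_pred (\<lambda>z k. P z k \<and> Q z k)" "local_pred (\<lambda>z k. P z k \<longrightarrow> Q z k)"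
    "local_pred (\<lambda>z k. P z k \<longleftrightarrow> Q z k)"
proof -
  have "local_pred (\<lambda>z k. of_bool (P z k) * of_bool (Q z k) \<noteq> (0::nat))"
    "local_pred (\<lambda>z k. of_bool (P z k) \<le> (of_bool (Q z k) :: nat))"
    "local_pred (\<lambda>z k. of_bool (P z k) = (of_bool (Q z k) :: nat))"
    by (rule local_rec2[OF _ assms], intro rec_intro)+
  moreover have "of_bool p * of_bool q \<noteq> (0::nat) \<longleftrightarrow> p \<and> q" "of_bool p \<le> (of_bool q :: nat) \<longleftrightarrow> (p \<longrightarrow> q)"
    "of_bool p = (of_bool q :: nat) \<longleftrightarrow> (p \<longleftrightarrow> q)" for p q
    by auto
  ultimately show "local_pred (\<lambda>z k. P z k \<and> Q z k)" "local_pred (\<lambda>z k. P z k \<longrightarrow> Q z k)"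
    "local_pred (\<lambda>z k. P z k \<longleftrightarrow> Q z k)"
    by simp_all
qed

lemma local_not:
  assumes "local_pred P"
  shows "local_pred (\<lambda>z k. \<not> P z k)"
  using local_rec1[OF dec_eq[OF rec_id rec_const[of _ 0]] assms] by simp

lemma local_if:
  assumes "local_pred P" "local_fun F" "local_fun G"
  shows "local_fun (\<lambda>z k. if P z k then F z k else G z k)"
proof -
  have "local_fun (\<lambda>z k. of_bool (P z k) * F z k + of_bool (\<not> P z k) * G z k)"
    using assms by (intro local_ops2 local_not)
  then show ?thesis
    by (rule back_subst[of local_fun]) (auto simp: fun_eq_iff)
qed

lemmas [local_intro] = local_const local_var local_ops local_ops2 local_connectives local_not local_if
  local_lookup

text \<open>
  The entries of \<open>z\<close> are divided into kinds by the first component of their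
  addresses. Kind \<open>0\<close> lists the notations under consideration, and kind \<open>1\<close> the sets belonging to them, a
  positive entry meaning membership; the others describe the runs of all machines with these sets as
  oracles. A run \<open>r\<close> is given as \<open>pair b (pair e x)\<close> by the number \<open>b\<close> of its oracle, its program
  and its input. Integer positions of the tape are replaced by their codes.
\<close>
definition is_notation :: "(nat \<Rightarrow> nat) \<Rightarrow> nat \<Rightarrow> nat" where
  "is_notation z b = z (pair 0 b)"

definition column :: "(nat \<Rightarrow> nat) \<Rightarrow> nat \<Rightarrow> nat \<Rightarrow> nat" where
  "column z b x = z (pair 1 (pair b x))"

definition state :: "(nat \<Rightarrow> nat) \<Rightarrow> nat \<Rightarrow> nat \<Rightarrow> nat" where
  "state z r t = z (pair 2 (pair r t))"

definition head :: "(nat \<Rightarrow> nat) \<Rightarrow> nat \<Rightarrow> nat \<Rightarrow> nat" where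
  "head z r t = z (pair 3 (pair r t))"

definition cell :: "(nat \<Rightarrow> nat) \<Rightarrow> nat \<Rightarrow> nat \<Rightarrow> nat \<Rightarrow> nat" where
  "cell z r t i = z (pair 4 (pair (pair r t) i))"

definition table_entry :: "(nat \<Rightarrow> nat) \<Rightarrow> nat \<Rightarrow> nat \<Rightarrow> nat" where
  "table_entry z e key = z (pair 5 (pair e key))"

definition count :: "(nat \<Rightarrow> nat) \<Rightarrow> nat \<Rightarrow> nat \<Rightarrow> nat \<Rightarrow> nat" where
  "count z r t i = z (pair 6 (pair (pair r t) i))"

definition extent :: "(nat \<Rightarrow> nat) \<Rightarrow> nat \<Rightarrow> nat \<Rightarrow> nat" where
  "extent z r t = z (pair 7 (pair r t))"

lemma local_is_notation [local_intro]:
  assumes "local_fun F"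
  shows "local_fun (\<lambda>z k. is_notation z (F z k))"
  unfolding is_notation_def by (intro local_intro assms)

lemma local_accessors [local_intro]:
  assumes "local_fun F" "local_fun G"
  shows "local_fun (\<lambda>z k. column z (F z k) (G z k))"
    "local_fun (\<lambda>z k. state z (F z k) (G z k))" "local_fun (\<lambda>z k. head z (F z k) (G z k))"
    "local_fun (\<lambda>z k. table_entry z (F z k) (G z k))" "local_fun (\<lambda>z k. extent z (F z k) (G z k))"
  unfolding column_def state_def head_def table_entry_def extent_def
  by (intro local_intro assms)+

lemma local_accessors3 [local_intro]:
  assumes "local_fun F" "local_fun G" "local_fun H"
  shows "local_fun (\<lambda>z k. cell z (F z k) (G z k) (H z k))" "local_fun (\<lambda>z k. count z (F z k) (G z k) (H z k))"
  unfolding cell_def count_def by (intro local_intro assms)+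

definition go_left :: "nat \<Rightarrow> nat" where
  "go_left h = (if even h then if h = 0 then 1 else h - 2 else h + 2)"

definition go_right :: "nat \<Rightarrow> nat" where
  "go_right h = (if even h then h + 2 else if h = 1 then 0 else h - 2)"

lemma int_decode_even: "int_decode (2 * n) = int n"
  by (simp add: int_decode_def sum_decode_def)

lemma int_decode_odd: "int_decode (2 * n + 1) = - int n - 1"
  by (simp add: int_decode_def sum_decode_def)

lemma int_decode_go_left: "int_decode (go_left h) = int_decode h - 1"
proof (cases "even h")
  case True
  then obtain n where n: "h = 2 * n" ..
  show ?thesis
    using int_decode_even[of n] int_decode_even[of "n - 1"] int_decode_odd[of 0]
    by (cases n) (auto simp: go_left_def n)
next
  case False
  then obtain n where n: "h = 2 * n + 1" ..
  show ?thesis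
    using int_decode_odd[of n] int_decode_odd[of "n + 1"] by (auto simp: go_left_def n)
qed

lemma int_decode_go_right: "int_decode (go_right h) = int_decode h + 1"
proof (cases "even h")
  case True
  then obtain n where n: "h = 2 * n" ..
  show ?thesis
    using int_decode_even[of n] int_decode_even[of "n + 1"] by (auto simp: go_right_def n)
next
  case False
  then obtain n where n: "h = 2 * n + 1" ..
  show ?thesis
    using int_decode_odd[of n] int_decode_odd[of "n - 1"] int_decode_even[of 0]
    by (cases n) (auto simp: go_right_def n)
qed

definition oracle_symbol :: "(nat \<Rightarrow> nat) \<Rightarrow> nat \<Rightarrow> nat \<Rightarrow> nat" where
  "oracle_symbol z b h = (if even h then of_bool (column z b (h div 2) \<noteq> 0) else 2)"

definition action :: "(nat \<Rightarrow> nat) \<Rightarrow> nat \<Rightarrow> nat \<Rightarrow> nat" where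
  "action z r t = table_entry z (pfst (psnd r))
     (pair (state z r t) (pair (oracle_symbol z (pfst r) (head z r t)) (cell z r t (head z r t))))"

definition outcome :: "(nat \<Rightarrow> nat) \<Rightarrow> nat \<Rightarrow> nat \<Rightarrow> nat" where
  "outcome z r t = count z r t (extent z r t)"

lemma local_oracle_symbol [local_intro]:
  assumes "local_fun B" "local_fun H"
  shows "local_fun (\<lambda>z k. oracle_symbol z (B z k) (H z k))"
  unfolding oracle_symbol_def by (intro local_intro assms)

lemma local_action [local_intro]:
  assumes "local_fun F" "local_fun G"
  shows "local_fun (\<lambda>z k. action z (F z k) (G z k))" "local_fun (\<lambda>z k. outcome z (F z k) (G z k))"
  unfolding action_def outcome_def by (intro local_intro assms)+

text \<open>
  These rules determine the instruction tables, by recursion on the program, and all runs, by recursion on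
  the time \<open>t\<close>. The output is the number of strokes on an infinite tape; it becomes accessible to local rules
  by counting the strokes of initial segments and guessing an \<open>extent\<close> beyond which there
  are none.
\<close>
definition machine_rules :: "(nat \<Rightarrow> nat) \<Rightarrow> nat \<Rightarrow> nat \<Rightarrow> nat \<Rightarrow> bool" where
  "machine_rules z r t i \<longleftrightarrow>
     table_entry z 0 i = 0 \<and>
     table_entry z (Suc r) i =
       (if pfst (pfst r) = i then Suc (psnd (pfst r)) else table_entry z (psnd r) i) \<and>
     state z r 0 = 0 \<and> head z r 0 = 0 \<and>
     cell z r 0 i = of_bool (even i \<and> i div 2 \<le> psnd (psnd r)) \<and>
     state z r (Suc t) = (if action z r t = 0 then state z r t else pfst (action z r t - 1)) \<and>
     head z r (Suc t) = (if action z r t = 0 then head z r t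
       else if psnd (psnd (action z r t - 1)) = 0 then go_left (head z r t) else go_right (head z r t)) \<and>
     cell z r (Suc t) i = (if action z r t \<noteq> 0 \<and> i = head z r t
       then pfst (psnd (action z r t - 1)) else cell z r t i) \<and>
     count z r t 0 = 0 \<and> count z r t (Suc i) = count z r t i + of_bool (cell z r t i = 1) \<and>
     (extent z r t \<le> i \<longrightarrow> cell z r t i \<noteq> 1)"

lemma local_machine_rules:
  assumes "local_fun F" "local_fun G" "local_fun H"
  shows "local_pred (\<lambda>z k. machine_rules z (F z k) (G z k) (H z k))"
  unfolding machine_rules_def go_left_def go_right_def by (intro local_intro assms)

definition column_set :: "(nat \<Rightarrow> nat) \<Rightarrow> nat \<Rightarrow> nat set" where
  "column_set z b = {x. column z b x \<noteq> 0}"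

definition run_of :: "(nat \<Rightarrow> nat) \<Rightarrow> nat \<Rightarrow> nat \<Rightarrow> configuration" where
  "run_of z r t = run (column_set z (pfst r)) (pfst (psnd r)) (psnd (psnd r)) t"

lemma oracle_symbol_eq: "oracle_symbol z b h = oracle_tape (column_set z b) (int_decode h)"
proof (cases "even h")
  case True
  then obtain n where n: "h = 2 * n" ..
  show ?thesis
    by (simp add: n oracle_symbol_def oracle_tape_def int_decode_even column_set_def)
next
  case False
  then obtain n where n: "h = 2 * n + 1" ..
  show ?thesis
    using int_decode_odd[of n] by (simp add: n oracle_symbol_def oracle_tape_def)
qed

lemma initial_cell: "of_bool (even i \<and> i div 2 \<le> x) = snd (snd (tm_init x)) (int_decode i)"
proof (cases "even i")
  case True
  then obtain n where n: "i = 2 * n" ..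
  show ?thesis
    by (simp add: n tm_init_def int_decode_even)
next
  case False
  then obtain n where n: "i = 2 * n + 1" ..
  show ?thesis
    using int_decode_odd[of n] by (simp add: n tm_init_def)
qed

context
  fixes z :: "nat \<Rightarrow> nat"
  assumes rules: "\<And>r t i. machine_rules z r t i"
begin

lemma table_entry_eq: "table_entry z e key = lookup e key"
proof (induction e rule: less_induct)
  case (less e)
  show ?case
  proof (cases e)
    case 0
    then show ?thesis
      using rules[of 0 0 key] by (simp add: machine_rules_def lookup_0)
  next
    case (Suc m)
    have "psnd m < e"
      using le_prod_encode_2[of "psnd m" "pfst m"] by (simp add: Suc)
    then show ?thesis
      using rules[of m 0 key] less by (simp add: machine_rules_def lookup_Suc Suc)
  qed
qed

lemma action_eq:
  assumes "state z r t = q" "int_decode (head z r t) = h" "\<And>i. cell z r t i = T (int_decode i)"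
  shows "action z r t = lookup (pfst (psnd r)) (pair q (pair (oracle_tape (column_set z (pfst r)) h) (T h)))"
  unfolding action_def table_entry_eq oracle_symbol_eq assms(1,3) by (simp add: assms(2))

lemma configuration_eq:
  "run_of z r t = (state z r t, int_decode (head z r t), \<lambda>i. cell z r t (int_encode i))"
proof (induction t)
  case 0
  show ?case
    using rules[of r 0] initial_cell[of _ "psnd (psnd r)"] int_decode_even[of 0]
    by (simp add: machine_rules_def run_of_def tm_init_def)
next
  case (Suc t)
  let ?h = "int_decode (head z r t)" and ?T = "\<lambda>i. cell z r t (int_encode i)"
  have a: "action z r t = lookup (pfst (psnd r))
      (pair (state z r t) (pair (oracle_tape (column_set z (pfst r)) ?h) (?T ?h)))"
    by (rule action_eq) auto
  have T: "(\<lambda>i. cell z r (Suc t) (int_encode i)) =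
      (if action z r t = 0 then ?T else ?T(?h := pfst (psnd (action z r t - 1))))"
  proof -
    have "int_encode i = head z r t \<longleftrightarrow> i = ?h" for i
      by (metis int_encode_inverse int_decode_inverse)
    then show ?thesis
      using rules[of r t] by (auto simp: machine_rules_def fun_eq_iff)
  qed
  have "state z r (Suc t) = (if action z r t = 0 then state z r t else pfst (action z r t - 1))"
    "int_decode (head z r (Suc t)) = (if action z r t = 0 then ?h
      else if psnd (psnd (action z r t - 1)) = 0 then ?h - 1 else ?h + 1)"
    using rules[of r t 0] by (auto simp: machine_rules_def int_decode_go_left int_decode_go_right)
  moreover have "run_of z r (Suc t) = (case tm_step (column_set z (pfst r)) (pfst (psnd r)) (run_of z r t) of
      None \<Rightarrow> run_of z r t | Some c \<Rightarrow> c)"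
    by (simp only: run_of_def run.simps)
  ultimately show ?case
    unfolding T Suc.IH tm_step_lookup a[symmetric] by (simp add: Let_def)
qed

lemma action_eq_0_iff:
  "action z r t = 0 \<longleftrightarrow> halts_at (column_set z (pfst r)) (pfst (psnd r)) (psnd (psnd r)) t"
proof -
  have "action z r t = lookup (pfst (psnd r)) (pair (state z r t)
    (pair (oracle_tape (column_set z (pfst r)) (int_decode (head z r t)))
      (cell z r t (int_encode (int_decode (head z r t))))))"
    by (rule action_eq[where T = "\<lambda>i. cell z r t (int_encode i)"]) auto
  then show ?thesis
    using configuration_eq[of r t] unfolding halts_at_def run_of_def
    by (simp only: tm_step_lookup Let_def) simp
qed

lemma outcome_eq: "outcome z r t = strokes (run_of z r t)"
proof -
  have count: "count z r t n = card {i. i < n \<and> cell z r t i = 1}" for n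
  proof (induction n)
    case 0
    then show ?case
      using rules[of r t 0] by (simp add: machine_rules_def)
  next
    case (Suc n)
    have "{i. i < Suc n \<and> cell z r t i = 1} =
        (if cell z r t n = 1 then insert n {i. i < n \<and> cell z r t i = 1} else {i. i < n \<and> cell z r t i = 1})"
      by (auto simp: less_Suc_eq)
    then show ?case
      using rules[of r t n] Suc by (auto simp: machine_rules_def)
  qed
  have ext: "cell z r t i \<noteq> 1" if "extent z r t \<le> i" for i
    using rules[of r t i] that by (simp add: machine_rules_def)
  have "{i. i < extent z r t \<and> cell z r t i = 1} = {i. cell z r t i = 1}"
    using ext not_le by blast
  also have "\<dots> = int_encode ` {i. cell z r t (int_encode i) = 1}"
    by (auto simp: image_iff) (metis int_decode_inverse)
  also have "card \<dots> = card {i. cell z r t (int_encode i) = 1}"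
    by (rule card_image) (rule inj_int_encode)
  finally show ?thesis
    by (simp add: outcome_def count strokes_def configuration_eq)
qed

end

text \<open>
  The notations and the columns are arbitrary: the rules leave no choice for
  the runs, but they also impose nothing on the oracles.
\<close>
lemma ex_machine_rules:
  fixes nt :: "nat \<Rightarrow> nat" and cl :: "nat \<Rightarrow> nat \<Rightarrow> nat"
  obtains z where "\<And>r t i. machine_rules z r t i" "is_notation z = nt" "column z = cl"
proof -
  define cf where "cf r t = run {x. cl (pfst r) x \<noteq> 0} (pfst (psnd r)) (psnd (psnd r)) t" for r t
  define tp where "tp r t i = snd (snd (cf r t)) (int_decode i)" for r t i
  have "\<exists>n. \<forall>i\<ge>n. tp r t i \<noteq> 1" for r t
  proof -
    have "finite (int_encode ` {i. snd (snd (cf r t)) i \<noteq> 0})"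
      unfolding cf_def by (intro finite_imageI finite_tape_run)
    then obtain n where n: "\<And>i. i \<in> int_encode ` {i. snd (snd (cf r t)) i \<noteq> 0} \<Longrightarrow> i < n"
      using finite_nat_set_iff_bounded by metis
    have "tp r t i \<noteq> 1" if "n \<le> i" for i
    proof
      assume "tp r t i = 1"
      then have "int_encode (int_decode i) \<in> int_encode ` {i. snd (snd (cf r t)) i \<noteq> 0}"
        by (intro imageI) (simp add: tp_def)
      then show False
        using n[of i] that by simp
    qed
    then show ?thesis
      by blast
  qed
  then obtain ext where ext: "\<And>r t i. ext r t \<le> i \<Longrightarrow> tp r t i \<noteq> 1"
    by metis
  define z where "z m = (let u = psnd m in
    if pfst m = 0 then nt u
    else if pfst m = 1 then cl (pfst u) (psnd u)
    else if pfst m = 2 then fst (cf (pfst u) (psnd u))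
    else if pfst m = 3 then int_encode (fst (snd (cf (pfst u) (psnd u))))
    else if pfst m = 4 then tp (pfst (pfst u)) (psnd (pfst u)) (psnd u)
    else if pfst m = 5 then lookup (pfst u) (psnd u)
    else if pfst m = 6 then card {j. j < psnd u \<and> tp (pfst (pfst u)) (psnd (pfst u)) j = 1}
    else ext (pfst u) (psnd u))" for m
  have acc: "is_notation z = nt" "column z = cl"
    "state z r t = fst (cf r t)" "head z r t = int_encode (fst (snd (cf r t)))"
    "cell z r t i = tp r t i" "table_entry z e key = lookup e key"
    "count z r t i = card {j. j < i \<and> tp r t j = 1}" "extent z r t = ext r t" for r t i e key
    by (simp_all add: fun_eq_iff is_notation_def column_def state_def head_def cell_def
        table_entry_def count_def extent_def z_def)
  have action: "action z r t = lookup (pfst (psnd r)) (pair (fst (cf r t))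
      (pair (oracle_tape {x. cl (pfst r) x \<noteq> 0} (fst (snd (cf r t))))
        (snd (snd (cf r t)) (fst (snd (cf r t))))))" for r t
    by (simp add: action_def acc oracle_symbol_eq column_set_def tp_def)
  have step: "cf r (Suc t) = (if action z r t = 0 then cf r t else
      (pfst (action z r t - 1),
       if psnd (psnd (action z r t - 1)) = 0 then fst (snd (cf r t)) - 1 else fst (snd (cf r t)) + 1,
       (snd (snd (cf r t)))(fst (snd (cf r t)) := pfst (psnd (action z r t - 1)))))" for r t
  proof -
    obtain q h T where c: "cf r t = (q, h, T)"
      by (cases "cf r t")
    have "cf r (Suc t) = (case tm_step {x. cl (pfst r) x \<noteq> 0} (pfst (psnd r)) (cf r t) of
        None \<Rightarrow> cf r t | Some c \<Rightarrow> c)"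
      by (simp only: cf_def run.simps)
    then show ?thesis
      unfolding c tm_step_lookup by (simp add: action c Let_def)
  qed
  have enc: "int_encode (h - 1) = go_left (int_encode h)" "int_encode (h + 1) = go_right (int_encode h)" for h
    using int_decode_go_left[of "int_encode h"] int_decode_go_right[of "int_encode h"]
    by (metis int_encode_inverse int_decode_inverse)+
  have dec: "int_decode i = h \<longleftrightarrow> i = int_encode h" for i h
    by (metis int_encode_inverse int_decode_inverse)
  have count: "card {j. j < Suc i \<and> tp r t j = 1} = card {j. j < i \<and> tp r t j = 1} + of_bool (tp r t i = 1)"
    for r t i
  proof -
    have "{j. j < Suc i \<and> tp r t j = 1} =
        (if tp r t i = 1 then insert i {j. j < i \<and> tp r t j = 1} else {j. j < i \<and> tp r t j = 1})"
      by (auto simp: less_Suc_eq)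
    then show ?thesis
      by simp
  qed
  have init: "cf r 0 = tm_init (psnd (psnd r))" for r
    by (simp add: cf_def)
  have "machine_rules z r t i" for r t i
    unfolding machine_rules_def acc
  proof (intro conjI impI)
    show "lookup 0 i = 0"
      by (rule lookup_0)
    show "lookup (Suc r) i = (if pfst (pfst r) = i then Suc (psnd (pfst r)) else lookup (psnd r) i)"
      by (rule lookup_Suc)
    show "fst (cf r 0) = 0" "int_encode (fst (snd (cf r 0))) = 0"
      using int_decode_even[of 0] dec[of 0 0] by (simp_all add: init tm_init_def)
    show "tp r 0 i = of_bool (even i \<and> i div 2 \<le> psnd (psnd r))"
      by (simp add: tp_def init initial_cell)
    show "fst (cf r (Suc t)) = (if action z r t = 0 then fst (cf r t) else pfst (action z r t - 1))"
      by (simp add: step)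
    show "int_encode (fst (snd (cf r (Suc t)))) =
      (if action z r t = 0 then int_encode (fst (snd (cf r t)))
       else if psnd (psnd (action z r t - 1)) = 0 then go_left (int_encode (fst (snd (cf r t))))
       else go_right (int_encode (fst (snd (cf r t)))))"
      by (simp add: step enc)
    show "tp r (Suc t) i = (if action z r t \<noteq> 0 \<and> i = int_encode (fst (snd (cf r t)))
      then pfst (psnd (action z r t - 1)) else tp r t i)"
      by (simp add: tp_def step dec)
    show "card {j. j < 0 \<and> tp r t j = 1} = 0"
      by simp
    show "card {j. j < Suc i \<and> tp r t j = 1} = card {j. j < i \<and> tp r t j = 1} + of_bool (tp r t i = 1)"
      by (rule count)
    show "tp r t i \<noteq> 1" if "ext r t \<le> i"
      using that by (rule ext)
  qed
  then show ?thesis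
    using acc(1,2) by (rule that)
qed


section \<open>A local description of the jump hierarchy\<close>

text \<open>
  The rules follow the generation of notations backwards from \<open>a\<close>: with a notation also the notations
  that it is built from are under consideration, and its column is obtained from theirs. Column \<open>0\<close> is the
  empty oracle used in fundamental sequences. For membership in a jump, the entry is one more than a halting time, so
  that the existential quantifier disappears; nonmembership is universal anyway.
  Column \<open>7\<close> is the set decided by program \<open>i\<close> from column \<open>a\<close>, and column
  \<open>14\<close> the diagonal set for column \<open>7\<close>. Neither \<open>0\<close> nor \<open>7\<close> nor \<open>14\<close> is
  coprime to \<open>7\<close>, as notations are, so these columns do not collide with the hierarchy.
\<close>
definition hierarchy_rules :: "nat \<Rightarrow> nat \<Rightarrow> (nat \<Rightarrow> nat) \<Rightarrow> nat \<Rightarrow> nat \<Rightarrow> nat \<Rightarrow> nat \<Rightarrow> bool" where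
  "hierarchy_rules a i z p x s y \<longleftrightarrow>
     column z 0 p = 0 \<and> column z 1 p = 0 \<and> is_notation z a \<noteq> 0 \<and>
     (p \<noteq> 0 \<and> is_notation z (2 ^ p) \<noteq> 0 \<longrightarrow> is_notation z p \<noteq> 0 \<and>
        (column z (2 ^ p) x \<noteq> 0 \<longrightarrow> action z (pair p (pair x x)) (column z (2 ^ p) x - 1) = 0) \<and>
        (column z (2 ^ p) x = 0 \<longrightarrow> action z (pair p (pair x x)) s \<noteq> 0)) \<and>
     (is_notation z (3 * 5 ^ p) \<noteq> 0 \<and> action z (pair 0 (pair p x)) s = 0 \<longrightarrow>
        is_notation z (outcome z (pair 0 (pair p x)) s) \<noteq> 0 \<and>
        (column z (3 * 5 ^ p) (pair y x) \<noteq> 0 \<longleftrightarrow> column z (outcome z (pair 0 (pair p x)) s) y \<noteq> 0)) \<and>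
     (action z (pair a (pair i p)) s = 0 \<longrightarrow>
        (column z 7 p \<noteq> 0 \<longleftrightarrow> outcome z (pair a (pair i p)) s \<noteq> 0)) \<and>
     (column z 14 p \<noteq> 0 \<longrightarrow> action z (pair 7 (pair p p)) (column z 14 p - 1) = 0 \<and>
        outcome z (pair 7 (pair p p)) (column z 14 p - 1) = 0) \<and>
     (column z 14 p = 0 \<and> action z (pair 7 (pair p p)) s = 0 \<longrightarrow>
        outcome z (pair 7 (pair p p)) s \<noteq> 0)"

lemma local_hierarchy_rules:
  assumes "local_fun P" "local_fun F" "local_fun G" "local_fun H"
  shows "local_pred (\<lambda>z k. hierarchy_rules a i z (P z k) (F z k) (G z k) (H z k))"
  unfolding hierarchy_rules_def by (intro local_intro assms)

definition diagonal :: "nat set \<Rightarrow> nat set" where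
  "diagonal G = {p. tm_computes G p p 0}"

lemma kleene_O_pos: "kleene_O a \<Longrightarrow> a \<noteq> 0"
  by (erule kleene_O.cases) auto

lemma coprime_7_2_power: "coprime (7::nat) (2 ^ n)"
proof -
  have "coprime (7::nat) 2"
    by (simp add: coprime_iff_gcd_eq_1 gcd_red_nat[of 7 2])
  then show ?thesis
    by simp
qed

lemma coprime_7_limit: "coprime (7::nat) (3 * 5 ^ n)"
proof -
  have "coprime (7::nat) 3" "coprime (7::nat) 5"
    by (simp_all add: coprime_iff_gcd_eq_1 gcd_red_nat[of 7 3] gcd_red_nat[of 7 5] gcd_red_nat[of 5 2])
  then show ?thesis
    by simp
qed

lemma limit_neq_2_power: "3 * 5 ^ e \<noteq> (2::nat) ^ p"
proof
  assume eq: "3 * 5 ^ e = (2::nat) ^ p"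
  have "odd ((2::nat) ^ p)"
    by (simp add: eq[symmetric])
  then have "p = 0"
    by simp
  with eq show False
    by simp
qed

lemma iterated_jump_coprime: "iterated_jump b H \<Longrightarrow> coprime 7 b"
  by (erule iterated_jump.cases) (metis coprime_7_2_power coprime_7_limit coprime_1_right)+

lemma iterated_jump_1: "iterated_jump 1 H \<Longrightarrow> H = {}"
proof (erule iterated_jump.cases)
  fix a H'
  assume "(1::nat) = 2 ^ a" "kleene_O a"
  moreover from this have "a = 0"
    by (metis dvd_power neq0_conv odd_one)
  ultimately show "H = {}"
    using kleene_O_pos by blast
qed auto

lemma iterated_jump_succ:
  assumes "iterated_jump (2 ^ p) H" "p \<noteq> 0"
  obtains H' where "iterated_jump p H'" "H = turing_jump H'"
  using assms(1)
proof (cases rule: iterated_jump.cases)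
  case jump_zero
  then show ?thesis
    using assms(2) by simp
next
  case (jump_succ a H')
  then have "a = p"
    by simp
  with jump_succ that show ?thesis
    by blast
next
  case (jump_limit e g H')
  then show ?thesis
    using limit_neq_2_power[of e p] by simp
qed

lemma iterated_jump_limit:
  assumes "iterated_jump (3 * 5 ^ e) H"
  obtains g K where "\<And>n. tm_computes {} e n (g n)" "\<And>n. iterated_jump (g n) (K n)"
    "H = {pair x n | x n. x \<in> K n}"
  using assms
proof (cases rule: iterated_jump.cases)
  case jump_zero
  then show ?thesis
    using limit_neq_2_power[of e 0] by simp
next
  case (jump_succ a H')
  then show ?thesis
    using limit_neq_2_power[of e a] by simp
next
  case (jump_limit e' g K)
  then have "e' = e"
    by simp
  with jump_limit that show ?thesis
    by blast
qed

lemma iterated_jump_unique: "iterated_jump b H \<Longrightarrow> iterated_jump b H' \<Longrightarrow> H = H'"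
proof (induction arbitrary: H' rule: iterated_jump.induct)
  case jump_zero
  show ?case
    using iterated_jump_1[OF jump_zero.prems] by simp
next
  case (jump_succ a H)
  then show ?case
    using iterated_jump_succ[OF jump_succ.prems kleene_O_pos] by metis
next
  case (jump_limit e g H)
  obtain g' K where K: "\<And>n. tm_computes {} e n (g' n)" "\<And>n. iterated_jump (g' n) (K n)"
    "H' = {pair x n | x n. x \<in> K n}"
    by (rule iterated_jump_limit[OF jump_limit.prems]) (rule that)
  have "g' n = g n" for n
    using tm_computes_unique[OF K(1) jump_limit.hyps(2)] .
  then have "H n = K n" for n
    using jump_limit.IH[of n "K n"] K(2)[of n] by simp
  then show ?case
    by (simp add: K(3))
qed

context
  fixes z :: "nat \<Rightarrow> nat" and a i :: nat
  assumes machine: "\<And>r t j. machine_rules z r t j"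
    and hierarchy: "\<And>p x s y. hierarchy_rules a i z p x s y"
begin

lemma action_eq_0: "action z (pair b (pair e x)) t = 0 \<longleftrightarrow> halts_at (column_set z b) e x t"
  by (simp add: action_eq_0_iff[OF machine])

lemma outcome_strokes: "outcome z (pair b (pair e x)) t = strokes (run (column_set z b) e x t)"
  by (simp add: outcome_eq[OF machine] run_of_def)

lemma column_set_0: "column_set z 0 = {}" "column_set z 1 = {}"
proof -
  have "column z 0 p = 0" "column z 1 p = 0" for p
    using hierarchy[of p 0 0 0] unfolding hierarchy_rules_def by blast+
  then show "column_set z 0 = {}" "column_set z 1 = {}"
    by (simp_all add: column_set_def)
qed

lemma is_notation_a: "is_notation z a \<noteq> 0"
  using hierarchy[of 0 0 0 0] unfolding hierarchy_rules_def by blast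

lemma column_succ:
  assumes "p \<noteq> 0" "is_notation z (2 ^ p) \<noteq> 0"
  shows "is_notation z p \<noteq> 0" "x \<in> column_set z (2 ^ p) \<longleftrightarrow> (\<exists>s. halts_at (column_set z p) x x s)"
proof -
  have *: "is_notation z p \<noteq> 0 \<and>
      (column z (2 ^ p) x \<noteq> 0 \<longrightarrow> halts_at (column_set z p) x x (column z (2 ^ p) x - 1)) \<and>
      (column z (2 ^ p) x = 0 \<longrightarrow> \<not> halts_at (column_set z p) x x s)" for s
    using hierarchy[of p x s 0] assms unfolding hierarchy_rules_def action_eq_0 by blast
  then show "is_notation z p \<noteq> 0"
    by blast
  show "x \<in> column_set z (2 ^ p) \<longleftrightarrow> (\<exists>s. halts_at (column_set z p) x x s)"
    using * by (cases "column z (2 ^ p) x = 0") (auto simp: column_set_def[of z "2 ^ p"])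
qed

lemma column_limit:
  assumes "is_notation z (3 * 5 ^ e) \<noteq> 0" "halts_at {} e n s"
  shows "is_notation z (strokes (run {} e n s)) \<noteq> 0"
    "pair y n \<in> column_set z (3 * 5 ^ e) \<longleftrightarrow> y \<in> column_set z (strokes (run {} e n s))"
proof -
  have *: "is_notation z (strokes (run {} e n s)) \<noteq> 0 \<and>
      (column z (3 * 5 ^ e) (pair y n) \<noteq> 0 \<longleftrightarrow> column z (strokes (run {} e n s)) y \<noteq> 0)"
    using hierarchy[of e n s y] assms
    unfolding hierarchy_rules_def action_eq_0 outcome_strokes column_set_0 by blast
  then show "is_notation z (strokes (run {} e n s)) \<noteq> 0"
    by blast
  show "pair y n \<in> column_set z (3 * 5 ^ e) \<longleftrightarrow> y \<in> column_set z (strokes (run {} e n s))"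
    using * by (simp add: column_set_def)
qed

text \<open>
  By induction on the generation of the hierarchy: the rules put the predecessor of a successor notation and the
  members of a fundamental sequence under consideration as well, and they express the column in
  question in terms of those columns.
\<close>
lemma column_set_notation:
  "iterated_jump b H \<Longrightarrow> is_notation z b \<noteq> 0 \<Longrightarrow> column_set z b = H"
proof (induction rule: iterated_jump.induct)
  case jump_zero
  show ?case
    by (rule column_set_0)
next
  case (jump_succ p H)
  have p: "p \<noteq> 0"
    using jump_succ.hyps(1) by (rule kleene_O_pos)
  have H: "column_set z p = H"
    using column_succ(1)[OF p jump_succ.prems] by (rule jump_succ.IH)
  show ?case
    using column_succ(2)[OF p jump_succ.prems] unfolding H
    by (auto simp: turing_jump_def tm_computes_iff_run)
next
  case (jump_limit e g H)
  have limit: "pair y n \<in> column_set z (3 * 5 ^ e) \<longleftrightarrow> y \<in> H n" for n y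
  proof -
    obtain s where s: "halts_at {} e n s" "g n = strokes (run {} e n s)"
      using jump_limit.hyps(2)[of n] unfolding tm_computes_iff_run by blast
    note c = column_limit[OF jump_limit.prems s(1), folded s(2)]
    show ?thesis
      unfolding c(2) jump_limit.IH[OF c(1)] ..
  qed
  have "m \<in> column_set z (3 * 5 ^ e) \<longleftrightarrow> m \<in> {pair x n | x n. x \<in> H n}" for m
  proof -
    have "m \<in> column_set z (3 * 5 ^ e) \<longleftrightarrow> pfst m \<in> H (psnd m)"
      using limit[of "pfst m" "psnd m"] by simp
    also have "\<dots> \<longleftrightarrow> m \<in> {pair x n | x n. x \<in> H n}"
      unfolding mem_Collect_eq by (metis pair_pfst_psnd pfst_pair psnd_pair)
    finally show ?thesis .
  qed
  then show ?case
    by blast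
qed

lemma column_7:
  "halts_at (column_set z a) i p s \<Longrightarrow> column z 7 p \<noteq> 0 \<longleftrightarrow> strokes (run (column_set z a) i p s) \<noteq> 0"
  using hierarchy[of p 0 s 0] unfolding hierarchy_rules_def action_eq_0 outcome_strokes by blast

lemma column_14:
  "column z 14 p \<noteq> 0 \<Longrightarrow> \<exists>s. halts_at (column_set z 7) p p s \<and> strokes (run (column_set z 7) p p s) = 0"
  "column z 14 p = 0 \<Longrightarrow> halts_at (column_set z 7) p p s \<Longrightarrow> strokes (run (column_set z 7) p p s) \<noteq> 0"
  using hierarchy[of p 0 s 0] unfolding hierarchy_rules_def action_eq_0 outcome_strokes by blast+

lemma column_sets:
  assumes "iterated_jump a H" "tm_decides H i G"
  shows "column_set z 7 = G" "column_set z 14 = diagonal G"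
proof -
  have H: "column_set z a = H"
    by (intro column_set_notation assms is_notation_a)
  have "p \<in> column_set z 7 \<longleftrightarrow> p \<in> G" for p
  proof -
    obtain s where "halts_at H i p s" "of_bool (p \<in> G) = strokes (run H i p s)"
      using assms(2) unfolding tm_decides_def tm_computes_iff_run by blast
    then show ?thesis
      using column_7[of p s] unfolding H by (auto simp: column_set_def of_bool_def split: if_splits)
  qed
  then show G: "column_set z 7 = G"
    by blast
  have "p \<in> column_set z 14 \<longleftrightarrow> p \<in> diagonal G" for p
  proof (cases "column z 14 p = 0")
    case True
    then show ?thesis
      using column_14(2)[of p] unfolding G by (force simp: column_set_def diagonal_def tm_computes_iff_run)
  next
    case False
    then show ?thesis
      using column_14(1)[of p] unfolding G by (force simp: column_set_def diagonal_def tm_computes_iff_run)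
  qed
  then show "column_set z 14 = diagonal G"
    by blast
qed

end

text \<open>
  The rules are satisfied if exactly the numbers that have an iterated jump are taken as
  notations.
\<close>
lemma ex_hierarchy_rules:
  assumes a: "iterated_jump a H" and G: "tm_decides H i G"
  obtains z where "\<And>r t j. machine_rules z r t j" "\<And>p x s y. hierarchy_rules a i z p x s y"
proof -
  define Y where "Y b = (if b = 7 then G else if b = 14 then diagonal G
    else if \<exists>H. iterated_jump b H then (THE H. iterated_jump b H) else {})" for b
  have Y: "Y b = K" if "iterated_jump b K" for b K
  proof -
    have "coprime 7 b"
      using that by (rule iterated_jump_coprime)
    then have "b \<noteq> 7" "b \<noteq> 14"
      by (auto simp: coprime_iff_gcd_eq_1)
    moreover have "(THE H. iterated_jump b H) = K"
      using that iterated_jump_unique by (intro the_equality) auto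
    ultimately show ?thesis
      using that by (auto simp: Y_def)
  qed
  have Y7: "Y 7 = G" "Y 14 = diagonal G"
    by (simp_all add: Y_def)
  have Y0: "Y 0 = {}" "Y 1 = {}"
  proof -
    have "\<not> (\<exists>K. iterated_jump 0 K)"
      using iterated_jump_coprime[of 0] by auto
    then show "Y 0 = {}"
      unfolding Y_def by (subst if_not_P, simp)+ (rule refl)
    show "Y 1 = {}"
      by (rule Y) (rule jump_zero)
  qed
  \<comment> \<open>The halting time that the rules demand as a witness of membership in column \<open>b\<close>.\<close>
  define wit where "wit b x = (SOME s. (\<forall>p. b = 2 ^ p \<longrightarrow> halts_at (Y p) x x s) \<and>
    (b = 14 \<longrightarrow> halts_at G x x s \<and> strokes (run G x x s) = 0))" for b x :: nat
  obtain z where z: "\<And>r t j. machine_rules z r t j"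
    "is_notation z = (\<lambda>b. of_bool (\<exists>H. iterated_jump b H))"
    "column z = (\<lambda>b x. if x \<in> Y b then Suc (wit b x) else 0)"
    by (rule ex_machine_rules[of "\<lambda>b. of_bool (\<exists>H. iterated_jump b H)"
          "\<lambda>b x. if x \<in> Y b then Suc (wit b x) else 0"]) (rule that)
  have C: "column_set z b = Y b" for b
    by (simp add: column_set_def z(3))
  have act: "action z (pair b (pair e x)) t = 0 \<longleftrightarrow> halts_at (Y b) e x t" for b e x t
    by (simp add: action_eq_0_iff[OF z(1)] C)
  have out: "outcome z (pair b (pair e x)) t = strokes (run (Y b) e x t)" for b e x t
    by (simp add: outcome_eq[OF z(1)] run_of_def C)
  have "hierarchy_rules a i z p x s y" for p x s y
    unfolding hierarchy_rules_def act out
  proof (intro conjI impI; (elim conjE)?)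
    show "column z 0 p = 0" "column z 1 p = 0"
      by (simp_all add: z(3) Y0[simplified])
    show "is_notation z a \<noteq> 0"
      using a by (auto simp: z(2))
  next
    assume p: "p \<noteq> 0" "is_notation z (2 ^ p) \<noteq> 0"
    then obtain K where "iterated_jump (2 ^ p) K"
      by (auto simp: z(2))
    then obtain K' where K': "iterated_jump p K'" "K = turing_jump K'" "iterated_jump (2 ^ p) K"
      using p(1) by (metis iterated_jump_succ)
    show "is_notation z p \<noteq> 0"
      using K'(1) by (auto simp: z(2))
    have jump: "x \<in> Y (2 ^ p) \<longleftrightarrow> (\<exists>s. halts_at (Y p) x x s)"
      unfolding Y[OF K'(1)] Y[OF K'(3)] K'(2) by (auto simp: turing_jump_def tm_computes_iff_run)
    show "\<not> halts_at (Y p) x x s" if "column z (2 ^ p) x = 0"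
      using that jump by (auto simp: z(3) split: if_splits)
    show "halts_at (Y p) x x (column z (2 ^ p) x - 1)" if c: "column z (2 ^ p) x \<noteq> 0"
    proof -
      have "(2::nat) ^ p \<noteq> 14"
        using coprime_7_2_power[of p] by (auto simp: coprime_iff_gcd_eq_1)
      moreover obtain s where "halts_at (Y p) x x s"
        using c jump by (auto simp: z(3) split: if_splits)
      ultimately have "\<exists>s. (\<forall>q. 2 ^ p = (2::nat) ^ q \<longrightarrow> halts_at (Y q) x x s) \<and>
          ((2::nat) ^ p = 14 \<longrightarrow> halts_at G x x s \<and> strokes (run G x x s) = 0)"
        by auto
      then have "halts_at (Y p) x x (wit (2 ^ p) x)"
        unfolding wit_def by (rule someI2_ex) blast
      then show ?thesis
        using c by (auto simp: z(3) split: if_splits)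
    qed
  next
    assume p: "is_notation z (3 * 5 ^ p) \<noteq> 0" "halts_at (Y 0) p x s"
    then obtain K where K: "iterated_jump (3 * 5 ^ p) K"
      by (auto simp: z(2))
    obtain g L where L: "\<And>n. tm_computes {} p n (g n)" "\<And>n. iterated_jump (g n) (L n)"
      "K = {pair x n | x n. x \<in> L n}"
      by (rule iterated_jump_limit[OF K]) (rule that)
    have g: "strokes (run (Y 0) p x s) = g x"
      using tm_computes_at[OF L(1) p(2)[unfolded Y0]] by (simp add: Y0)
    show "is_notation z (strokes (run (Y 0) p x s)) \<noteq> 0"
      unfolding g using L(2) by (auto simp: z(2))
    show "(column z (3 * 5 ^ p) (pair y x) \<noteq> 0) = (column z (strokes (run (Y 0) p x s)) y \<noteq> 0)"
      unfolding g by (simp add: z(3) Y[OF K] Y[OF L(2)] L(3))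
  next
    assume "halts_at (Y a) i p s"
    moreover have "tm_computes (Y a) i p (of_bool (p \<in> G))"
      using G by (simp add: Y[OF a] tm_decides_def)
    ultimately have "of_bool (p \<in> G) = strokes (run (Y a) i p s)"
      using tm_computes_at by blast
    then show "(column z 7 p \<noteq> 0) = (strokes (run (Y a) i p s) \<noteq> 0)"
      by (auto simp: z(3) Y7 of_bool_def split: if_splits)
  next
    assume c: "column z 14 p \<noteq> 0"
    have no: "14 \<noteq> (2::nat) ^ q" for q
      using coprime_7_2_power[of q] by (auto simp: coprime_iff_gcd_eq_1)
    have "p \<in> diagonal G"
      using c by (auto simp: z(3) Y7 split: if_splits)
    then have "\<exists>s. (\<forall>q. 14 = (2::nat) ^ q \<longrightarrow> halts_at (Y q) p p s) \<and>
        (14 = (14::nat) \<longrightarrow> halts_at G p p s \<and> strokes (run G p p s) = 0)"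
      using no by (auto simp: diagonal_def tm_computes_iff_run)
    then have "halts_at G p p (wit 14 p) \<and> strokes (run G p p (wit 14 p)) = 0"
      unfolding wit_def by (rule someI2_ex) blast
    then show "halts_at (Y 7) p p (column z 14 p - 1)" "strokes (run (Y 7) p p (column z 14 p - 1)) = 0"
      using c by (auto simp: z(3) Y7 split: if_splits)
  next
    assume "column z 14 p = 0" "halts_at (Y 7) p p s"
    then show "strokes (run (Y 7) p p s) \<noteq> 0"
      by (auto simp: z(3) Y7 diagonal_def tm_computes_iff_run split: if_splits)
  qed
  with z(1) show ?thesis
    by (rule that)
qed

text \<open>
  All rules are combined to a single local condition, whose index \<open>k\<close> codes the parameters of the
  rules, together with the requirement that \<open>n\<close> belongs to column \<open>c\<close> or not, according to \<open>b\<close>.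
\<close>
lemma hierarchy_column_reducible:
  assumes a: "iterated_jump a H" and G: "tm_decides H i G" and c: "c = 7 \<or> c = (14 :: nat)"
    and f: "calculates_maximal_chains f"
  shows "(if c = 7 then G else diagonal G) \<le>\<^sub>T fun_graph f"
proof -
  let ?X = "if c = 7 then G else diagonal G"
  define Q where "Q z k \<longleftrightarrow> machine_rules z (pfst k) (pfst (psnd k)) (psnd (psnd k)) \<and>
    hierarchy_rules a i z (pfst k) (pfst (psnd k)) (pfst (psnd (psnd k))) (psnd (psnd (psnd k)))" for z k
  define R where "R z m = (of_bool (Q z (psnd (psnd m)) \<and>
    (column z c (pfst m) \<noteq> 0 \<longleftrightarrow> pfst (psnd m) \<noteq> 0)) :: nat)" for z m
  have Q: "(\<forall>k. Q z k) \<longleftrightarrow>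
      (\<forall>r t j. machine_rules z r t j) \<and> (\<forall>p x s y. hierarchy_rules a i z p x s y)" for z
  proof
    assume Q: "\<forall>k. Q z k"
    have "machine_rules z r t j" for r t j
      using spec[OF Q, of "pair r (pair t j)"] by (simp add: Q_def)
    moreover have "hierarchy_rules a i z p x s y" for p x s y
      using spec[OF Q, of "pair p (pair x (pair s y))"] by (simp add: Q_def)
    ultimately show "(\<forall>r t j. machine_rules z r t j) \<and> (\<forall>p x s y. hierarchy_rules a i z p x s y)"
      by blast
  qed (simp add: Q_def)
  have col: "column_set z c = ?X" if "\<forall>k. Q z k" for z
    using that column_sets[OF _ _ a G, of z] c unfolding Q by auto
  have R: "(\<forall>k. R z (pair n (pair b k)) \<noteq> 0) \<longleftrightarrow> (\<forall>k. Q z k) \<and> (n \<in> ?X \<longleftrightarrow> b \<noteq> 0)" for z n b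
  proof -
    have "(\<forall>k. R z (pair n (pair b k)) \<noteq> 0) \<longleftrightarrow> (\<forall>k. Q z k) \<and> (n \<in> column_set z c \<longleftrightarrow> b \<noteq> 0)"
      by (auto simp: R_def column_set_def)
    then show ?thesis
      using col[of z] by auto
  qed
  obtain z where "\<forall>k. Q z k"
    unfolding Q using ex_hierarchy_rules[OF a G] by metis
  then have "(\<exists>z. \<forall>k. R z (pair n (pair b k)) \<noteq> 0) \<longleftrightarrow> (n \<in> ?X \<longleftrightarrow> b \<noteq> 0)" for n b
    unfolding R by blast
  moreover have "local_fun R"
    unfolding R_def Q_def
    by (intro local_intro local_machine_rules local_hierarchy_rules)
  ultimately show ?thesis
    using f by (intro local_condition_reducible[of R]) auto
qed

lemma diagonal_not_reducible: "\<not> diagonal G \<le>\<^sub>T G"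
proof
  assume "diagonal G \<le>\<^sub>T G"
  then obtain e where "tm_computes G e e (of_bool (e \<in> diagonal G))"
    by (auto simp: turing_reducible_def tm_decides_def)
  then show False
    using tm_computes_unique[of G e e 0 1] by (cases "e \<in> diagonal G") (auto simp: diagonal_def)
qed

theorem theorem5p1:
  shows "(\<not> (\<exists>f :: nat \<times> nat \<Rightarrow> nat. hyperarithmetic (fun_graph f) \<and> calculates_maximal_chains f)) \<and>
    (\<forall>f :: nat \<times> nat \<Rightarrow> nat. calculates_maximal_chains f \<longrightarrow>
       (\<forall>X :: nat set. hyperarithmetic X \<longrightarrow> X \<le>\<^sub>T fun_graph f))"
proof (intro conjI allI impI notI)
  fix f X
  assume f: "calculates_maximal_chains f" and "hyperarithmetic X"
  then obtain a H i where "iterated_jump a H" "tm_decides H i X"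
    unfolding hyperarithmetic_def turing_reducible_def by blast
  from hierarchy_column_reducible[OF this _ f, of 7] show "X \<le>\<^sub>T fun_graph f"
    by simp
next
  assume "\<exists>f. hyperarithmetic (fun_graph f) \<and> calculates_maximal_chains f"
  then obtain f a H i where f: "calculates_maximal_chains f"
    and "iterated_jump a H" "tm_decides H i (fun_graph f)"
    unfolding hyperarithmetic_def turing_reducible_def by blast
  from hierarchy_column_reducible[OF this(2,3) _ f, of 14] have "diagonal (fun_graph f) \<le>\<^sub>T fun_graph f"
    by simp
  then show False
    using diagonal_not_reducible by blast
qed

end
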